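(* Let the constant parameters satisfy $3\alpha_0+\alpha_1+2\alpha_2+\alpha_3+2\alpha_4+2\alpha_5+\alpha_6=0$ and consider the system $\frac{dq}{dt}=\frac{\partial I}{\partial p}$, $\frac{dp}{dt}=-\frac{\partial I}{\partial q}$ with the Hamiltonian $I$ given in the context. This system admits extended affine Weyl group symmetry of type $E_6^{(1)}$ as the group of its Bäcklund transformations, whose generators $s_0,\dots,s_6,\pi_1,\pi_2,\pi_3$ are explicitly given, with the notation $( * )=(q,p,t;\alpha_0,\alpha_1,\dots,\alpha_6)$, by $$\begin{aligned} s_0:( * )&\to\left(q+\tfrac{\alpha_0}{p},p,t;-\alpha_0,\alpha_1,\alpha_2+\alpha_0,\alpha_3,\alpha_4+\alpha_0,\alpha_5+\alpha_0,\alpha_6\right),\\ s_1:( * )&\to(q,p,t;\alpha_0,-\alpha_1,\alpha_2+\alpha_1,\alpha_3,\alpha_4,\alpha_5,\alpha_6),\\ s_2:( * )&\to\left(q,p-\tfrac{\alpha_2}{q},t;\alpha_0+\alpha_2,\alpha_1+\alpha_2,-\alpha_2,\alpha_3,\alpha_4,\alpha_5,\alpha_6\right),\\ s_3:( * )&\to(q,p,t;\alpha_0,\alpha_1,\alpha_2,-\alpha_3,\alpha_4+\alpha_3,\alpha_5,\alpha_6),\\ s_4:( * )&\to\left(q,p-\tfrac{\alpha_4}{q-1},t;\alpha_0+\alpha_4,\alpha_1,\alpha_2,\alpha_3+\alpha_4,-\alpha_4,\alpha_5,\alpha_6\right),\\ s_5:( * )&\to(q,p,t;\alpha_0+\alpha_5,\alpha_1,\alpha_2,\alpha_3,\alpha_4,-\alpha_5,\alpha_6+\alpha_5),\\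 s_6:( * )&\to(q,p,t;\alpha_0,\alpha_1,\alpha_2,\alpha_3,\alpha_4,\alpha_5+\alpha_6,-\alpha_6),\\ \pi_1:( * )&\to(1-q,-p,1-t;\alpha_0,\alpha_3,\alpha_4,\alpha_1,\alpha_2,\alpha_5,\alpha_6),\\ \pi_2:( * )&\to\left(\tfrac1q,-(qp+\alpha_0)q,-t;\alpha_0,\alpha_6,\alpha_5,\alpha_3,\alpha_4,\alpha_2,\alpha_1\right),\\ \pi_3:( * )&\to\left(\tfrac{q}{q-1},-(q-1)((q-1)p+\alpha_0),2-t;\alpha_0,\alpha_1,\alpha_2,\alpha_6,\alpha_5,\alpha_4,\alpha_3\right), \end{aligned}$$ where $\pi_1,\pi_2,\pi_3$ are Dynkin diagram automorphisms of type $E_6^{(1)}$.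
   Context: The Hamiltonian is $$\begin{aligned} I={}&(q-1)^2q^2p^3-q(q-1)\{(\alpha_1+2\alpha_2+\alpha_3+2\alpha_4)q-\alpha_1-2\alpha_2\}p^2\\ &+\big[\{-3\alpha_0^2-2\alpha_0(\alpha_1+2\alpha_2+\alpha_3+2\alpha_4)-3\alpha_0\alpha_5-\alpha_5(\alpha_1+2\alpha_2+\alpha_3+2\alpha_4+\alpha_5)\}q^2\\ &\quad+\{3\alpha_0^2-\alpha_2^2+2\alpha_0(\alpha_1+2\alpha_2+\alpha_3+2\alpha_4)+3\alpha_0\alpha_5+2\alpha_2\alpha_5+\alpha_1(\alpha_5-\alpha_2)\\ &\quad\quad+(\alpha_4+\alpha_5)(\alpha_3+\alpha_4+\alpha_5)\}q+\alpha_2(\alpha_1+\alpha_2)\big]p\\ &+\alpha_0(\alpha_0+\alpha_5)(\alpha_0+\alpha_5+\alpha_6)q . \end{aligned}$$ Each listed transformation $w$ sends each entry of $( * )$ to the corresponding entry on the right; e.g. $s_0(q)=q+\alpha_0/p$, $s_0(p)=p$, $s_0(t)=t$, $s_0(\alpha_0)=-\alpha_0$, $s_0(\alpha_2)=\alpha_2+\alpha_0$. It is a Bäcklund transformation of the system if, whenever $(q,p)$ satisfies the system, $(w(q),w(p))$ satisfies the same system with time variable $w(t)$ and parameters $w(\alpha_i)$. The Dynkin diagram of type $E_6^{(1)}$ has nodes $0,\dots,6$ and edges $0\!-\!2$, $2\!-\!1$, $0\!-\!4$, $4\!-\!3$, $0\!-\!5$, $5\!-\!6$. The affine Weyl group $W(E_6^{(1)})$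 has generators $s_0,\dots,s_6$ and relations $s_i^2=1$, $(s_is_j)^3=1$ if $i,j$ are joined by an edge, $(s_is_j)^2=1$ if $i\neq j$ are not joined. The extended affine Weyl group $\tilde W(E_6^{(1)})$ is its extension by the diagram automorphisms.
   Formalization: The group generated by the listed transformations is shown to be the extended affine Weyl group only modulo pure time shifts t → t+c, because with the given actions on t the element (π1π2)^3 sends t to t−3 instead of being the identity. *)

theory Defs
  imports
    "HOL-Analysis.Analysis"
    "HOL-Algebra.Generated_Groups"
    "HOL-Combinatorics.Permutations"
    "HOL-Library.Poly_Mapping"
    "HOL-Computational_Algebra.Fraction_Field"
begin

section \<open>The Hamiltonian system\<close>

type_synonym 'k params = "'k \<times> 'k \<times> 'k \<times> 'k \<times> 'k \<times> 'k \<times> 'k"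

fun param_constraint :: "'k::field params \<Rightarrow> bool" where
  "param_constraint (a0, a1, a2, a3, a4, a5, a6) \<longleftrightarrow>
     3 * a0 + a1 + 2 * a2 + a3 + 2 * a4 + 2 * a5 + a6 = 0"

fun hamiltonian :: "complex params \<Rightarrow> complex \<Rightarrow> complex \<Rightarrow> complex" where
  "hamiltonian (a0, a1, a2, a3, a4, a5, a6) q p =
     (q - 1)^2 * q^2 * p^3
     - q * (q - 1) * ((a1 + 2 * a2 + a3 + 2 * a4) * q - a1 - 2 * a2) * p^2
     + ((- 3 * a0^2 - 2 * a0 * (a1 + 2 * a2 + a3 + 2 * a4) - 3 * a0 * a5
          - a5 * (a1 + 2 * a2 + a3 + 2 * a4 + a5)) * q^2
        + (3 * a0^2 - a2^2 + 2 * a0 * (a1 + 2 * a2 + a3 + 2 * a4) + 3 * a0 * a5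
          + 2 * a2 * a5 + a1 * (a5 - a2) + (a4 + a5) * (a3 + a4 + a5)) * q
        + a2 * (a1 + a2)) * p
     + a0 * (a0 + a5) * (a0 + a5 + a6) * q"

definition solves_system ::
  "complex set \<Rightarrow> complex params \<Rightarrow> (complex \<Rightarrow> complex) \<Rightarrow> (complex \<Rightarrow> complex) \<Rightarrow> bool" where
  "solves_system U a q p \<longleftrightarrow> open U \<and>
     (\<forall>t\<in>U. (q has_field_derivative deriv (\<lambda>y. hamiltonian a (q t) y) (p t)) (at t) \<and>
            (p has_field_derivative - deriv (\<lambda>x. hamiltonian a x (p t)) (q t)) (at t))"


section \<open>The transformations\<close>

datatype 'k config = Config 'k 'k 'k "'k params"

datatype gen = S0 | S1 | S2 | S3 | S4 | S5 | S6 | Pi1 | Pi2 | Pi3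

text \<open>The formulas are polymorphic in the field: they are used both for the values of a
  solution, in \<^typ>\<open>complex\<close>, and for the indeterminates in the field of rational functions.\<close>

fun bt :: "gen \<Rightarrow> 'k::field config \<Rightarrow> 'k config" where
  "bt S0 (Config q p t (a0, a1, a2, a3, a4, a5, a6)) =
     Config (q + a0 / p) p t (- a0, a1, a2 + a0, a3, a4 + a0, a5 + a0, a6)"
| "bt S1 (Config q p t (a0, a1, a2, a3, a4, a5, a6)) =
     Config q p t (a0, - a1, a2 + a1, a3, a4, a5, a6)"
| "bt S2 (Config q p t (a0, a1, a2, a3, a4, a5, a6)) =
     Config q (p - a2 / q) t (a0 + a2, a1 + a2, - a2, a3, a4, a5, a6)"
| "bt S3 (Config q p t (a0, a1, a2, a3, a4, a5, a6)) =
     Config q p t (a0, a1, a2, - a3, a4 + a3, a5, a6)"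
| "bt S4 (Config q p t (a0, a1, a2, a3, a4, a5, a6)) =
     Config q (p - a4 / (q - 1)) t (a0 + a4, a1, a2, a3 + a4, - a4, a5, a6)"
| "bt S5 (Config q p t (a0, a1, a2, a3, a4, a5, a6)) =
     Config q p t (a0 + a5, a1, a2, a3, a4, - a5, a6 + a5)"
| "bt S6 (Config q p t (a0, a1, a2, a3, a4, a5, a6)) =
     Config q p t (a0, a1, a2, a3, a4, a5 + a6, - a6)"
| "bt Pi1 (Config q p t (a0, a1, a2, a3, a4, a5, a6)) =
     Config (1 - q) (- p) (1 - t) (a0, a3, a4, a1, a2, a5, a6)"
| "bt Pi2 (Config q p t (a0, a1, a2, a3, a4, a5, a6)) =
     Config (1 / q) (- (q * p + a0) * q) (- t) (a0, a6, a5, a3, a4, a2, a1)"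
| "bt Pi3 (Config q p t (a0, a1, a2, a3, a4, a5, a6)) =
     Config (q / (q - 1)) (- (q - 1) * ((q - 1) * p + a0)) (2 - t) (a0, a1, a2, a6, a5, a4, a3)"

text \<open>The denominators of the transformation do not vanish.\<close>

fun bt_defined :: "gen \<Rightarrow> 'k::field \<Rightarrow> 'k \<Rightarrow> bool" where
  "bt_defined S0 q p \<longleftrightarrow> p \<noteq> 0"
| "bt_defined S2 q p \<longleftrightarrow> q \<noteq> 0"
| "bt_defined S4 q p \<longleftrightarrow> q - 1 \<noteq> 0"
| "bt_defined Pi2 q p \<longleftrightarrow> q \<noteq> 0"
| "bt_defined Pi3 q p \<longleftrightarrow> q - 1 \<noteq> 0"
| "bt_defined _ q p \<longleftrightarrow> True"

text \<open>On \<open>\<tau> ` U\<close> the new functions \<open>Q\<close>, \<open>P\<close> of the new time are determined by the equation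
  for \<^const>\<open>bt\<close>, since every point of that set is some \<open>\<tau> t\<close>.\<close>

definition backlund_transformation :: "gen \<Rightarrow> bool" where
  "backlund_transformation g \<longleftrightarrow>
     (\<forall>U a q p.
        param_constraint a \<and> solves_system U a q p \<and> (\<forall>t\<in>U. bt_defined g (q t) (p t)) \<longrightarrow>
        (\<exists>\<tau> b Q P.
           (\<forall>t\<in>U. bt g (Config (q t) (p t) t a) = Config (Q (\<tau> t)) (P (\<tau> t)) (\<tau> t) b) \<and>
           param_constraint b \<and> solves_system (\<tau> ` U) b Q P))"


section \<open>The field of rational functions and the group generated by the transformations\<close>

text \<open>Coordinates on the hyperplane \<^const>\<open>param_constraint\<close>: the parameter \<open>\<alpha>\<^sub>1\<close> is expressed
  through the other ones. The linear order is only needed for the \<^class>\<open>idom\<close> instance of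
  \<open>\<Rightarrow>\<^sub>0\<close>.\<close>

datatype var = Var_q | Var_p | Var_t | Var_a0 | Var_a2 | Var_a3 | Var_a4 | Var_a5 | Var_a6

fun var_index :: "var \<Rightarrow> nat" where
  "var_index Var_q = 0" | "var_index Var_p = 1" | "var_index Var_t = 2"
| "var_index Var_a0 = 3" | "var_index Var_a2 = 4" | "var_index Var_a3 = 5"
| "var_index Var_a4 = 6" | "var_index Var_a5 = 7" | "var_index Var_a6 = 8"

lemma var_index_inject: "var_index x = var_index y \<longleftrightarrow> x = y"
  by (cases x; cases y) simp_all

instantiation var :: linorder
begin

definition less_eq_var :: "var \<Rightarrow> var \<Rightarrow> bool" where
  "less_eq_var x y \<longleftrightarrow> var_index x \<le> var_index y"

definition less_var :: "var \<Rightarrow> var \<Rightarrow> bool" where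
  "less_var x y \<longleftrightarrow> var_index x < var_index y"

instance
  by standard (auto simp: less_eq_var_def less_var_def var_index_inject[symmetric])

end

type_synonym ratfun = "((var \<Rightarrow>\<^sub>0 nat) \<Rightarrow>\<^sub>0 complex) fract"

definition rf_const :: "complex \<Rightarrow> ratfun" where
  "rf_const c = Fract (Poly_Mapping.single 0 c) 1"

definition rf_var :: "var \<Rightarrow> ratfun" where
  "rf_var v = Fract (Poly_Mapping.single (Poly_Mapping.single v 1) 1) 1"

definition generic_params :: "ratfun params" where
  "generic_params =
     (rf_var Var_a0,
      - (3 * rf_var Var_a0 + 2 * rf_var Var_a2 + rf_var Var_a3 + 2 * rf_var Var_a4
         + 2 * rf_var Var_a5 + rf_var Var_a6),
      rf_var Var_a2, rf_var Var_a3, rf_var Var_a4, rf_var Var_a5, rf_var Var_a6)"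

definition generic_config :: "ratfun config" where
  "generic_config = Config (rf_var Var_q) (rf_var Var_p) (rf_var Var_t) generic_params"

definition ratfun_Aut :: "(ratfun \<Rightarrow> ratfun) monoid" where
  "ratfun_Aut =
     \<lparr>carrier = {\<sigma>. bij \<sigma> \<and> (\<forall>x y. \<sigma> (x + y) = \<sigma> x + \<sigma> y) \<and> (\<forall>x y. \<sigma> (x * y) = \<sigma> x * \<sigma> y) \<and>
                   (\<forall>c. \<sigma> (rf_const c) = rf_const c)},
      monoid.mult = (\<circ>),
      one = id\<rparr>"

definition induces :: "gen \<Rightarrow> (ratfun \<Rightarrow> ratfun) \<Rightarrow> bool" where
  "induces g \<sigma> \<longleftrightarrow> \<sigma> \<in> carrier ratfun_Aut \<and> map_config \<sigma> generic_config = bt g generic_config"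

definition bt_aut :: "gen \<Rightarrow> ratfun \<Rightarrow> ratfun" where
  "bt_aut g = (THE \<sigma>. induces g \<sigma>)"

definition bt_group :: "(ratfun \<Rightarrow> ratfun) monoid" where
  "bt_group = ratfun_Aut\<lparr>carrier := generate ratfun_Aut (range bt_aut)\<rparr>"

text \<open>The system is autonomous, so the origin of time is immaterial. On \<open>t\<close> itself the
  relations between the \<open>\<pi>\<^sub>j\<close> hold only up to such a shift: \<open>\<pi>\<^sub>1 \<pi>\<^sub>2\<close> sends \<open>t\<close> to \<open>t - 1\<close>, while
  the corresponding diagram automorphism has order three.\<close>

definition time_shifts :: "(ratfun \<Rightarrow> ratfun) set" where
  "time_shifts =
     {\<sigma> \<in> carrier bt_group.
        \<exists>c. map_config \<sigma> generic_config =
            Config (rf_var Var_q) (rf_var Var_p) (rf_var Var_t + rf_const c) generic_params}"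


section \<open>The extended affine Weyl group of type \<open>E\<^sub>6\<^sup>(\<^sup>1\<^sup>)\<close>\<close>

definition E6_nodes :: "nat set" where
  "E6_nodes = {0..6}"

definition E6_edges :: "nat set set" where
  "E6_edges = {{0, 2}, {2, 1}, {0, 4}, {4, 3}, {0, 5}, {5, 6}}"

definition E6_diagram_auts :: "(nat \<Rightarrow> nat) set" where
  "E6_diagram_auts =
     {\<pi>. \<pi> permutes E6_nodes \<and>
         (\<forall>i\<in>E6_nodes. \<forall>j\<in>E6_nodes. {\<pi> i, \<pi> j} \<in> E6_edges \<longleftrightarrow> {i, j} \<in> E6_edges)}"

definition E6_order :: "nat \<Rightarrow> nat \<Rightarrow> nat" where
  "E6_order i j = (if i = j then 1 else if {i, j} \<in> E6_edges then 3 else 2)"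

text \<open>A word \<open>[i\<^sub>1, \<dots>, i\<^sub>k]\<close> stands for the product \<open>s\<^bsub>i\<^sub>1\<^esub> \<cdots> s\<^bsub>i\<^sub>k\<^esub>\<close>. Formal inverses are not
  needed since the defining relations make the generators involutions.\<close>

inductive E6_word_eq :: "nat list \<Rightarrow> nat list \<Rightarrow> bool" where
  refl: "w \<in> lists E6_nodes \<Longrightarrow> E6_word_eq w w"
| sym: "E6_word_eq u v \<Longrightarrow> E6_word_eq v u"
| trans: "E6_word_eq u v \<Longrightarrow> E6_word_eq v w \<Longrightarrow> E6_word_eq u w"
| rel: "i \<in> E6_nodes \<Longrightarrow> j \<in> E6_nodes \<Longrightarrow> u \<in> lists E6_nodes \<Longrightarrow> v \<in> lists E6_nodes \<Longrightarrow>
        E6_word_eq (u @ concat (replicate (E6_order i j) [i, j]) @ v) (u @ v)"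

definition E6_class :: "nat list \<Rightarrow> nat list set" where
  "E6_class w = {v. E6_word_eq w v}"

definition affine_weyl_E6 :: "nat list set monoid" where
  "affine_weyl_E6 =
     \<lparr>carrier = E6_class ` lists E6_nodes,
      monoid.mult = (\<lambda>X Y. \<Union>x\<in>X. \<Union>y\<in>Y. E6_class (x @ y)),
      one = E6_class []\<rparr>"

text \<open>The semidirect product with the diagram automorphisms, which permute the generators.\<close>

definition ext_affine_weyl_E6 :: "(nat list set \<times> (nat \<Rightarrow> nat)) monoid" where
  "ext_affine_weyl_E6 =
     \<lparr>carrier = carrier affine_weyl_E6 \<times> E6_diagram_auts,
      monoid.mult = (\<lambda>(X, \<pi>) (Y, \<rho>). (X \<otimes>\<^bsub>affine_weyl_E6\<^esub> (map \<pi> ` Y), \<pi> \<circ> \<rho>)),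
      one = (\<one>\<^bsub>affine_weyl_E6\<^esub>, id)\<rparr>"

fun E6_gen :: "gen \<Rightarrow> nat list set \<times> (nat \<Rightarrow> nat)" where
  "E6_gen S0 = (E6_class [0], id)"
| "E6_gen S1 = (E6_class [1], id)"
| "E6_gen S2 = (E6_class [2], id)"
| "E6_gen S3 = (E6_class [3], id)"
| "E6_gen S4 = (E6_class [4], id)"
| "E6_gen S5 = (E6_class [5], id)"
| "E6_gen S6 = (E6_class [6], id)"
| "E6_gen Pi1 = (E6_class [], Transposition.transpose 1 3 \<circ> Transposition.transpose 2 4)"
| "E6_gen Pi2 = (E6_class [], Transposition.transpose 1 6 \<circ> Transposition.transpose 2 5)"
| "E6_gen Pi3 = (E6_class [], Transposition.transpose 3 6 \<circ> Transposition.transpose 4 5)"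

end

theory Submission
  imports Defs "HOL-Computational_Algebra.Formal_Laurent_Series"
begin

text \<open>
  The system is covariant because each generator is symplectic and preserves the Hamiltonian up to
  sign and an additive constant. The relations of the extended affine Weyl group are identities of
  rational functions, and the \<open>\<pi>\<^sub>j\<close> satisfy those of the diagram automorphisms up to a shift of
  the time.

  The point is faithfulness. The null root vanishes, so translations act trivially on the
  parameters and must be detected on \<open>(q, p)\<close>. Blow up the point \<open>(q, p) = (0, \<infinity>)\<close>: the exceptional
  curve, with coordinate \<open>x = qp\<close>, is a component of the fibre \<open>I = \<infinity>\<close>, it is preserved by
  \<open>s\<^sub>0, \<dots>, s\<^sub>6\<close>, and on it \<open>s\<^sub>0\<close> and \<open>s\<^sub>2\<close> act by \<open>x \<mapsto> x + \<alpha>\<^sub>0\<close> and \<open>x \<mapsto> x - \<alpha>\<^sub>2\<close> while the other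
  generators fix \<open>x\<close>. So \<open>x\<close> and the \<open>\<alpha>\<^sub>i\<close> span the reflection representation on the weight space
  modulo the null root, with \<open>x\<close> of nonzero level, and this representation is faithful by Tits'
  theorem. Nontrivial rotations of the diagram are excluded because they move the exceptional
  curve, and reflections because they reverse the time.
\<close>

section \<open>Covariance of the Hamiltonian system\<close>

text \<open>Tits' theorem concerns the action on the root lattice itself, while rational functions
  show a vector only modulo the null root, and modulo the null root translations fix every simple
  root. An invariant bilinear form closes this gap: the null root is orthogonal to all simple roots
  but pairs to -1 with \<open>x\<close>, so a word that preserves the pairings with \<open>x\<close>
  cannot add multiples of the null root to simple roots. The other obstacle is that a substitution
  acts on rational functions only where denominators survive. It is kept as a single-valued relation
  \<open>ev\<close> and carried along a word letter by letter. This succeeds at the blown-up curve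
  because reflections never change the coefficient of \<open>x\<close>, so the leading coefficients
  that occur contain \<open>qp\<close> and cannot vanish. The same relation yields the
  automorphisms: each generator is its own inverse, which makes its substitution injective on
  polynomials.\<close>

fun ham_s :: "complex params \<Rightarrow> complex" where
  "ham_s (a0, a1, a2, a3, a4, a5, a6) = a1 + 2 * a2 + a3 + 2 * a4"
fun ham_k :: "complex params \<Rightarrow> complex" where
  "ham_k (a0, a1, a2, a3, a4, a5, a6) = a1 + 2 * a2"
fun ham_A :: "complex params \<Rightarrow> complex" where
  "ham_A (a0, a1, a2, a3, a4, a5, a6) =
     - 3 * a0^2 - 2 * a0 * (a1 + 2 * a2 + a3 + 2 * a4) - 3 * a0 * a5
          - a5 * (a1 + 2 * a2 + a3 + 2 * a4 + a5)"
fun ham_B :: "complex params \<Rightarrow> complex" where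
  "ham_B (a0, a1, a2, a3, a4, a5, a6) =
     3 * a0^2 - a2^2 + 2 * a0 * (a1 + 2 * a2 + a3 + 2 * a4) + 3 * a0 * a5
          + 2 * a2 * a5 + a1 * (a5 - a2) + (a4 + a5) * (a3 + a4 + a5)"
fun ham_C :: "complex params \<Rightarrow> complex" where
  "ham_C (a0, a1, a2, a3, a4, a5, a6) = a2 * (a1 + a2)"
fun ham_D :: "complex params \<Rightarrow> complex" where
  "ham_D (a0, a1, a2, a3, a4, a5, a6) = a0 * (a0 + a5) * (a0 + a5 + a6)"

text \<open>The parameters enter only through six coefficients. Both partial derivatives are then
  short, and the additive constants in the covariance lemmas become polynomials in these
  coefficients and one parameter.\<close>

lemma hamiltonian_coeffs:
  "hamiltonian a q p = (q - 1)^2 * q^2 * p^3 - q * (q - 1) * (ham_s a * q - ham_k a) * p^2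
     + (ham_A a * q^2 + ham_B a * q + ham_C a) * p + ham_D a * q"
  by (cases a) (simp add: algebra_simps)

definition ham_q :: "complex params \<Rightarrow> complex \<Rightarrow> complex \<Rightarrow> complex" where
  "ham_q a q p = 2 * (q - 1) * q * (2 * q - 1) * p^3
     - ((2 * q - 1) * (ham_s a * q - ham_k a) + q * (q - 1) * ham_s a) * p^2
     + (2 * ham_A a * q + ham_B a) * p + ham_D a"

definition ham_p :: "complex params \<Rightarrow> complex \<Rightarrow> complex \<Rightarrow> complex" where
  "ham_p a q p = 3 * (q - 1)^2 * q^2 * p^2 - 2 * q * (q - 1) * (ham_s a * q - ham_k a) * p
     + (ham_A a * q^2 + ham_B a * q + ham_C a)"

lemma hamiltonian_chain:
  assumes "(u has_field_derivative u') (at t)" "(v has_field_derivative v') (at t)"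
  shows "((\<lambda>t. hamiltonian a (u t) (v t)) has_field_derivative
           ham_q a (u t) (v t) * u' + ham_p a (u t) (v t) * v') (at t)"
  unfolding hamiltonian_coeffs ham_q_def ham_p_def
  by (rule DERIV_cong, (rule derivative_intros assms)+) (simp add: algebra_simps power2_eq_square power3_eq_cube)

lemma deriv_hamiltonian_q: "deriv (\<lambda>x. hamiltonian a x p) q = ham_q a q p"
  using hamiltonian_chain[OF DERIV_ident[of "at q"] DERIV_const[of p "at q"], of a]
  by (simp add: DERIV_imp_deriv)

lemma deriv_hamiltonian_p: "deriv (\<lambda>y. hamiltonian a q y) p = ham_p a q p"
  using hamiltonian_chain[OF DERIV_const[of q "at p"] DERIV_ident[of "at p"], of a]
  by (simp add: DERIV_imp_deriv)

lemma solves_system_iff: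
  "solves_system U a q p \<longleftrightarrow> open U \<and>
     (\<forall>t\<in>U. (q has_field_derivative ham_p a (q t) (p t)) (at t) \<and>
            (p has_field_derivative - ham_q a (q t) (p t)) (at t))"
  by (simp add: solves_system_def deriv_hamiltonian_q deriv_hamiltonian_p)

text \<open>Every generator is a symplectic change of coordinates that preserves the Hamiltonian up to
  the sign of the time change and an additive constant; by the chain rule this suffices. The constants are obtained by comparing the
  coefficients of \<open>q\<^sup>0p\<^sup>0\<close> (of \<open>(q - 1)\<^sup>0p\<^sup>0\<close> for \<open>s\<^sub>4\<close> and \<open>\<pi>\<^sub>3\<close>).\<close>

lemma backlund_criterion:
  fixes F G Fx Fy Gx Gy :: "complex \<Rightarrow> complex \<Rightarrow> complex" and e k c :: complex
  assumes sol: "solves_system U a q p"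
    and b: "param_constraint b"
    and e: "e * e = 1"
    and bt: "\<And>t. t \<in> U \<Longrightarrow> bt g (Config (q t) (p t) t a) = Config (F (q t) (p t)) (G (q t) (p t)) (e * t + k) b"
    and def: "\<And>t. t \<in> U \<Longrightarrow> bt_defined g (q t) (p t)"
    and dom: "\<And>p. open {q. bt_defined g (q :: complex) (p :: complex)}" "\<And>q. open {p. bt_defined g (q :: complex) (p :: complex)}"
    and F: "\<And>u v u' v' t. (u has_field_derivative u') (at t) \<Longrightarrow> (v has_field_derivative v') (at t) \<Longrightarrow>
       bt_defined g (u t) (v t) \<Longrightarrow>
       ((\<lambda>t. F (u t) (v t)) has_field_derivative Fx (u t) (v t) * u' + Fy (u t) (v t) * v') (at t)"
    and G: "\<And>u v u' v' t. (u has_field_derivative u') (at t) \<Longrightarrow> (v has_field_derivative v') (at t) \<Longrightarrow>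
       bt_defined g (u t) (v t) \<Longrightarrow>
       ((\<lambda>t. G (u t) (v t)) has_field_derivative Gx (u t) (v t) * u' + Gy (u t) (v t) * v') (at t)"
    and jac: "\<And>x y. bt_defined g x y \<Longrightarrow> Fx x y * Gy x y - Fy x y * Gx x y = 1"
    and ham: "\<And>x y. bt_defined g x y \<Longrightarrow> hamiltonian b (F x y) (G x y) = e * hamiltonian a x y + c"
  shows "\<exists>\<tau> b Q P.
           (\<forall>t\<in>U. bt g (Config (q t) (p t) t a) = Config (Q (\<tau> t)) (P (\<tau> t)) (\<tau> t) b) \<and>
           param_constraint b \<and> solves_system (\<tau> ` U) b Q P"
proof -
  define \<tau> where "\<tau> t = e * t + k" for t
  define \<tau>' where "\<tau>' s = e * (s - k)" for s
  have inv: "\<tau>' (\<tau> t) = t" "\<tau> (\<tau>' t) = t" for t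
    using e by (simp_all add: \<tau>_def \<tau>'_def algebra_simps flip: mult.assoc)
  define Q where "Q s = F (q (\<tau>' s)) (p (\<tau>' s))" for s
  define P where "P s = G (q (\<tau>' s)) (p (\<tau>' s))" for s
  \<comment> \<open>These identities come from differentiating \<open>ham\<close> along the two
    coordinate lines through \<open>(x, y)\<close>. As \<open>ham\<close> holds only off the
    denominators, the functions are compared on the open sets from \<open>dom\<close>.\<close>
  have grad:
    "ham_q b (F x y) (G x y) * Fx x y + ham_p b (F x y) (G x y) * Gx x y = e * ham_q a x y"
    "ham_q b (F x y) (G x y) * Fy x y + ham_p b (F x y) (G x y) * Gy x y = e * ham_p a x y"
    if d: "bt_defined g x y" for x y
  proof -
    note Fd = F[of "\<lambda>t. t" 1 x "\<lambda>t. y" 0, OF DERIV_ident DERIV_const d]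
    note Gd = G[of "\<lambda>t. t" 1 x "\<lambda>t. y" 0, OF DERIV_ident DERIV_const d]
    have "((\<lambda>t. e * hamiltonian a t y + c) has_field_derivative
        ham_q b (F x y) (G x y) * Fx x y + ham_p b (F x y) (G x y) * Gx x y) (at x)"
      using has_field_derivative_transform_within_open[OF hamiltonian_chain[OF Fd Gd, of b] dom(1)[of y]] d ham
      by simp
    moreover have "((\<lambda>t. e * hamiltonian a t y + c) has_field_derivative e * ham_q a x y) (at x)"
      using DERIV_add[OF DERIV_cmult[OF hamiltonian_chain[OF DERIV_ident[of "at x"] DERIV_const[of y "at x"]], of e a] DERIV_const[of c]]
      by simp
    ultimately show "ham_q b (F x y) (G x y) * Fx x y + ham_p b (F x y) (G x y) * Gx x y = e * ham_q a x y"
      by (rule DERIV_unique)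
    note Fd = F[of "\<lambda>t. x" 0 y "\<lambda>t. t" 1, OF DERIV_const DERIV_ident d]
    note Gd = G[of "\<lambda>t. x" 0 y "\<lambda>t. t" 1, OF DERIV_const DERIV_ident d]
    have "((\<lambda>t. e * hamiltonian a x t + c) has_field_derivative
        ham_q b (F x y) (G x y) * Fy x y + ham_p b (F x y) (G x y) * Gy x y) (at y)"
      using has_field_derivative_transform_within_open[OF hamiltonian_chain[OF Fd Gd, of b] dom(2)[of x]] d ham
      by simp
    moreover have "((\<lambda>t. e * hamiltonian a x t + c) has_field_derivative e * ham_p a x y) (at y)"
      using DERIV_add[OF DERIV_cmult[OF hamiltonian_chain[OF DERIV_const[of x "at y"] DERIV_ident[of "at y"]], of e a] DERIV_const[of c]]
      by simp
    ultimately show "ham_q b (F x y) (G x y) * Fy x y + ham_p b (F x y) (G x y) * Gy x y = e * ham_p a x y"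
      by (rule DERIV_unique)
  qed
  have "\<tau> ` U = \<tau>' -` U"
    using inv by (auto intro: rev_image_eqI)
  moreover have "continuous_on UNIV \<tau>'"
    unfolding \<tau>'_def by (intro continuous_intros)
  ultimately have "open (\<tau> ` U)"
    using sol by (simp add: solves_system_def open_vimage)
  moreover have "(Q has_field_derivative ham_p b (Q s) (P s)) (at s) \<and>
                 (P has_field_derivative - ham_q b (Q s) (P s)) (at s)" if "s \<in> \<tau> ` U" for s
  proof -
    let ?t = "\<tau>' s"
    have t: "?t \<in> U" using that inv by auto
    let ?x = "q ?t" and ?y = "p ?t"
    have d: "bt_defined g ?x ?y" using t def by blast
    have q: "(q has_field_derivative ham_p a ?x ?y) (at ?t)"
      and p: "(p has_field_derivative - ham_q a ?x ?y) (at ?t)"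
      using sol t by (auto simp: solves_system_iff)
    have \<tau>'d: "(\<tau>' has_field_derivative e) (at s)"
      unfolding \<tau>'_def by (auto intro!: derivative_eq_intros)
    have q': "((\<lambda>s. q (\<tau>' s)) has_field_derivative ham_p a ?x ?y * e) (at s)"
      by (rule DERIV_chain2[OF q \<tau>'d])
    have p': "((\<lambda>s. p (\<tau>' s)) has_field_derivative - ham_q a ?x ?y * e) (at s)"
      by (rule DERIV_chain2[OF p \<tau>'d])
    \<comment> \<open>The gradient identities are linear in \<open>ham_p b\<close> and
      \<open>ham_q b\<close> with determinant 1 by \<open>jac\<close>, so Cramer's rule gives the
      new vector field. The factor \<open>e\<close> is the derivative of the inverse time
      change.\<close>
    have "Fx ?x ?y * (ham_p a ?x ?y * e) + Fy ?x ?y * (- ham_q a ?x ?y * e) = ham_p b (Q s) (P s)"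
      using grad[OF d] jac[OF d] unfolding Q_def P_def by algebra
    moreover have "Gx ?x ?y * (ham_p a ?x ?y * e) + Gy ?x ?y * (- ham_q a ?x ?y * e) = - ham_q b (Q s) (P s)"
      using grad[OF d] jac[OF d] unfolding Q_def P_def by algebra
    ultimately show ?thesis
      using F[OF q' p' d] G[OF q' p' d] by (simp add: Q_def[abs_def] P_def[abs_def])
  qed
  ultimately have "solves_system (\<tau> ` U) b Q P"
    by (simp add: solves_system_iff)
  moreover have "\<forall>t\<in>U. bt g (Config (q t) (p t) t a) = Config (Q (\<tau> t)) (P (\<tau> t)) (\<tau> t) b"
    using bt inv by (simp add: Q_def P_def \<tau>_def[symmetric])
  ultimately show ?thesis
    using b by blast
qed

lemma open_neq [simp]: "open {x. x \<noteq> (c::complex)}"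
  by (rule open_Collect_neq) (auto intro: continuous_intros)

lemma param_constraint_iff:
  "param_constraint (a0, a1, a2, a3, a4, a5, a6) \<longleftrightarrow>
     a1 = - (3 * a0 + 2 * a2 + a3 + 2 * a4 + 2 * a5 + a6)"
proof -
  have "3 * a0 + a1 + 2 * a2 + a3 + 2 * a4 + 2 * a5 + a6 =
        a1 - - (3 * a0 + 2 * a2 + a3 + 2 * a4 + 2 * a5 + a6)"
    by simp
  then show ?thesis
    by (simp only: param_constraint.simps right_minus_eq)
qed

section \<open>Covariance under the ten generators, one at a time\<close>

lemma backlund_S0: "backlund_transformation S0"
  unfolding backlund_transformation_def
proof (intro allI impI, elim conjE, goal_cases)
  case (1 U a q p)
  obtain a0 a1 a2 a3 a4 a5 a6 where a: "a = (a0, a1, a2, a3, a4, a5, a6)"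
    by (cases a) auto
  let ?a = "(a0, a1, a2, a3, a4, a5, a6)"
  let ?b = "(- a0, a1, a2 + a0, a3, a4 + a0, a5 + a0, a6)"
  have a1: "a1 = - (3 * a0 + 2 * a2 + a3 + 2 * a4 + 2 * a5 + a6)"
    using 1(1) unfolding a by (simp only: param_constraint_iff)
  have ham: "hamiltonian ?b (x + a0 / y) y =
      1 * hamiltonian ?a x y + (- 2 * a0^3 + a0^2 * (ham_k ?b + ham_s ?b) + ham_B ?b * a0)"
    if "bt_defined S0 x y" for x y
  proof -
    \<comment> \<open>With the reciprocal as a new unknown subject to \<open>y * w = 1\<close>, and
      \<open>a1\<close> eliminated by the constraint, the claim becomes membership in a polynomial
      ideal, which \<open>algebra\<close> decides. The other generators with denominators are
      treated alike.\<close>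
    define w where "w = 1 / y"
    have w: "y * w = 1" using that by (simp add: w_def)
    have eq: "a0 / y = a0 * w" by (simp add: w_def)
    show ?thesis
      using w unfolding eq a1 hamiltonian.simps ham_s.simps ham_k.simps ham_A.simps ham_B.simps ham_D.simps by algebra
  qed
  have jac: "1 * 1 - (- a0 / y^2) * 0 = (1::complex)"
    if "bt_defined S0 x y" for x y
    using that by simp
  show ?case
    unfolding a
    by (rule backlund_criterion[where e = "1" and k = "0" and b = "?b"
          and F = "\<lambda>x y. x + a0 / y" and G = "\<lambda>x y. y"
          and Fx = "\<lambda>x y. 1" and Fy = "\<lambda>x y. - a0 / y^2"
          and Gx = "\<lambda>x y. 0" and Gy = "\<lambda>x y. 1",
          OF 1(2)[unfolded a] _ _ _ _ _ _ _ _ jac ham])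
      (use 1 in \<open>auto simp: a1 a field_simps power2_eq_square intro!: derivative_eq_intros\<close>)
qed

lemma backlund_S1: "backlund_transformation S1"
  unfolding backlund_transformation_def
proof (intro allI impI, elim conjE, goal_cases)
  case (1 U a q p)
  obtain a0 a1 a2 a3 a4 a5 a6 where a: "a = (a0, a1, a2, a3, a4, a5, a6)"
    by (cases a) auto
  let ?a = "(a0, a1, a2, a3, a4, a5, a6)"
  let ?b = "(a0, - a1, a2 + a1, a3, a4, a5, a6)"
  have a1: "a1 = - (3 * a0 + 2 * a2 + a3 + 2 * a4 + 2 * a5 + a6)"
    using 1(1) unfolding a by (simp only: param_constraint_iff)
  have ham: "hamiltonian ?b x y =
      1 * hamiltonian ?a x y + 0"
    if "bt_defined S1 x y" for x y
  proof -
    show ?thesis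
      unfolding a1 hamiltonian.simps ham_D.simps by algebra
  qed
  have jac: "1 * 1 - 0 * 0 = (1::complex)"
    if "bt_defined S1 x y" for x y
    using that by simp
  show ?case
    unfolding a
    by (rule backlund_criterion[where e = "1" and k = "0" and b = "?b"
          and F = "\<lambda>x y. x" and G = "\<lambda>x y. y"
          and Fx = "\<lambda>x y. 1" and Fy = "\<lambda>x y. 0"
          and Gx = "\<lambda>x y. 0" and Gy = "\<lambda>x y. 1",
          OF 1(2)[unfolded a] _ _ _ _ _ _ _ _ jac ham])
      (use 1 in \<open>auto simp: a1 a field_simps power2_eq_square intro!: derivative_eq_intros\<close>)
qed

lemma backlund_S2: "backlund_transformation S2"
  unfolding backlund_transformation_def
proof (intro allI impI, elim conjE, goal_cases)
  case (1 U a q p)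
  obtain a0 a1 a2 a3 a4 a5 a6 where a: "a = (a0, a1, a2, a3, a4, a5, a6)"
    by (cases a) auto
  let ?a = "(a0, a1, a2, a3, a4, a5, a6)"
  let ?b = "(a0 + a2, a1 + a2, - a2, a3, a4, a5, a6)"
  have a1: "a1 = - (3 * a0 + 2 * a2 + a3 + 2 * a4 + 2 * a5 + a6)"
    using 1(1) unfolding a by (simp only: param_constraint_iff)
  have ham: "hamiltonian ?b x (y - a2 / x) =
      1 * hamiltonian ?a x y + (2 * a2^3 + a2^2 * (ham_k ?b + ham_s ?b) - ham_B ?b * a2)"
    if "bt_defined S2 x y" for x y
  proof -
    define w where "w = 1 / x"
    have w: "x * w = 1" using that by (simp add: w_def)
    have eq: "a2 / x = a2 * w" by (simp add: w_def)
    show ?thesis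
      using w unfolding eq a1 hamiltonian.simps ham_s.simps ham_k.simps ham_A.simps ham_B.simps ham_D.simps by algebra
  qed
  have jac: "1 * 1 - 0 * (a2 / x^2) = (1::complex)"
    if "bt_defined S2 x y" for x y
    using that by simp
  show ?case
    unfolding a
    by (rule backlund_criterion[where e = "1" and k = "0" and b = "?b"
          and F = "\<lambda>x y. x" and G = "\<lambda>x y. y - a2 / x"
          and Fx = "\<lambda>x y. 1" and Fy = "\<lambda>x y. 0"
          and Gx = "\<lambda>x y. a2 / x^2" and Gy = "\<lambda>x y. 1",
          OF 1(2)[unfolded a] _ _ _ _ _ _ _ _ jac ham])
      (use 1 in \<open>auto simp: a1 a field_simps power2_eq_square intro!: derivative_eq_intros\<close>)
qed

lemma backlund_S3: "backlund_transformation S3"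
  unfolding backlund_transformation_def
proof (intro allI impI, elim conjE, goal_cases)
  case (1 U a q p)
  obtain a0 a1 a2 a3 a4 a5 a6 where a: "a = (a0, a1, a2, a3, a4, a5, a6)"
    by (cases a) auto
  let ?a = "(a0, a1, a2, a3, a4, a5, a6)"
  let ?b = "(a0, a1, a2, - a3, a4 + a3, a5, a6)"
  have a1: "a1 = - (3 * a0 + 2 * a2 + a3 + 2 * a4 + 2 * a5 + a6)"
    using 1(1) unfolding a by (simp only: param_constraint_iff)
  have ham: "hamiltonian ?b x y =
      1 * hamiltonian ?a x y + 0"
    if "bt_defined S3 x y" for x y
  proof -
    show ?thesis
      unfolding a1 hamiltonian.simps ham_D.simps by algebra
  qed
  have jac: "1 * 1 - 0 * 0 = (1::complex)"
    if "bt_defined S3 x y" for x y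
    using that by simp
  show ?case
    unfolding a
    by (rule backlund_criterion[where e = "1" and k = "0" and b = "?b"
          and F = "\<lambda>x y. x" and G = "\<lambda>x y. y"
          and Fx = "\<lambda>x y. 1" and Fy = "\<lambda>x y. 0"
          and Gx = "\<lambda>x y. 0" and Gy = "\<lambda>x y. 1",
          OF 1(2)[unfolded a] _ _ _ _ _ _ _ _ jac ham])
      (use 1 in \<open>auto simp: a1 a field_simps power2_eq_square intro!: derivative_eq_intros\<close>)
qed

lemma backlund_S4: "backlund_transformation S4"
  unfolding backlund_transformation_def
proof (intro allI impI, elim conjE, goal_cases)
  case (1 U a q p)
  obtain a0 a1 a2 a3 a4 a5 a6 where a: "a = (a0, a1, a2, a3, a4, a5, a6)"
    by (cases a) auto
  let ?a = "(a0, a1, a2, a3, a4, a5, a6)"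
  let ?b = "(a0 + a4, a1, a2, a3 + a4, - a4, a5, a6)"
  have a1: "a1 = - (3 * a0 + 2 * a2 + a3 + 2 * a4 + 2 * a5 + a6)"
    using 1(1) unfolding a by (simp only: param_constraint_iff)
  have ham: "hamiltonian ?b x (y - a4 / (x - 1)) =
      1 * hamiltonian ?a x y + (- 2 * a4^3 - a4^2 * (2 * ham_s ?b - ham_k ?b) - a4 * (2 * ham_A ?b + ham_B ?b) + ham_D ?b - ham_D ?a)"
    if "bt_defined S4 x y" for x y
  proof -
    define w where "w = 1 / (x - 1)"
    have w: "(x - 1) * w = 1" using that by (simp add: w_def)
    have eq: "a4 / (x - 1) = a4 * w" by (simp add: w_def)
    show ?thesis
      using w unfolding eq a1 hamiltonian.simps ham_s.simps ham_k.simps ham_A.simps ham_B.simps ham_D.simps by algebra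
  qed
  have jac: "1 * 1 - 0 * (a4 / (x - 1)^2) = (1::complex)"
    if "bt_defined S4 x y" for x y
    using that by simp
  show ?case
    unfolding a
    by (rule backlund_criterion[where e = "1" and k = "0" and b = "?b"
          and F = "\<lambda>x y. x" and G = "\<lambda>x y. y - a4 / (x - 1)"
          and Fx = "\<lambda>x y. 1" and Fy = "\<lambda>x y. 0"
          and Gx = "\<lambda>x y. a4 / (x - 1)^2" and Gy = "\<lambda>x y. 1",
          OF 1(2)[unfolded a] _ _ _ _ _ _ _ _ jac ham])
      (use 1 in \<open>auto simp: a1 a field_simps power2_eq_square intro!: derivative_eq_intros\<close>)
qed

lemma backlund_S5: "backlund_transformation S5"
  unfolding backlund_transformation_def
proof (intro allI impI, elim conjE, goal_cases)
  case (1 U a q p)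
  obtain a0 a1 a2 a3 a4 a5 a6 where a: "a = (a0, a1, a2, a3, a4, a5, a6)"
    by (cases a) auto
  let ?a = "(a0, a1, a2, a3, a4, a5, a6)"
  let ?b = "(a0 + a5, a1, a2, a3, a4, - a5, a6 + a5)"
  have a1: "a1 = - (3 * a0 + 2 * a2 + a3 + 2 * a4 + 2 * a5 + a6)"
    using 1(1) unfolding a by (simp only: param_constraint_iff)
  have ham: "hamiltonian ?b x y =
      1 * hamiltonian ?a x y + 0"
    if "bt_defined S5 x y" for x y
  proof -
    show ?thesis
      unfolding a1 hamiltonian.simps ham_D.simps by algebra
  qed
  have jac: "1 * 1 - 0 * 0 = (1::complex)"
    if "bt_defined S5 x y" for x y
    using that by simp
  show ?case
    unfolding a
    by (rule backlund_criterion[where e = "1" and k = "0" and b = "?b"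
          and F = "\<lambda>x y. x" and G = "\<lambda>x y. y"
          and Fx = "\<lambda>x y. 1" and Fy = "\<lambda>x y. 0"
          and Gx = "\<lambda>x y. 0" and Gy = "\<lambda>x y. 1",
          OF 1(2)[unfolded a] _ _ _ _ _ _ _ _ jac ham])
      (use 1 in \<open>auto simp: a1 a field_simps power2_eq_square intro!: derivative_eq_intros\<close>)
qed

lemma backlund_S6: "backlund_transformation S6"
  unfolding backlund_transformation_def
proof (intro allI impI, elim conjE, goal_cases)
  case (1 U a q p)
  obtain a0 a1 a2 a3 a4 a5 a6 where a: "a = (a0, a1, a2, a3, a4, a5, a6)"
    by (cases a) auto
  let ?a = "(a0, a1, a2, a3, a4, a5, a6)"
  let ?b = "(a0, a1, a2, a3, a4, a5 + a6, - a6)"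
  have a1: "a1 = - (3 * a0 + 2 * a2 + a3 + 2 * a4 + 2 * a5 + a6)"
    using 1(1) unfolding a by (simp only: param_constraint_iff)
  have ham: "hamiltonian ?b x y =
      1 * hamiltonian ?a x y + 0"
    if "bt_defined S6 x y" for x y
  proof -
    show ?thesis
      unfolding a1 hamiltonian.simps ham_D.simps by algebra
  qed
  have jac: "1 * 1 - 0 * 0 = (1::complex)"
    if "bt_defined S6 x y" for x y
    using that by simp
  show ?case
    unfolding a
    by (rule backlund_criterion[where e = "1" and k = "0" and b = "?b"
          and F = "\<lambda>x y. x" and G = "\<lambda>x y. y"
          and Fx = "\<lambda>x y. 1" and Fy = "\<lambda>x y. 0"
          and Gx = "\<lambda>x y. 0" and Gy = "\<lambda>x y. 1",
          OF 1(2)[unfolded a] _ _ _ _ _ _ _ _ jac ham])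
      (use 1 in \<open>auto simp: a1 a field_simps power2_eq_square intro!: derivative_eq_intros\<close>)
qed

lemma backlund_Pi1: "backlund_transformation Pi1"
  unfolding backlund_transformation_def
proof (intro allI impI, elim conjE, goal_cases)
  case (1 U a q p)
  obtain a0 a1 a2 a3 a4 a5 a6 where a: "a = (a0, a1, a2, a3, a4, a5, a6)"
    by (cases a) auto
  let ?a = "(a0, a1, a2, a3, a4, a5, a6)"
  let ?b = "(a0, a3, a4, a1, a2, a5, a6)"
  have a1: "a1 = - (3 * a0 + 2 * a2 + a3 + 2 * a4 + 2 * a5 + a6)"
    using 1(1) unfolding a by (simp only: param_constraint_iff)
  have ham: "hamiltonian ?b (1 - x) (- y) =
      - 1 * hamiltonian ?a x y + (ham_D ?b)"
    if "bt_defined Pi1 x y" for x y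
  proof -
    show ?thesis
      unfolding a1 hamiltonian.simps ham_D.simps by algebra
  qed
  have jac: "(- 1) * (- 1) - 0 * 0 = (1::complex)"
    if "bt_defined Pi1 x y" for x y
    using that by simp
  show ?case
    unfolding a
    by (rule backlund_criterion[where e = "- 1" and k = "1" and b = "?b"
          and F = "\<lambda>x y. 1 - x" and G = "\<lambda>x y. - y"
          and Fx = "\<lambda>x y. - 1" and Fy = "\<lambda>x y. 0"
          and Gx = "\<lambda>x y. 0" and Gy = "\<lambda>x y. - 1",
          OF 1(2)[unfolded a] _ _ _ _ _ _ _ _ jac ham])
      (use 1 in \<open>auto simp: a1 a field_simps power2_eq_square intro!: derivative_eq_intros\<close>)
qed

lemma backlund_Pi2: "backlund_transformation Pi2"
  unfolding backlund_transformation_def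
proof (intro allI impI, elim conjE, goal_cases)
  case (1 U a q p)
  obtain a0 a1 a2 a3 a4 a5 a6 where a: "a = (a0, a1, a2, a3, a4, a5, a6)"
    by (cases a) auto
  let ?a = "(a0, a1, a2, a3, a4, a5, a6)"
  let ?b = "(a0, a6, a5, a3, a4, a2, a1)"
  have a1: "a1 = - (3 * a0 + 2 * a2 + a3 + 2 * a4 + 2 * a5 + a6)"
    using 1(1) unfolding a by (simp only: param_constraint_iff)
  have ham: "hamiltonian ?b (1 / x) (- (x * y + a0) * x) =
      - 1 * hamiltonian ?a x y + (2 * a0^3 + a0^2 * (ham_k ?b + ham_s ?b) - ham_B ?b * a0)"
    if "bt_defined Pi2 x y" for x y
  proof -
    define w where "w = 1 / x"
    have w: "x * w = 1" using that by (simp add: w_def)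
    have eq: "1 / x = w" by (simp add: w_def)
    show ?thesis
      using w unfolding eq a1 hamiltonian.simps ham_s.simps ham_k.simps ham_A.simps ham_B.simps ham_D.simps by algebra
  qed
  have jac: "(- 1 / x^2) * (- (x^2)) - 0 * (- (2 * x * y + a0)) = (1::complex)"
    if "bt_defined Pi2 x y" for x y
    using that by simp
  show ?case
    unfolding a
    by (rule backlund_criterion[where e = "- 1" and k = "0" and b = "?b"
          and F = "\<lambda>x y. 1 / x" and G = "\<lambda>x y. - (x * y + a0) * x"
          and Fx = "\<lambda>x y. - 1 / x^2" and Fy = "\<lambda>x y. 0"
          and Gx = "\<lambda>x y. - (2 * x * y + a0)" and Gy = "\<lambda>x y. - (x^2)",
          OF 1(2)[unfolded a] _ _ _ _ _ _ _ _ jac ham])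
      (use 1 in \<open>auto simp: a1 a field_simps power2_eq_square intro!: derivative_eq_intros\<close>)
qed

lemma backlund_Pi3: "backlund_transformation Pi3"
  unfolding backlund_transformation_def
proof (intro allI impI, elim conjE, goal_cases)
  case (1 U a q p)
  obtain a0 a1 a2 a3 a4 a5 a6 where a: "a = (a0, a1, a2, a3, a4, a5, a6)"
    by (cases a) auto
  let ?a = "(a0, a1, a2, a3, a4, a5, a6)"
  let ?b = "(a0, a1, a2, a6, a5, a4, a3)"
  have a1: "a1 = - (3 * a0 + 2 * a2 + a3 + 2 * a4 + 2 * a5 + a6)"
    using 1(1) unfolding a by (simp only: param_constraint_iff)
  have ham: "hamiltonian ?b (x / (x - 1)) (- (x - 1) * ((x - 1) * y + a0)) =
      - 1 * hamiltonian ?a x y + (- 2 * a0^3 - a0^2 * (2 * ham_s ?b - ham_k ?b) - a0 * (2 * ham_A ?b + ham_B ?b) + ham_D ?b + ham_D ?a)"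
    if "bt_defined Pi3 x y" for x y
  proof -
    define w where "w = 1 / (x - 1)"
    have w: "(x - 1) * w = 1" using that by (simp add: w_def)
    have eq: "x / (x - 1) = x * w" by (simp add: w_def)
    show ?thesis
      using w unfolding eq a1 hamiltonian.simps ham_s.simps ham_k.simps ham_A.simps ham_B.simps ham_D.simps by algebra
  qed
  have jac: "(- 1 / (x - 1)^2) * (- ((x - 1)^2)) - 0 * (- (2 * (x - 1) * y + a0)) = (1::complex)"
    if "bt_defined Pi3 x y" for x y
    using that by simp
  show ?case
    unfolding a
    by (rule backlund_criterion[where e = "- 1" and k = "2" and b = "?b"
          and F = "\<lambda>x y. x / (x - 1)" and G = "\<lambda>x y. - (x - 1) * ((x - 1) * y + a0)"
          and Fx = "\<lambda>x y. - 1 / (x - 1)^2" and Fy = "\<lambda>x y. 0"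
          and Gx = "\<lambda>x y. - (2 * (x - 1) * y + a0)" and Gy = "\<lambda>x y. - ((x - 1)^2)",
          OF 1(2)[unfolded a] _ _ _ _ _ _ _ _ jac ham])
      (use 1 in \<open>auto simp: a1 a field_simps power2_eq_square intro!: derivative_eq_intros\<close>)
qed

theorem backlund: "backlund_transformation g"
  by (cases g) (simp_all add: backlund_S0 backlund_S1 backlund_S2 backlund_S3 backlund_S4
      backlund_S5 backlund_S6 backlund_Pi1 backlund_Pi2 backlund_Pi3)

section \<open>Faithfulness of the reflection representation\<close>

lemma E6_nodes_eq: "E6_nodes = {..<7}"
  by (auto simp: E6_nodes_def)

section \<open>Words modulo the Coxeter relations\<close>

lemma E6_word_eq_lists:
  assumes "E6_word_eq u v"
  shows "u \<in> lists E6_nodes" "v \<in> lists E6_nodes"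
proof -
  have "u \<in> lists E6_nodes \<and> v \<in> lists E6_nodes"
    using assms
  proof induction
    case (rel i j u v)
    have "concat (replicate n [i, j]) \<in> lists E6_nodes" for n
      using rel by (induction n) auto
    with rel show ?case
      by (simp del: in_lists_conv_set)
  qed auto
  then show "u \<in> lists E6_nodes" "v \<in> lists E6_nodes"
    by auto
qed

lemma E6_word_eq_append_right:
  assumes "E6_word_eq u v" "w \<in> lists E6_nodes"
  shows "E6_word_eq (u @ w) (v @ w)"
  using assms
proof (induction)
  case (rel i j u v)
  then have "v @ w \<in> lists E6_nodes" by auto
  from E6_word_eq.rel[OF rel(1-3) this] show ?case by simp
next
  case (trans u v x)
  then show ?case by (meson E6_word_eq.trans)
qed (auto intro!: E6_word_eq.refl intro: E6_word_eq.sym)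

lemma E6_word_eq_append_left:
  assumes "E6_word_eq u v" "w \<in> lists E6_nodes"
  shows "E6_word_eq (w @ u) (w @ v)"
  using assms
proof (induction)
  case (rel i j u v)
  then have "w @ u \<in> lists E6_nodes" by auto
  from E6_word_eq.rel[OF rel(1,2) this rel(4)] show ?case by simp
next
  case (trans u v x)
  then show ?case by (meson E6_word_eq.trans)
qed (auto intro!: E6_word_eq.refl intro: E6_word_eq.sym)

lemma E6_word_eq_append:
  assumes "E6_word_eq u u'" "E6_word_eq v v'"
  shows "E6_word_eq (u @ v) (u' @ v')"
  using E6_word_eq.trans[OF E6_word_eq_append_right[OF assms(1)] E6_word_eq_append_left[OF assms(2)]]
    E6_word_eq_lists[OF assms(1)] E6_word_eq_lists[OF assms(2)]
  by blast

lemma E6_word_eq_square: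
  assumes "w \<in> lists E6_nodes" "i \<in> E6_nodes"
  shows "E6_word_eq (w @ [i, i]) w"
  using E6_word_eq.rel[of i i w "[]"] assms by (simp add: E6_order_def)

text \<open>Each letter is its own inverse, so \<open>rev w\<close> inverts \<open>w\<close>; pairs
  are removed from the middle outwards. This replaces formal inverses when a relation has to be
  solved for one side.\<close>

lemma E6_word_eq_cancel:
  assumes "w \<in> lists E6_nodes" "E6_word_eq (u @ w @ rev w) v"
  shows "E6_word_eq u v"
  using assms
proof (induction w arbitrary: u rule: rev_induct)
  case (snoc i w)
  have l: "u @ w \<in> lists E6_nodes" "rev w \<in> lists E6_nodes" "i \<in> E6_nodes"
    using snoc.prems(1) E6_word_eq_lists(1)[OF snoc.prems(2)] by auto
  have "E6_word_eq ((u @ w) @ rev w) (((u @ w) @ [i, i]) @ rev w)"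
    using l by (intro E6_word_eq_append E6_word_eq.sym[OF E6_word_eq_square] E6_word_eq.refl)
  moreover have "E6_word_eq (((u @ w) @ [i, i]) @ rev w) v"
    using snoc.prems(2) by simp
  ultimately have "E6_word_eq (u @ w @ rev w) v"
    by (metis E6_word_eq.trans append_assoc)
  then show ?case
    using snoc.IH[of u] snoc.prems(1) by auto
qed simp

text \<open>The square of \<open>[i, j]\<close> is inserted in front of the target word, whose
  letters then cancel its second half. The braid form below arises in the same way from the third
  power.\<close>

lemma E6_word_eq_commute:
  assumes "w \<in> lists E6_nodes" "i \<in> E6_nodes" "j \<in> E6_nodes" "i \<noteq> j" "{i, j} \<notin> E6_edges"
  shows "E6_word_eq (w @ [i, j]) (w @ [j, i])"
proof -
  have "E6_word_eq (w @ concat (replicate (E6_order i j) [i, j]) @ [j, i]) (w @ [j, i])"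
    using assms by (intro E6_word_eq.rel) auto
  then have "E6_word_eq ((w @ [i, j]) @ [i, j] @ rev [i, j]) (w @ [j, i])"
    using assms by (simp add: E6_order_def numeral_2_eq_2)
  then show ?thesis
    using assms by (intro E6_word_eq_cancel[of "[i, j]" "w @ [i, j]"]) auto
qed

lemma E6_word_eq_braid:
  assumes "w \<in> lists E6_nodes" "i \<in> E6_nodes" "j \<in> E6_nodes" "{i, j} \<in> E6_edges" "i \<noteq> j"
  shows "E6_word_eq (w @ [i, j, i]) (w @ [j, i, j])"
proof -
  have "E6_word_eq (w @ concat (replicate (E6_order i j) [i, j]) @ [j, i, j]) (w @ [j, i, j])"
    using assms by (intro E6_word_eq.rel) auto
  then have "E6_word_eq ((w @ [i, j, i]) @ [j, i, j] @ rev [j, i, j]) (w @ [j, i, j])"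
    using assms by (simp add: E6_order_def numeral_3_eq_3)
  then show ?thesis
    using assms by (intro E6_word_eq_cancel[of "[j, i, j]" "w @ [i, j, i]"]) auto
qed

text \<open>A vector \<open>c\<close> stands for \<open>c\<^sub>7 x + \<Sum>\<^sub>j c\<^sub>j \<alpha>\<^sub>j\<close>, where \<open>x\<close> behaves like \<open>qp\<close> near the point
  \<open>(q, p) = (0, \<infinity>)\<close>: its pairing with the coroots is that of \<open>\<varpi>\<^sub>2 - \<varpi>\<^sub>0\<close>. The
  canonical central element pairs to \<open>-1\<close> with \<open>x\<close>, so that translations act on \<open>x\<close> nontrivially
  even modulo the null root.\<close>

definition cartan :: "nat \<Rightarrow> nat \<Rightarrow> int" where
  "cartan i j = (if i = j then 2 else if {i, j} \<in> E6_edges then - 1 else 0)"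

definition coroot :: "nat \<Rightarrow> (nat \<Rightarrow> int) \<Rightarrow> int" where
  "coroot i c = (\<Sum>j<7. cartan i j * c j) + (if i = 2 then c 7 else if i = 0 then - c 7 else 0)"

definition reflect :: "nat \<Rightarrow> (nat \<Rightarrow> int) \<Rightarrow> nat \<Rightarrow> int" where
  "reflect i c = c(i := c i - coroot i c)"

definition unit_vec :: "nat \<Rightarrow> nat \<Rightarrow> int" where
  "unit_vec j k = (if k = j then 1 else 0)"

abbreviation word_act :: "nat list \<Rightarrow> (nat \<Rightarrow> int) \<Rightarrow> nat \<Rightarrow> int" where
  "word_act w \<equiv> foldr reflect w"

lemma cartan_same [simp]: "cartan i i = 2"
  by (simp add: cartan_def)

section \<open>The reflections satisfy the Coxeter relations\<close>

lemma coroot_lin: "coroot i (\<lambda>k. a * c k + b * d k) = a * coroot i c + b * coroot i d"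
  by (simp add: coroot_def sum.distrib sum_distrib_left algebra_simps)

lemma reflect_lin: "reflect i (\<lambda>k. a * c k + b * d k) = (\<lambda>k. a * reflect i c k + b * reflect i d k)"
  by (auto simp: reflect_def coroot_lin algebra_simps)

lemma word_act_lin:
  "word_act w (\<lambda>k. a * c k + b * d k) = (\<lambda>k. a * word_act w c k + b * word_act w d k)"
  by (induction w) (simp_all add: reflect_lin)

lemma coroot_upd:
  assumes "j < 7"
  shows "coroot i (c(j := x)) = coroot i c + cartan i j * (x - c j)"
proof -
  have "(\<Sum>k<7. cartan i k * (c(j := x)) k) =
        (\<Sum>k<7. cartan i k * c k + (if k = j then cartan i j * (x - c j) else 0))"
    by (intro sum.cong) (auto simp: algebra_simps)
  then show ?thesis
    using assms by (auto simp: coroot_def sum.distrib)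
qed

lemma coroot_reflect: "j < 7 \<Longrightarrow> coroot i (reflect j c) = coroot i c - cartan i j * coroot j c"
  by (simp add: reflect_def coroot_upd)

lemma reflect_nth: "reflect i c k = (if k = i then c i - coroot i c else c k)"
  by (simp add: reflect_def)

lemma reflect_reflect: "i < 7 \<Longrightarrow> reflect i (reflect i c) = c"
  by (rule ext) (simp add: reflect_nth coroot_reflect)

lemma reflect_order:
  assumes "i < 7" "j < 7"
  shows "word_act (concat (replicate (E6_order i j) [i, j])) c = c"
proof -
  consider "i = j" | "i \<noteq> j" "{i, j} \<in> E6_edges" | "i \<noteq> j" "{i, j} \<notin> E6_edges" by blast
  then show ?thesis
  proof cases
    case 1
    then show ?thesis using assms by (simp add: E6_order_def reflect_reflect)
  next
    case 2
    then have "cartan i j = -1" "cartan j i = -1"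
      by (auto simp: cartan_def insert_commute)
    then show ?thesis
      using assms 2
      by (intro ext) (simp add: E6_order_def numeral_3_eq_3 reflect_nth coroot_reflect)
  next
    case 3
    then have "cartan i j = 0" "cartan j i = 0"
      by (auto simp: cartan_def insert_commute)
    then show ?thesis
      using assms 3
      by (intro ext) (simp add: E6_order_def numeral_2_eq_2 reflect_nth coroot_reflect)
  qed
qed

lemma word_act_cong: "E6_word_eq u v \<Longrightarrow> word_act u = word_act v"
proof (induction rule: E6_word_eq.induct)
  case (rel i j u v)
  then show ?case
    by (intro ext) (simp add: E6_nodes_eq reflect_order del: foldr_append, simp add: reflect_order)
qed auto

lemma word_act_outside: "w \<in> lists E6_nodes \<Longrightarrow> k \<notin> E6_nodes \<Longrightarrow> word_act w c k = c k"
  by (induction w) (auto simp: reflect_nth)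

section \<open>Coxeter length and the positivity of roots\<close>

definition word_len :: "nat list \<Rightarrow> nat" where
  "word_len w = (LEAST n. \<exists>v. E6_word_eq w v \<and> length v = n)"

lemma word_len_witness:
  assumes "w \<in> lists E6_nodes"
  obtains v where "E6_word_eq w v" "length v = word_len w"
proof -
  have "\<exists>n v. E6_word_eq w v \<and> length v = n"
    using assms by (auto intro: E6_word_eq.refl)
  then have "\<exists>v. E6_word_eq w v \<and> length v = word_len w"
    unfolding word_len_def by (rule LeastI_ex)
  with that show ?thesis by blast
qed

lemma word_len_le: "E6_word_eq w v \<Longrightarrow> word_len w \<le> length v"
  unfolding word_len_def by (rule Least_le) auto

lemma word_len_cong: "E6_word_eq u v \<Longrightarrow> word_len u = word_len v"
  unfolding word_len_def by (metis E6_word_eq.sym E6_word_eq.trans)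

lemma word_len_append:
  assumes "w \<in> lists E6_nodes" "u \<in> lists E6_nodes"
  shows "word_len (w @ u) \<le> word_len w + length u"
proof -
  obtain v where "E6_word_eq w v" "length v = word_len w"
    using word_len_witness assms(1) by blast
  then show ?thesis
    using word_len_le[OF E6_word_eq_append_right[of w v u]] assms(2) by simp
qed

definition nonneg_vec :: "(nat \<Rightarrow> int) \<Rightarrow> bool" where
  "nonneg_vec c \<longleftrightarrow> (\<forall>j<7. 0 \<le> c j)"

lemma coroot_unit: "j < 7 \<Longrightarrow> coroot i (unit_vec j) = cartan i j"
  by (simp add: coroot_def unit_vec_def if_distrib[where f = "\<lambda>x. _ * x"] cong: if_cong)

lemma reflect_unit:
  assumes "j < 7"
  shows "reflect i (unit_vec j) = (\<lambda>k. 1 * unit_vec j k + (- cartan i j) * unit_vec i k)"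
  using assms by (intro ext) (simp add: reflect_nth coroot_unit, simp add: unit_vec_def)

text \<open>The induction step reduces to a rank-two subdiagram; the case split follows Deodhar's
  argument for the exchange of descents.\<close>

lemma nonneg_vec_word_act:
  assumes "w \<in> lists E6_nodes" "s < 7" "word_len w \<le> word_len (w @ [s])"
  shows "nonneg_vec (word_act w (unit_vec s))"
  using assms
proof (induction "word_len w" arbitrary: w s rule: less_induct)
  case less
  have s: "s \<in> E6_nodes" using less.prems by (simp add: E6_nodes_eq)
  obtain v where v: "E6_word_eq w v" "length v = word_len w"
    using word_len_witness less.prems(1) by blast
  have vl: "v \<in> lists E6_nodes" using E6_word_eq_lists v(1) by blast
  show ?case
  proof (cases v rule: rev_cases)
    case Nil
    then show ?thesis
      using word_act_cong[OF v(1)] by (simp add: nonneg_vec_def unit_vec_def)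
  next
    \<comment> \<open>A shortest word for \<open>w\<close> is split as \<open>u\<close> followed by
      \<open>t\<close>, so that \<open>u\<close> is shorter and \<open>t\<close> is an ascent of
      \<open>u\<close>.\<close>
    case (snoc u t)
    have ul: "u \<in> lists E6_nodes" and t: "t \<in> E6_nodes" "t < 7"
      using vl snoc by (auto simp: E6_nodes_eq)
    have wu: "word_len u < word_len w"
      using word_len_le[OF E6_word_eq.refl[OF ul]] v(2) snoc by simp
    have wu': "word_len w = word_len (u @ [t])"
      using v(1) snoc by (simp add: word_len_cong)
    have le1: "word_len w \<le> word_len u + 1"
      using word_len_append[of u "[t]"] ul t wu' by simp
    have ws: "word_len (w @ [s]) = word_len (u @ [t, s])"
      using word_len_cong[OF E6_word_eq_append_right[OF v(1), of "[s]"]] s snoc by simp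
    have act: "word_act w (unit_vec s) = word_act u (reflect t (unit_vec s))"
      using word_act_cong[OF v(1)] snoc by simp
    have ts: "t \<noteq> s"
    proof
      assume "t = s"
      then have "word_len (w @ [s]) = word_len u"
        using ws word_len_cong[OF E6_word_eq_square[OF ul s]] by simp
      with wu less.prems(3) show False by simp
    qed
    have ut: "nonneg_vec (word_act u (unit_vec t))"
      using less.hyps[OF wu ul t(2)] wu wu' by simp
    show ?thesis
    proof (cases "{t, s} \<in> E6_edges")
      case False
      have "word_len (w @ [s]) = word_len ((u @ [s]) @ [t])"
        using ws word_len_cong[OF E6_word_eq_commute[OF ul t(1) s ts False]] by simp
      also have "\<dots> \<le> word_len (u @ [s]) + 1"
        using word_len_append[of "u @ [s]" "[t]"] ul s t by simp
      finally have "word_len u \<le> word_len (u @ [s])"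
        using less.prems(3) wu by simp
      then have "nonneg_vec (word_act u (unit_vec s))"
        using less.hyps[OF wu ul less.prems(2)] by simp
      moreover have "cartan t s = 0"
        using ts False by (simp add: cartan_def)
      ultimately show ?thesis
        unfolding act using reflect_unit[of s t] less.prems(2) by simp
    next
      case True
      then have c: "cartan t s = -1" "cartan s t = -1"
        using ts by (auto simp: cartan_def insert_commute)
      have rts: "reflect t (unit_vec s) = (\<lambda>k. 1 * unit_vec s k + 1 * unit_vec t k)"
        using reflect_unit[of s t] less.prems(2) c by simp
      show ?thesis
      \<comment> \<open>For an edge, \<open>w\<close> maps the root of \<open>s\<close> to the
        \<open>u\<close>-image of the sum of both roots. If \<open>s\<close> is an ascent of
        \<open>u\<close>, both summands are nonnegative by induction. Otherwise \<open>u\<close> is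
        the shorter word \<open>u s\<close> followed by \<open>s\<close>, and
        \<open>reflect s\<close> turns the sum into the root of \<open>t\<close>.\<close>
      proof (cases "word_len u \<le> word_len (u @ [s])")
        case True
        then have "nonneg_vec (word_act u (unit_vec s))"
          using less.hyps[OF wu ul less.prems(2)] by simp
        then show ?thesis
          unfolding act rts word_act_lin[of u 1 "unit_vec s" 1 "unit_vec t"] using ut by (simp add: nonneg_vec_def)
      next
        case False
        let ?x = "u @ [s]"
        have xl: "?x \<in> lists E6_nodes" using ul s by simp
        have uact: "word_act u f = word_act ?x (reflect s f)" for f
          using less.prems(2) by (simp add: reflect_reflect)
        have "reflect s (\<lambda>k. 1 * unit_vec s k + 1 * unit_vec t k) = unit_vec t"
          unfolding reflect_lin[of s 1 "unit_vec s" 1 "unit_vec t"] using reflect_unit[of s s] reflect_unit[of t s] t less.prems(2) c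
          by simp
        then have "word_act w (unit_vec s) = word_act ?x (unit_vec t)"
          using act rts uact[of "reflect t (unit_vec s)"] by simp
        moreover have "word_len ?x \<le> word_len (?x @ [t])"
        \<comment> \<open>If \<open>t\<close> were a descent of \<open>?x\<close>, then
          \<open>?x t\<close> would be at least three letters shorter than \<open>w\<close>, while
          the braid relation writes \<open>w s\<close> as \<open>?x t s t\<close>. Then
          \<open>w s\<close> would be shorter than \<open>w\<close>.\<close>
        proof (rule ccontr)
          assume *: "\<not> word_len ?x \<le> word_len (?x @ [t])"
          have "E6_word_eq ((u @ [s, s]) @ [t, s]) (u @ [t, s])"
            using ul t s by (intro E6_word_eq_append E6_word_eq_square E6_word_eq.refl) auto
          moreover have "E6_word_eq (?x @ [t, s, t]) (?x @ [s, t, s])"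
            using xl t s ts True by (intro E6_word_eq_braid) auto
          ultimately have "E6_word_eq (?x @ [t, s, t]) (u @ [t, s])"
            by (simp add: E6_word_eq.trans)
          then have "word_len (w @ [s]) = word_len ((?x @ [t]) @ [s, t])"
            using ws word_len_cong by fastforce
          also have "\<dots> \<le> word_len (?x @ [t]) + 2"
            using word_len_append[of "?x @ [t]" "[s, t]"] xl s t by simp
          finally show False
            using * False wu less.prems(3) by simp
        qed
        ultimately show ?thesis
          using less.hyps[of ?x t] False wu xl t by simp
      qed
    qed
  qed
qed

text \<open>In a nonempty shortest word \<open>u t\<close> the letter \<open>t\<close> is an ascent
  of \<open>u\<close>, so \<open>u\<close> sends the root of \<open>t\<close> to a nonnegative
  vector. The whole word sends it to the negative of that vector, hence not to itself.\<close>

lemma word_act_faithful: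
  assumes "w \<in> lists E6_nodes" "\<And>j. j < 7 \<Longrightarrow> word_act w (unit_vec j) = unit_vec j"
  shows "E6_word_eq w []"
proof -
  obtain v where v: "E6_word_eq w v" "length v = word_len w"
    using word_len_witness assms(1) by blast
  have vl: "v \<in> lists E6_nodes" using E6_word_eq_lists v(1) by blast
  show ?thesis
  proof (cases v rule: rev_cases)
    case Nil
    with v show ?thesis by simp
  next
    case (snoc u t)
    have ul: "u \<in> lists E6_nodes" and t: "t < 7"
      using vl snoc by (auto simp: E6_nodes_eq)
    have "word_len u \<le> word_len (u @ [t])"
      using word_len_le[OF E6_word_eq.refl[OF ul]] v snoc word_len_cong[OF v(1)] by simp
    then have nn: "nonneg_vec (word_act u (unit_vec t))"
      using nonneg_vec_word_act[OF ul t] by simp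
    have "reflect t (unit_vec t) = (\<lambda>k. (-1) * unit_vec t k + 0 * unit_vec t k)"
      using reflect_unit[of t t] t by auto
    then have "unit_vec t = word_act u (\<lambda>k. (-1) * unit_vec t k + 0 * unit_vec t k)"
      using assms(2)[OF t] word_act_cong[OF v(1)] snoc by simp
    then have "unit_vec t = (\<lambda>k. (-1) * word_act u (unit_vec t) k + 0 * word_act u (unit_vec t) k)"
      unfolding word_act_lin[of u "-1" "unit_vec t" 0 "unit_vec t"] .
    then have "unit_vec t t = - word_act u (unit_vec t) t"
      by (simp add: fun_eq_iff)
    with nn t show ?thesis
      by (auto simp: nonneg_vec_def unit_vec_def dest!: spec[of _ t])
  qed
qed

text \<open>The symmetric form that extends the Cartan matrix to the extra vector \<open>x\<close>,
  paired with the simple roots as in \<open>coroot\<close>. Every reflection is orthogonal for it;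
  the value 0 for \<open>x\<close> with itself is a free choice.\<close>

definition inv_form :: "(nat \<Rightarrow> int) \<Rightarrow> (nat \<Rightarrow> int) \<Rightarrow> int" where
  "inv_form c d = (\<Sum>i<7. d i * coroot i c) + d 7 * (c 2 - c 0)"

text \<open>The marks of the diagram, with the central node first. They are also the coefficients of
  \<open>param_constraint\<close>, which says that this combination of the parameters
  vanishes.\<close>

definition null_root :: "nat \<Rightarrow> int" where
  "null_root j = (if j < 7 then [3, 1, 2, 1, 2, 2, 1] ! j else 0)"

lemma lessThan_7: "{..<7::nat} = {0, 1, 2, 3, 4, 5, 6}"
  by auto

lemma less_7_cases:
  assumes "(j::nat) < 7"
  shows "j = 0 \<or> j = 1 \<or> j = 2 \<or> j = 3 \<or> j = 4 \<or> j = 5 \<or> j = 6"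
  using assms by linarith

lemma coroot_0: "coroot 0 c = 2 * c 0 - c 2 - c 4 - c 5 - c 7"
  and coroot_1: "coroot 1 c = 2 * c 1 - c 2"
  and coroot_2: "coroot 2 c = 2 * c 2 - c 0 - c 1 + c 7"
  and coroot_3: "coroot 3 c = 2 * c 3 - c 4"
  and coroot_4: "coroot 4 c = 2 * c 4 - c 0 - c 3"
  and coroot_5: "coroot 5 c = 2 * c 5 - c 0 - c 6"
  and coroot_6: "coroot 6 c = 2 * c 6 - c 5"
  by (simp_all add: coroot_def lessThan_7 cartan_def E6_edges_def doubleton_eq_iff)

lemmas coroot_simps = coroot_0 coroot_1 coroot_1[unfolded One_nat_def] coroot_2 coroot_3 coroot_4 coroot_5 coroot_6

lemma inv_form_expand:
  "inv_form c d = d 0 * coroot 0 c + d 1 * coroot 1 c + d 2 * coroot 2 c + d 3 * coroot 3 c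
     + d 4 * coroot 4 c + d 5 * coroot 5 c + d 6 * coroot 6 c + d 7 * (c 2 - c 0)"
  by (simp add: inv_form_def lessThan_7)

lemma inv_form_reflect:
  assumes "i < 7"
  shows "inv_form (reflect i c) (reflect i d) = inv_form c d"
  using less_7_cases[OF assms]
  by (elim disjE) (simp_all add: inv_form_expand coroot_simps reflect_nth algebra_simps)

lemma inv_form_word_act:
  "w \<in> lists E6_nodes \<Longrightarrow> inv_form (word_act w c) (word_act w d) = inv_form c d"
  by (induction w) (auto simp: inv_form_reflect E6_nodes_eq)

text \<open>The null root is orthogonal to itself and to all simple roots and pairs to -1 with
  \<open>x\<close>. Invariance of the pairing of \<open>x\<close> with the simple root
  \<open>j\<close> therefore gives \<open>m j = 0\<close>, after which faithfulness on the root
  lattice applies.\<close>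

theorem word_act_faithful_mod_null_root:
  assumes w: "w \<in> lists E6_nodes"
    and m: "\<And>j. j < 8 \<Longrightarrow> word_act w (unit_vec j) = (\<lambda>k. unit_vec j k + m j * null_root k)"
  shows "E6_word_eq w []"
proof (rule word_act_faithful[OF w])
  fix j :: nat assume j: "j < 7"
  have "inv_form (unit_vec 7) (unit_vec j) =
        inv_form (\<lambda>k. unit_vec 7 k + m 7 * null_root k) (\<lambda>k. unit_vec j k + m j * null_root k)"
    using inv_form_word_act[OF w, of "unit_vec 7" "unit_vec j"] m[of 7] m[of j] j by simp
  then have "m j = 0"
    using less_7_cases[OF j]
    by (elim disjE) (simp_all add: inv_form_expand coroot_simps unit_vec_def null_root_def)
  with m[of j] j show "word_act w (unit_vec j) = unit_vec j"
    by simp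
qed

section \<open>Substitution in the field of rational functions\<close>

locale field_morphism =
  fixes h :: "'a::field \<Rightarrow> 'b::field"
  assumes h_add: "h (x + y) = h x + h y"
    and h_mult: "h (x * y) = h x * h y"
    and h_1: "h 1 = 1"
begin

lemma h_0: "h 0 = 0"
  using h_add[of 0 0] by (metis add_0 add_left_cancel add.right_neutral)

lemma h_minus: "h (- x) = - h x"
  using h_add[of x "- x"] by (simp add: h_0 eq_neg_iff_add_eq_0 add.commute)

lemma h_diff: "h (x - y) = h x - h y"
  using h_add[of x "- y"] by (simp add: h_minus)

lemma h_inverse: "h (inverse x) = inverse (h x)"
proof (cases "x = 0")
  case False
  then have "h x * h (inverse x) = 1"
    using h_mult[of x "inverse x"] h_1 by simp
  then show ?thesis
    by (metis inverse_unique)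
qed (simp add: h_0)

lemma h_divide: "h (x / y) = h x / h y"
  by (simp add: divide_inverse h_mult h_inverse)

lemma h_of_nat: "h (of_nat n) = of_nat n"
  by (induction n) (simp_all add: h_0 h_1 h_add)

lemma h_numeral: "h (numeral n) = numeral n"
  using h_of_nat[of "numeral n"] by simp

lemma h_power: "h (x ^ n) = h x ^ n"
  by (induction n) (simp_all add: h_1 h_mult)

lemma h_of_int: "h (of_int n) = of_int n"
  by (cases n) (simp_all add: h_of_nat h_minus h_diff h_1)

lemma h_prod: "h (prod f A) = (\<Prod>x\<in>A. h (f x))"
  by (induction A rule: infinite_finite_induct) (simp_all add: h_1 h_mult)

lemma h_sum: "h (sum f A) = (\<Sum>x\<in>A. h (f x))"
  by (induction A rule: infinite_finite_induct) (simp_all add: h_0 h_add)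

lemmas h_simps = h_add h_mult h_1 h_0 h_minus h_diff h_inverse h_divide h_numeral h_power

text \<open>The formulas use only field operations and integer constants. Morphisms respect inverses
  even at 0, so no assumption on denominators appears, in contrast to \<open>rel_bt\<close>.\<close>

lemma map_bt: "map_config h (bt g C) = bt g (map_config h C)"
proof (cases C)
  case (Config q p t a)
  then show ?thesis
    by (cases a; cases g) (simp_all add: h_simps)
qed

end

lemma field_morphism_comp:
  "field_morphism f \<Longrightarrow> field_morphism g \<Longrightarrow> field_morphism (f \<circ> g)"
  by (simp add: field_morphism_def)

section \<open>Evaluation of polynomials and of rational functions\<close>

type_synonym mpoly = "(var \<Rightarrow>\<^sub>0 nat) \<Rightarrow>\<^sub>0 complex"

lemma UNIV_var: "UNIV = {Var_q, Var_p, Var_t, Var_a0, Var_a2, Var_a3, Var_a4, Var_a5, Var_a6}"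
  using var.exhaust by auto

lemma finite_UNIV_var [simp]: "finite (UNIV :: var set)"
  unfolding UNIV_var by simp

definition monom_eval :: "(var \<Rightarrow> 'k::field) \<Rightarrow> (var \<Rightarrow>\<^sub>0 nat) \<Rightarrow> 'k" where
  "monom_eval v m = (\<Prod>x\<in>UNIV. v x ^ Poly_Mapping.lookup m x)"

definition poly_eval :: "(complex \<Rightarrow> 'k::field) \<Rightarrow> (var \<Rightarrow> 'k) \<Rightarrow> mpoly \<Rightarrow> 'k" where
  "poly_eval k v f = (\<Sum>m\<in>Poly_Mapping.keys f. k (Poly_Mapping.lookup f m) * monom_eval v m)"

lemma monom_eval_0 [simp]: "monom_eval v 0 = 1"
  by (simp add: monom_eval_def)

lemma monom_eval_add: "monom_eval v (m + n) = monom_eval v m * monom_eval v n"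
  by (simp add: monom_eval_def lookup_add power_add prod.distrib)

lemma monom_eval_var [simp]: "monom_eval v (Poly_Mapping.single x 1) = v x"
proof -
  have "monom_eval v (Poly_Mapping.single x 1) = (\<Prod>y\<in>UNIV. if y = x then v x else 1)"
    unfolding monom_eval_def by (intro prod.cong) (auto simp: lookup_single when_def)
  then show ?thesis by simp
qed

lemma sum_single_lookup: "(\<Sum>m\<in>Poly_Mapping.keys f. Poly_Mapping.single m (Poly_Mapping.lookup f m)) = f"
proof (rule poly_mapping_eqI)
  fix n
  have "(\<Sum>m\<in>Poly_Mapping.keys f. Poly_Mapping.lookup (Poly_Mapping.single m (Poly_Mapping.lookup f m)) n) =
        (\<Sum>m\<in>Poly_Mapping.keys f. if m = n then Poly_Mapping.lookup f n else 0)"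
    by (intro sum.cong) (auto simp: lookup_single when_def)
  then show "Poly_Mapping.lookup (\<Sum>m\<in>Poly_Mapping.keys f. Poly_Mapping.single m (Poly_Mapping.lookup f m)) n = Poly_Mapping.lookup f n"
    by (simp add: lookup_sum in_keys_iff)
qed

locale substitution = field_morphism k for k :: "complex \<Rightarrow> 'k::field" +
  fixes v :: "var \<Rightarrow> 'k"
begin

abbreviation E :: "mpoly \<Rightarrow> 'k" where
  "E \<equiv> poly_eval k v"

lemma E_superset:
  assumes "finite A" "Poly_Mapping.keys f \<subseteq> A"
  shows "E f = (\<Sum>m\<in>A. k (Poly_Mapping.lookup f m) * monom_eval v m)"
  unfolding poly_eval_def using assms
  by (intro sum.mono_neutral_left) (auto simp: in_keys_iff h_0)

lemma E_0 [simp]: "E 0 = 0"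
  by (simp add: poly_eval_def)

lemma E_single: "E (Poly_Mapping.single m c) = k c * monom_eval v m"
  by (subst E_superset[of "{m}"]) auto

lemma E_add: "E (f + g) = E f + E g"
proof -
  let ?A = "Poly_Mapping.keys f \<union> Poly_Mapping.keys g"
  have "Poly_Mapping.keys (f + g) \<subseteq> ?A" by (rule Poly_Mapping.keys_add)
  then show ?thesis
    using E_superset[of ?A f] E_superset[of ?A g] E_superset[of ?A "f + g"]
    by (simp add: lookup_add h_add algebra_simps sum.distrib)
qed

lemma E_sum: "E (sum f A) = (\<Sum>x\<in>A. E (f x))"
  by (induction A rule: infinite_finite_induct) (simp_all add: E_add)

lemma E_mult: "E (f * g) = E f * E g"
proof -
  have "E (f * g) = E ((\<Sum>m\<in>Poly_Mapping.keys f. Poly_Mapping.single m (Poly_Mapping.lookup f m)) *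
                       (\<Sum>n\<in>Poly_Mapping.keys g. Poly_Mapping.single n (Poly_Mapping.lookup g n)))"
    by (simp add: sum_single_lookup)
  also have "\<dots> = (\<Sum>m\<in>Poly_Mapping.keys f. \<Sum>n\<in>Poly_Mapping.keys g.
      (k (Poly_Mapping.lookup f m) * monom_eval v m) * (k (Poly_Mapping.lookup g n) * monom_eval v n))"
    by (simp add: sum_product E_sum mult_single E_single h_mult monom_eval_add mult_ac)
  also have "\<dots> = E f * E g"
    by (simp add: sum_product poly_eval_def)
  finally show ?thesis .
qed

lemma E_1 [simp]: "E 1 = 1"
  using E_single[of 0 1] by (simp add: h_1)

lemma E_minus: "E (- f) = - E f"
  using E_add[of f "- f"] by (simp add: eq_neg_iff_add_eq_0 add.commute)

text \<open>The substitution as a partial map on rational functions: \<open>f\<close> has the value \<open>y\<close> if it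
  can be written with a denominator that does not vanish.\<close>

definition ev :: "ratfun \<Rightarrow> 'k \<Rightarrow> bool" where
  "ev f y \<longleftrightarrow> (\<exists>a b. f = Fract a b \<and> E b \<noteq> 0 \<and> y = E a / E b)"

lemma evI: "E b \<noteq> 0 \<Longrightarrow> ev (Fract a b) (E a / E b)"
  by (auto simp: ev_def)

lemma evE:
  assumes "ev f y"
  obtains a b where "f = Fract a b" "E b \<noteq> 0" "y = E a / E b"
  using assms by (auto simp: ev_def)

lemma ev_unique:
  assumes "ev f y" "ev f z"
  shows "y = z"
proof -
  obtain a b c d where 1: "f = Fract a b" "E b \<noteq> 0" "y = E a / E b"
    and 2: "f = Fract c d" "E d \<noteq> 0" "z = E c / E d"
    by (meson assms evE)
  have "b \<noteq> 0" "d \<noteq> 0" using 1 2 by auto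
  then have "a * d = c * b" using 1 2 by (simp add: eq_fract)
  then have "E a * E d = E c * E b" using E_mult by metis
  then show ?thesis using 1 2 by (simp add: frac_eq_eq)
qed

lemma ev_const: "ev (rf_const c) (k c)"
  using evI[of 1 "Poly_Mapping.single 0 c"] by (simp add: rf_const_def E_single)

lemma ev_var: "ev (rf_var x) (v x)"
  using evI[of 1 "Poly_Mapping.single (Poly_Mapping.single x 1) 1"]
  by (simp only: rf_var_def E_single monom_eval_var h_1) simp

lemma ev_add: assumes "ev f y" "ev g z" shows "ev (f + g) (y + z)"
proof -
  obtain a b c d where 1: "f = Fract a b" "E b \<noteq> 0" "y = E a / E b"
    and 2: "g = Fract c d" "E d \<noteq> 0" "z = E c / E d"
    by (meson assms evE)
  have "b \<noteq> 0" "d \<noteq> 0" using 1 2 by auto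
  moreover have "(E a * E d + E c * E b) / (E b * E d) = y + z"
    using 1 2 by (simp add: add_frac_eq)
  ultimately show ?thesis
    using evI[of "b * d" "a * d + c * b"] 1 2 by (simp add: E_mult E_add)
qed

lemma ev_mult: assumes "ev f y" "ev g z" shows "ev (f * g) (y * z)"
proof -
  obtain a b c d where 1: "f = Fract a b" "E b \<noteq> 0" "y = E a / E b"
    and 2: "g = Fract c d" "E d \<noteq> 0" "z = E c / E d"
    by (meson assms evE)
  then show ?thesis
    using evI[of "b * d" "a * c"] by (simp add: E_mult)
qed

lemma ev_0: "ev 0 0"
  using evI[of 1 0] by (simp add: Zero_fract_def)

lemma ev_1: "ev 1 1"
  using evI[of 1 1] by (simp add: One_fract_def)

lemma ev_minus: assumes "ev f y" shows "ev (- f) (- y)"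
proof -
  obtain a b where 1: "f = Fract a b" "E b \<noteq> 0" "y = E a / E b"
    using assms by (auto simp: ev_def)
  then show ?thesis
    using evI[of b "- a"] by (simp add: E_minus)
qed

lemma ev_diff: "ev f y \<Longrightarrow> ev g z \<Longrightarrow> ev (f - g) (y - z)"
  using ev_add[of f y "- g" "- z"] ev_minus by simp

lemma ev_divide: assumes "ev f y" "ev g z" "z \<noteq> 0" shows "ev (f / g) (y / z)"
proof -
  obtain a b c d where 1: "f = Fract a b" "E b \<noteq> 0" "y = E a / E b"
    and 2: "g = Fract c d" "E d \<noteq> 0" "z = E c / E d"
    by (meson assms evE)
  then show ?thesis
    using evI[of "b * c" "a * d"] assms(3) by (auto simp: E_mult)
qed

lemma ev_of_nat: "ev (of_nat n) (of_nat n)"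
  by (induction n) (auto intro: ev_0 ev_1 ev_add)

lemma ev_numeral: "ev (numeral n) (numeral n)"
  using ev_of_nat[of "numeral n"] by simp

lemma ev_of_int: "ev (of_int n) (of_int n)"
  by (cases n) (auto intro!: ev_of_nat ev_minus ev_diff ev_1)

lemma ev_power: "ev f y \<Longrightarrow> ev (f ^ n) (y ^ n)"
  by (induction n) (auto intro: ev_1 ev_mult)

lemma ev_sum: "(\<And>x. x \<in> A \<Longrightarrow> ev (f x) (y x)) \<Longrightarrow> ev (sum f A) (sum y A)"
  by (induction A rule: infinite_finite_induct) (auto intro: ev_0 ev_add)

lemma ev_prod: "(\<And>x. x \<in> A \<Longrightarrow> ev (f x) (y x)) \<Longrightarrow> ev (prod f A) (prod y A)"
  by (induction A rule: infinite_finite_induct) (auto intro: ev_1 ev_mult)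

lemmas ev_intros = ev_const ev_var ev_0 ev_1 ev_numeral ev_of_int ev_add ev_mult ev_minus ev_diff
  ev_divide ev_power

lemma ev_nonzero: "ev f y \<Longrightarrow> y \<noteq> 0 \<Longrightarrow> f \<noteq> 0"
  using ev_unique ev_0 by blast

lemma ev_poly_eval:
  assumes "\<And>x. ev (w x) (u x)"
  shows "ev (poly_eval rf_const w f) (poly_eval k u f)"
  unfolding poly_eval_def monom_eval_def
  by (intro ev_sum ev_mult ev_const ev_prod ev_power assms)

text \<open>Carries the partial substitution through one generator. Denominators are controlled at
  the target only: a nonzero value forces the denominator at the source to be nonzero.\<close>

lemma rel_bt:
  assumes "rel_config ev (Config q p t a) (Config q' p' t' a')" "bt_defined g q' p'"
  shows "rel_config ev (bt g (Config q p t a)) (bt g (Config q' p' t' a'))"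
proof -
  obtain a0 a1 a2 a3 a4 a5 a6 where a: "a = (a0, a1, a2, a3, a4, a5, a6)" by (cases a) auto
  obtain b0 b1 b2 b3 b4 b5 b6 where b: "a' = (b0, b1, b2, b3, b4, b5, b6)" by (cases a') auto
  show ?thesis
    using assms unfolding a b by (cases g) (auto intro!: ev_intros)
qed

end

section \<open>Morphisms from the field of rational functions\<close>

lemma rf_const_0 [simp]: "rf_const 0 = 0"
  by (simp add: rf_const_def Zero_fract_def)

interpretation rf_const: field_morphism rf_const
  by standard (simp_all add: rf_const_def single_add mult_single One_fract_def)

lemma field_morphism_id: "field_morphism (\<lambda>x. x)"
  by standard auto

lemma add_fract_1: "Fract (a + b) 1 = Fract a 1 + Fract b (1 :: mpoly)"
  by simp

lemma mult_fract_1: "Fract (a * b) 1 = Fract a 1 * Fract b (1 :: mpoly)"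
  by simp

lemma poly_eval_rf_var: "poly_eval rf_const rf_var f = Fract f 1"
proof -
  have 1: "Fract (\<Sum>x\<in>A. g x) 1 = (\<Sum>x\<in>A. Fract (g x) 1)" for A and g :: "_ \<Rightarrow> mpoly"
    by (induction A rule: infinite_finite_induct) (simp_all add: Zero_fract_def add_fract_1 del: add_fract)
  have 2: "Fract (\<Prod>x\<in>A. g x) 1 = (\<Prod>x\<in>A. Fract (g x) 1)" for A and g :: "_ \<Rightarrow> mpoly"
    by (induction A rule: infinite_finite_induct) (simp_all add: One_fract_def mult_fract_1 del: mult_fract)
  have 3: "Fract (g ^ n) 1 = (Fract g 1) ^ n" for g :: mpoly and n
    by (induction n) (simp_all add: One_fract_def mult_fract_1 del: mult_fract)
  have 4: "Poly_Mapping.single (Poly_Mapping.single x 1) 1 ^ n =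
           (Poly_Mapping.single (Poly_Mapping.single x n) 1 :: mpoly)" for x n
    by (induction n) (simp_all add: mult_single flip: single_add)
  have 5: "(\<Prod>x\<in>A. Poly_Mapping.single (g x) 1) = (Poly_Mapping.single (\<Sum>x\<in>A. g x) 1 :: mpoly)"
    for A and g :: "var \<Rightarrow> _"
    by (induction A rule: infinite_finite_induct) (simp_all add: mult_single)
  have 6: "(\<Sum>x\<in>UNIV. Poly_Mapping.single x (Poly_Mapping.lookup m x)) = m" for m :: "var \<Rightarrow>\<^sub>0 nat"
  proof -
    have "(\<Sum>x\<in>UNIV. Poly_Mapping.single x (Poly_Mapping.lookup m x)) = (\<Sum>x\<in>Poly_Mapping.keys m. Poly_Mapping.single x (Poly_Mapping.lookup m x))"
      by (intro sum.mono_neutral_right) (auto simp: in_keys_iff)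
    then show ?thesis by (simp add: sum_single_lookup)
  qed
  have "rf_const c * monom_eval rf_var m = Fract (Poly_Mapping.single m c) 1" for c m
    by (simp only: monom_eval_def rf_var_def rf_const_def flip: 3)
       (simp only: 4 5 6 flip: 2, simp add: mult_single)
  then have "poly_eval rf_const rf_var f = Fract (\<Sum>m\<in>Poly_Mapping.keys f. Poly_Mapping.single m (Poly_Mapping.lookup f m)) 1"
    by (simp add: poly_eval_def 1)
  then show ?thesis by (simp add: sum_single_lookup)
qed

lemma Fract_eq_divide: "b \<noteq> 0 \<Longrightarrow> Fract a b = Fract a 1 / Fract b 1"
  by simp

lemma (in field_morphism) h_poly_eval: "h (poly_eval k v f) = poly_eval (h \<circ> k) (h \<circ> v) f"
  by (simp add: poly_eval_def monom_eval_def h_sum h_mult h_prod h_power)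

lemma ratfun_morphism_unique:
  fixes \<sigma> \<tau> :: "ratfun \<Rightarrow> 'k::field"
  assumes "field_morphism \<sigma>" "field_morphism \<tau>"
    and "\<And>c. \<sigma> (rf_const c) = \<tau> (rf_const c)" "\<And>x. \<sigma> (rf_var x) = \<tau> (rf_var x)"
  shows "\<sigma> = \<tau>"
proof
  fix f :: ratfun
  interpret \<sigma>: field_morphism \<sigma> by fact
  interpret \<tau>: field_morphism \<tau> by fact
  have eq: "\<sigma> \<circ> rf_const = \<tau> \<circ> rf_const" "\<sigma> \<circ> rf_var = \<tau> \<circ> rf_var"
    using assms by auto
  have *: "\<sigma> (Fract a 1) = \<tau> (Fract a 1)" for a
    by (simp add: \<sigma>.h_poly_eval \<tau>.h_poly_eval eq flip: poly_eval_rf_var)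
  obtain a b where "f = Fract a b" "b \<noteq> 0"
    by (cases f) auto
  then have "f = Fract a 1 / Fract b 1"
    using Fract_eq_divide by blast
  then show "\<sigma> f = \<tau> f"
    by (simp only: \<sigma>.h_divide \<tau>.h_divide *)
qed

context substitution
begin

text \<open>Injectivity on polynomials keeps every denominator nonzero, so the partial map
  \<open>ev\<close> is total and, being single valued and compatible with the operations, a
  morphism.\<close>

lemma ratfun_morphism_exists:
  assumes inj: "\<And>f. f \<noteq> 0 \<Longrightarrow> E f \<noteq> 0"
  shows "\<exists>\<sigma>. field_morphism \<sigma> \<and> (\<forall>c. \<sigma> (rf_const c) = k c) \<and> (\<forall>x. \<sigma> (rf_var x) = v x)"
proof -
  have "\<exists>y. ev f y" for f
    by (cases f) (use inj evI in blast)
  then obtain \<sigma> where \<sigma>: "ev f (\<sigma> f)" for f by metis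
  have "\<sigma> f = y" if "ev f y" for f y
    using \<sigma> ev_unique that by blast
  then have "field_morphism \<sigma> \<and> (\<forall>c. \<sigma> (rf_const c) = k c) \<and> (\<forall>x. \<sigma> (rf_var x) = v x)"
    using \<sigma> by (simp add: field_morphism_def ev_intros)
  then show ?thesis by blast
qed

end

lemma carrier_ratfun_Aut_iff:
  "\<sigma> \<in> carrier ratfun_Aut \<longleftrightarrow>
     field_morphism \<sigma> \<and> bij \<sigma> \<and> (\<forall>c. \<sigma> (rf_const c) = rf_const c)"
proof -
  have "\<sigma> 1 = 1" if "\<forall>c. \<sigma> (rf_const c) = rf_const c"
    using that[rule_format, of 1] by (simp add: rf_const.h_1)
  then show ?thesis
    by (auto simp: ratfun_Aut_def field_morphism_def)
qed

text \<open>The entry \<open>\<alpha>\<^sub>1\<close> is left out because the parameter constraint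
  determines it; \<open>config_eqI\<close> recovers it from there.\<close>

definition config_var :: "'k config \<Rightarrow> var \<Rightarrow> 'k" where
  "config_var C x = (case C of Config q p t (a0, a1, a2, a3, a4, a5, a6) \<Rightarrow>
     (case x of Var_q \<Rightarrow> q | Var_p \<Rightarrow> p | Var_t \<Rightarrow> t | Var_a0 \<Rightarrow> a0 | Var_a2 \<Rightarrow> a2 | Var_a3 \<Rightarrow> a3
        | Var_a4 \<Rightarrow> a4 | Var_a5 \<Rightarrow> a5 | Var_a6 \<Rightarrow> a6))"

lemma config_var_map: "config_var (map_config h C) x = h (config_var C x)"
  by (cases C) (auto simp: config_var_def split: var.splits prod.splits)

lemma config_var_rel: "rel_config R C D \<Longrightarrow> R (config_var C x) (config_var D x)"
  by (cases C; cases D) (auto simp: config_var_def split: var.splits prod.splits)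

lemma config_var_generic [simp]: "config_var generic_config x = rf_var x"
  by (cases x) (simp_all add: config_var_def generic_config_def generic_params_def)

fun config_constraint :: "'k::field config \<Rightarrow> bool" where
  "config_constraint (Config q p t a) = param_constraint a"

lemma config_eqI:
  assumes "config_constraint C" "config_constraint D" "\<And>x. config_var C x = config_var D x"
  shows "C = D"
proof -
  obtain q p t a0 a1 a2 a3 a4 a5 a6 where C: "C = Config q p t (a0, a1, a2, a3, a4, a5, a6)"
    by (metis config.exhaust prod.exhaust)
  obtain q' p' t' b0 b1 b2 b3 b4 b5 b6 where D: "D = Config q' p' t' (b0, b1, b2, b3, b4, b5, b6)"
    by (metis config.exhaust prod.exhaust)
  note * = assms(3)[unfolded C D config_var_def, simplified]
  have "q = q'" "p = p'" "t = t'" "a0 = b0" "a2 = b2" "a3 = b3" "a4 = b4" "a5 = b5" "a6 = b6"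
    using *[of Var_q] *[of Var_p] *[of Var_t] *[of Var_a0] *[of Var_a2] *[of Var_a3] *[of Var_a4]
      *[of Var_a5] *[of Var_a6] by auto
  moreover from this have "a1 = b1"
    using assms(1,2) unfolding C D by (simp add: param_constraint_iff del: param_constraint.simps)
  ultimately show ?thesis by (simp add: C D)
qed

lemma config_constraint_generic [simp]: "config_constraint generic_config"
  by (simp add: generic_config_def generic_params_def)

lemma config_constraint_bt: "config_constraint C \<Longrightarrow> config_constraint (bt g C)"
proof -
  assume *: "config_constraint C"
  obtain q p t a0 a1 a2 a3 a4 a5 a6 where C: "C = Config q p t (a0, a1, a2, a3, a4, a5, a6)"
    by (metis config.exhaust prod.exhaust)
  show ?thesis
    by (insert *, unfold C, cases g) (simp_all add: algebra_simps)
qed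

lemma (in field_morphism) config_constraint_map:
  "config_constraint C \<Longrightarrow> config_constraint (map_config h C)"
proof -
  assume *: "config_constraint C"
  obtain q p t a0 a1 a2 a3 a4 a5 a6 where C: "C = Config q p t (a0, a1, a2, a3, a4, a5, a6)"
    by (metis config.exhaust prod.exhaust)
  show ?thesis
    using arg_cong[OF *[unfolded C config_constraint.simps param_constraint.simps], of h]
    by (simp add: C h_simps)
qed

lemma map_generic_eq_iff:
  assumes "field_morphism \<sigma>" "config_constraint C"
  shows "map_config \<sigma> generic_config = C \<longleftrightarrow> (\<forall>x. \<sigma> (rf_var x) = config_var C x)"
  using config_eqI[OF field_morphism.config_constraint_map[OF assms(1) config_constraint_generic] assms(2)]
  by (auto simp: config_var_map)

lemma ratfun_Aut_eqI:
  assumes "\<sigma> \<in> carrier ratfun_Aut" "\<tau> \<in> carrier ratfun_Aut"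
    "map_config \<sigma> generic_config = map_config \<tau> generic_config"
  shows "\<sigma> = \<tau>"
proof (rule ratfun_morphism_unique)
  fix x
  show "\<sigma> (rf_var x) = \<tau> (rf_var x)"
    using config_var_map[of \<sigma> generic_config x] config_var_map[of \<tau> generic_config x] assms(3)
    by simp
qed (use assms in \<open>auto simp: carrier_ratfun_Aut_iff\<close>)

text \<open>A substitution that is undone by itself wherever this makes sense is injective on polynomials
  and hence an involution of the whole field.\<close>

lemma ratfun_involution_exists:
  assumes "\<And>x. substitution.ev rf_const v (v x) (rf_var x)"
  shows "\<exists>\<sigma> \<in> carrier ratfun_Aut. (\<forall>x. \<sigma> (rf_var x) = v x) \<and> \<sigma> \<circ> \<sigma> = id"
proof -
  interpret substitution rf_const v ..
  have "E f \<noteq> 0" if "f \<noteq> 0" for f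
  proof
    assume "E f = 0"
    then have "ev 0 (Fract f 1)"
      using ev_poly_eval[of v rf_var f] assms by (simp add: poly_eval_rf_var)
    then have "Fract f 1 = 0" using ev_0 ev_unique by blast
    with that show False by (simp add: Zero_fract_def eq_fract)
  qed
  from ratfun_morphism_exists[OF this] obtain \<sigma> where
    \<sigma>: "field_morphism \<sigma>" "\<And>c. \<sigma> (rf_const c) = rf_const c" "\<And>x. \<sigma> (rf_var x) = v x" by blast
  interpret \<sigma>: field_morphism \<sigma> by fact
  have E: "\<sigma> (Fract a 1) = E a" for a
    using \<sigma> by (simp add: \<sigma>.h_poly_eval o_def flip: poly_eval_rf_var)
  have "\<sigma> (v x) = rf_var x" for x
  proof -
    obtain a b where ab: "v x = Fract a b" "E b \<noteq> 0" "rf_var x = E a / E b"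
      using assms[of x] by (auto simp: ev_def)
    then have "b \<noteq> 0" by auto
    then have "\<sigma> (Fract a b) = E a / E b"
      by (metis Fract_eq_divide \<sigma>.h_divide E)
    with ab show ?thesis by simp
  qed
  then have "\<sigma> \<circ> \<sigma> = (\<lambda>x. x)"
    using \<sigma> by (intro ratfun_morphism_unique field_morphism_comp field_morphism_id) auto
  then have "\<sigma> \<circ> \<sigma> = id" by (simp add: id_def)
  moreover from this have "bij \<sigma>"
    using o_bij by blast
  moreover from this have "\<sigma> \<in> carrier ratfun_Aut"
    using \<sigma> by (simp add: carrier_ratfun_Aut_iff)
  ultimately show ?thesis
    using \<sigma>(3) by blast
qed

section \<open>The automorphisms attached to the generators\<close>

lemma bt_involution:
  assumes "bt_defined g q p"
  shows "bt g (bt g (Config q p t a)) = Config q p t a"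
proof -
  obtain a0 a1 a2 a3 a4 a5 a6 where a: "a = (a0, a1, a2, a3, a4, a5, a6)" by (cases a) auto
  define r where "r = q - 1"
  have q: "q = r + 1" by (simp add: r_def)
  have "(r + 1) / r - 1 = 1 / r" if "r \<noteq> 0"
    using that by (simp add: field_simps)
  then show ?thesis
    using assms unfolding a q by (cases g) auto
qed

lemma bt_defined_bt:
  assumes "bt_defined g q p" "bt g (Config q p t a) = Config q' p' t' a'"
  shows "bt_defined g q' p'"
proof -
  obtain a0 a1 a2 a3 a4 a5 a6 where a: "a = (a0, a1, a2, a3, a4, a5, a6)" by (cases a) auto
  show ?thesis
    using assms unfolding a by (cases g) (auto simp: field_simps)
qed

lemma config_eta:
  assumes "config_constraint D"
  defines "w \<equiv> config_var D"
  shows "D = Config (w Var_q) (w Var_p) (w Var_t)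
    (w Var_a0, - (3 * w Var_a0 + 2 * w Var_a2 + w Var_a3 + 2 * w Var_a4 + 2 * w Var_a5 + w Var_a6),
     w Var_a2, w Var_a3, w Var_a4, w Var_a5, w Var_a6)"
proof -
  obtain q p t a0 a1 a2 a3 a4 a5 a6 where D: "D = Config q p t (a0, a1, a2, a3, a4, a5, a6)"
    by (metis config.exhaust prod.exhaust)
  show ?thesis
    using assms(1) by (simp add: D w_def config_var_def param_constraint_iff del: param_constraint.simps)
qed

lemma (in substitution) rel_generic:
  assumes "config_constraint D" "config_var D = v"
  shows "rel_config ev generic_config D"
  by (subst config_eta[OF assms(1)])
     (auto simp: generic_config_def generic_params_def assms(2) simp del: minus_add_distrib intro!: ev_intros)

text \<open>The factors by which one divides in the relations among the generators:
  \<open>q\<close>, \<open>q - 1\<close>, \<open>p\<close>, and the numerators that these acquire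
  after one generator. For example \<open>S0\<close> turns \<open>q\<close> into
  \<open>(q * p + a0) / p\<close>.\<close>

definition good_config :: "'k::field config \<Rightarrow> bool" where
  "good_config C = (case C of Config q p t (a0, a1, a2, a3, a4, a5, a6) \<Rightarrow>
     q \<noteq> 0 \<and> q - 1 \<noteq> 0 \<and> p \<noteq> 0 \<and> q * p + a0 \<noteq> 0 \<and> (q - 1) * p + a0 \<noteq> 0 \<and>
     q * p - a2 \<noteq> 0 \<and> (q - 1) * p - a4 \<noteq> 0)"

lemma substitution_id: "substitution (\<lambda>x :: complex. x)"
  by (simp add: substitution_def field_morphism_id)

lemma good_generic: "good_config generic_config"
proof -
  \<comment> \<open>At \<open>q = 2\<close>, \<open>p = 1\<close> with all other variables 0 none of
    the seven factors vanishes, and a rational function with a nonzero value is nonzero.\<close>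
  interpret substitution "\<lambda>x :: complex. x" "\<lambda>x. if x = Var_q then 2 else if x = Var_p then 1 else 0"
    by (rule substitution_id)
  note q = ev_var[of Var_q, simplified] and p = ev_var[of Var_p, simplified]
    and a = ev_var[of Var_a0, simplified] ev_var[of Var_a2, simplified] ev_var[of Var_a4, simplified]
  let ?q = "rf_var Var_q" and ?p = "rf_var Var_p"
  have "ev ?q 2" "ev (?q - 1) (2 - 1)" "ev ?p 1" "ev (?q * ?p + rf_var Var_a0) (2 * 1 + 0)"
    "ev ((?q - 1) * ?p + rf_var Var_a0) ((2 - 1) * 1 + 0)"
    "ev (?q * ?p - rf_var Var_a2) (2 * 1 - 0)"
    "ev ((?q - 1) * ?p - rf_var Var_a4) ((2 - 1) * 1 - 0)"
    by (intro ev_add ev_diff ev_mult ev_1 q p a)+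
  from this[THEN ev_nonzero] show ?thesis
    by (simp add: good_config_def generic_config_def generic_params_def)
qed

lemma good_config_defined: "good_config (Config q p t a) \<Longrightarrow> bt_defined g q p"
  by (cases g) (auto simp: good_config_def split: prod.splits)

lemma bt_bt_good: "good_config C \<Longrightarrow> bt g (bt g C) = C"
  by (cases C) (simp add: bt_involution good_config_defined)

lemma substitution_rf_const: "substitution rf_const"
  by (simp add: substitution_def rf_const.field_morphism_axioms)

text \<open>The substitution \<open>v\<close> takes the generic configuration to \<open>C\<close>,
  hence takes \<open>C\<close> to \<open>bt g C\<close>, which is the generic configuration again
  because \<open>bt g\<close> is an involution. So \<open>v\<close> undoes itself and
  \<open>ratfun_involution_exists\<close> applies.\<close>

lemma induces_exists:
  obtains \<sigma> where "induces g \<sigma>" "\<sigma> \<circ> \<sigma> = id"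
proof -
  define C where "C = bt g generic_config"
  define v where "v = config_var C"
  interpret substitution rf_const v by (rule substitution_rf_const)
  obtain q p t a where gen: "generic_config = Config q p t a" by (cases "generic_config :: ratfun config")
  obtain q' p' t' a' where C: "C = Config q' p' t' a'" by (cases C)
  have cC: "config_constraint C"
    by (simp add: C_def config_constraint_bt)
  have d: "bt_defined g q p"
    using good_generic gen good_config_defined by metis
  then have d': "bt_defined g q' p'"
    using bt_defined_bt C C_def gen by metis
  have "rel_config ev (bt g generic_config) (bt g C)"
    using rel_bt[OF _ d'] rel_generic[OF cC] v_def unfolding C gen by simp
  then have "rel_config ev C generic_config"
    using bt_bt_good[OF good_generic, of g] by (simp add: C_def)
  then have "ev (v x) (rf_var x)" for x
    using config_var_rel[of ev C generic_config x] by (simp add: v_def)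
  from ratfun_involution_exists[OF this] obtain \<sigma> where
    \<sigma>: "\<sigma> \<in> carrier ratfun_Aut" "\<And>x. \<sigma> (rf_var x) = v x" "\<sigma> \<circ> \<sigma> = id" by blast
  then have "map_config \<sigma> generic_config = C"
    using map_generic_eq_iff[OF _ cC] by (auto simp: carrier_ratfun_Aut_iff v_def)
  with \<sigma> that show ?thesis by (simp add: induces_def C_def)
qed

lemma induces_unique: "\<exists>!\<sigma>. induces g \<sigma>"
proof -
  obtain \<sigma> where "induces g \<sigma>" using induces_exists by blast
  then show ?thesis
    using ratfun_Aut_eqI by (intro ex1I[of _ \<sigma>]) (auto simp: induces_def)
qed

lemma bt_aut: "bt_aut g \<in> carrier ratfun_Aut" "map_config (bt_aut g) generic_config = bt g generic_config"
  and bt_aut_involution: "bt_aut g \<circ> bt_aut g = id"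
proof -
  obtain \<sigma> where "induces g \<sigma>" "\<sigma> \<circ> \<sigma> = id" using induces_exists by blast
  moreover from this have "bt_aut g = \<sigma>"
    using induces_unique unfolding bt_aut_def by (auto intro: the1_equality)
  ultimately show "bt_aut g \<in> carrier ratfun_Aut" "map_config (bt_aut g) generic_config = bt g generic_config"
    "bt_aut g \<circ> bt_aut g = id"
    by (auto simp: induces_def)
qed

lemma ratfun_Aut_simps [simp]: "\<one>\<^bsub>ratfun_Aut\<^esub> = id" "x \<otimes>\<^bsub>ratfun_Aut\<^esub> y = x \<circ> y"
  by (simp_all add: ratfun_Aut_def)

lemma ratfun_Aut_comp:
  "\<sigma> \<in> carrier ratfun_Aut \<Longrightarrow> \<tau> \<in> carrier ratfun_Aut \<Longrightarrow> \<sigma> \<circ> \<tau> \<in> carrier ratfun_Aut"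
  by (auto simp: carrier_ratfun_Aut_iff intro: field_morphism_comp bij_comp)

lemma ratfun_Aut_id: "id \<in> carrier ratfun_Aut"
  by (simp add: carrier_ratfun_Aut_iff field_morphism_def)

lemma group_ratfun_Aut: "group ratfun_Aut"
proof (rule groupI)
  fix \<sigma> assume \<sigma>: "\<sigma> \<in> carrier ratfun_Aut"
  then interpret field_morphism \<sigma> by (simp add: carrier_ratfun_Aut_iff)
  have b: "bij \<sigma>" and c: "\<And>c. \<sigma> (rf_const c) = rf_const c"
    using \<sigma> by (simp_all add: carrier_ratfun_Aut_iff)
  have inv: "inv_into UNIV \<sigma> (\<sigma> x) = x" "\<sigma> (inv_into UNIV \<sigma> x) = x" for x
    using b by (simp_all add: bij_is_inj bij_is_surj surj_f_inv_f)
  have "inv_into UNIV \<sigma> (x + y) = inv_into UNIV \<sigma> x + inv_into UNIV \<sigma> y"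
    "inv_into UNIV \<sigma> (x * y) = inv_into UNIV \<sigma> x * inv_into UNIV \<sigma> y"
    "inv_into UNIV \<sigma> 1 = 1" "inv_into UNIV \<sigma> (rf_const d) = rf_const d" for x y d
    using c inv h_add h_mult h_1 by metis+
  then have "inv_into UNIV \<sigma> \<in> carrier ratfun_Aut"
    using b by (simp add: carrier_ratfun_Aut_iff field_morphism_def bij_imp_bij_inv)
  moreover have "inv_into UNIV \<sigma> \<circ> \<sigma> = id"
    using inv by auto
  ultimately show "\<exists>\<tau>\<in>carrier ratfun_Aut. \<tau> \<otimes>\<^bsub>ratfun_Aut\<^esub> \<sigma> = \<one>\<^bsub>ratfun_Aut\<^esub>"
    by auto
qed (simp_all add: ratfun_Aut_comp ratfun_Aut_id o_assoc)

section \<open>Products of the generating automorphisms\<close>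

definition aut :: "gen list \<Rightarrow> ratfun \<Rightarrow> ratfun" where
  "aut us = foldr (\<lambda>g \<sigma>. bt_aut g \<circ> \<sigma>) us id"

lemma aut_Nil [simp]: "aut [] = id"
  and aut_Cons: "aut (g # us) = bt_aut g \<circ> aut us"
  by (simp_all add: aut_def)

lemma aut_append: "aut (us @ vs) = aut us \<circ> aut vs"
  by (induction us) (simp_all add: aut_Cons o_assoc)

lemma aut_carrier: "aut us \<in> carrier ratfun_Aut"
  by (induction us) (simp_all only: aut_Nil aut_Cons ratfun_Aut_id ratfun_Aut_comp bt_aut)

lemma aut_rev: "aut us \<circ> aut (rev us) = id"
proof (induction us)
  case (Cons g us)
  have "aut (g # us) \<circ> aut (rev (g # us)) = bt_aut g \<circ> (aut us \<circ> aut (rev us)) \<circ> bt_aut g"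
    by (simp add: aut_Cons aut_append fun_eq_iff)
  with Cons bt_aut_involution show ?case by (simp only: comp_id)
qed simp

text \<open>Composition of automorphisms on the left corresponds to successive substitution in reverse
  order, which is what \<^const>\<open>fold\<close> computes.\<close>

lemma map_aut: "map_config (aut us) generic_config = fold bt us generic_config"
proof (induction us)
  case (Cons g us)
  interpret field_morphism "bt_aut g"
    using bt_aut(1) by (simp add: carrier_ratfun_Aut_iff)
  have "map_config (bt_aut g) (fold bt us C) = fold bt us (map_config (bt_aut g) C)" for C
    by (induction us arbitrary: C) (simp_all add: map_bt)
  moreover have "map_config (aut (g # us)) generic_config = map_config (bt_aut g) (map_config (aut us) generic_config)"
    by (simp only: aut_Cons config.map_comp)
  ultimately show ?case
    using Cons bt_aut(2)[of g] by simp
qed (simp add: config.map_ident)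

lemma aut_eqI: "fold bt us generic_config = fold bt vs generic_config \<Longrightarrow> aut us = aut vs"
  by (rule ratfun_Aut_eqI) (simp_all add: aut_carrier map_aut)

subsection \<open>Relations\<close>

definition nodegen :: "nat \<Rightarrow> gen" where
  "nodegen i = [S0, S1, S2, S3, S4, S5, S6] ! i"

lemma nodegen_simps [simp]:
  "nodegen 0 = S0" "nodegen 1 = S1" "nodegen (Suc 0) = S1" "nodegen 2 = S2" "nodegen 3 = S3"
  "nodegen 4 = S4" "nodegen 5 = S5" "nodegen 6 = S6"
  by (simp_all add: nodegen_def)

text \<open>With \<open>x = q\<close> this is the braid relation of \<open>S0\<close> and
  \<open>S2\<close> on the pair \<open>(q, p)\<close>, with \<open>x = q - 1\<close> that of
  \<open>S0\<close> and \<open>S4\<close>. In terms of \<open>z = x * y\<close> every intermediate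
  value factors, since each step multiplies one coordinate by a ratio of translates of
  \<open>z\<close>.\<close>

lemma braid_identity:
  fixes x y a b :: "'k::field"
  assumes "x \<noteq> 0" "y \<noteq> 0" "x * y + a \<noteq> 0" "x * y - b \<noteq> 0"
  shows "(x + a / y) + b / (y - (b + a) / (x + a / y)) = x + (a + b) / (y - b / x)" (is ?Q)
    and "y - (b + a) / (x + a / y) = (y - b / x) - a / (x + (a + b) / (y - b / x))" (is ?P)
proof -
  define z where "z = x * y"
  have nz: "x \<noteq> 0" "y \<noteq> 0" "z + a \<noteq> 0" "z - b \<noteq> 0"
    using assms by (simp_all add: z_def)
  have 1: "x + a / y = (z + a) / y" "y - b / x = (z - b) / x"
    using nz by (simp_all add: divide_simps z_def)
  have 2: "y - (b + a) / (x + a / y) = y * (z - b) / (z + a)"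
    unfolding 1 using nz by (simp add: divide_simps, simp add: algebra_simps z_def)
  have 3: "x + (a + b) / (y - b / x) = x * (z + a) / (z - b)"
    unfolding 1 using nz by (simp add: divide_simps, simp add: algebra_simps z_def)
  show ?P
    unfolding 2 3 unfolding 1 using nz by (simp add: divide_simps, simp add: algebra_simps z_def)
  show ?Q
    unfolding 2 3 unfolding 1 using nz by (simp add: divide_simps, simp add: algebra_simps z_def)
qed

lemma braid_bt:
  assumes "good_config C" "{i, j} \<in> E6_edges"
  shows "fold bt [nodegen i, nodegen j, nodegen i] C = fold bt [nodegen j, nodegen i, nodegen j] C"
proof -
  obtain q p t a0 a1 a2 a3 a4 a5 a6 where C: "C = Config q p t (a0, a1, a2, a3, a4, a5, a6)"
    by (metis config.exhaust prod.exhaust)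
  have g: "q \<noteq> 0" "q - 1 \<noteq> 0" "p \<noteq> 0" "q * p + a0 \<noteq> 0" "q * p - a2 \<noteq> 0"
     "(q - 1) * p + a0 \<noteq> 0" "(q - 1) * p - a4 \<noteq> 0"
    using assms(1) by (auto simp: good_config_def C)
  note 02 = braid_identity[OF g(1,3,4,5)]
  note 04 = braid_identity[OF g(2,3,6,7)]
  have "fold bt [S0, S2, S0] C = fold bt [S2, S0, S2] C"
    unfolding C using 02 by (simp add: add.commute)
  moreover have "fold bt [S0, S4, S0] C = fold bt [S4, S0, S4] C"
    unfolding C using 04 by (simp add: add_ac diff_add_eq)
  \<comment> \<open>On the remaining edges at most one of the two generators moves
    \<open>(q, p)\<close>, so only sums of parameters over a common denominator are
    compared.\<close>
  moreover have "fold bt [S0, S5, S0] C = fold bt [S5, S0, S5] C"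
    "fold bt [S2, S1, S2] C = fold bt [S1, S2, S1] C"
    "fold bt [S4, S3, S4] C = fold bt [S3, S4, S3] C"
    "fold bt [S5, S6, S5] C = fold bt [S6, S5, S6] C"
    unfolding C by (simp_all add: add_ac add_divide_distrib diff_divide_distrib)
  ultimately show ?thesis
    using assms(2) by (auto simp: E6_edges_def doubleton_eq_iff)
qed

lemma commute_bt:
  assumes "good_config C" "i < 7" "j < 7" "i \<noteq> j" "{i, j} \<notin> E6_edges"
  shows "fold bt [nodegen i, nodegen j] C = fold bt [nodegen j, nodegen i] C"
proof -
  obtain q p t a0 a1 a2 a3 a4 a5 a6 where C: "C = Config q p t (a0, a1, a2, a3, a4, a5, a6)"
    by (metis config.exhaust prod.exhaust)
  show ?thesis
    using less_7_cases[OF assms(2)] less_7_cases[OF assms(3)] assms(4,5) unfolding C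
    by (elim disjE) (simp_all add: E6_edges_def doubleton_eq_iff algebra_simps)
qed

lemma pi_bt:
  assumes "good_config C" "i < 7" "g \<in> {Pi1, Pi2, Pi3}"
  shows "fold bt [g, nodegen i] C = fold bt [nodegen (snd (E6_gen g) i), g] C"
proof -
  obtain q p t a0 a1 a2 a3 a4 a5 a6 where C: "C = Config q p t (a0, a1, a2, a3, a4, a5, a6)"
    by (metis config.exhaust prod.exhaust)
  have g: "q \<noteq> 0" "q - 1 \<noteq> 0" "p \<noteq> 0" "q * p + a0 \<noteq> 0" "q * p - a2 \<noteq> 0"
     "(q - 1) * p + a0 \<noteq> 0" "(q - 1) * p - a4 \<noteq> 0"
    using assms(1) by (auto simp: good_config_def C)
  \<comment> \<open>\<open>z / p\<close> and \<open>w / p\<close> are the values of \<open>q\<close>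
    and \<open>q - 1\<close> after \<open>S0\<close>. They carry the case of node 0, where
    \<open>Pi2\<close> and \<open>Pi3\<close> put the shifted coordinate into a denominator.\<close>
  define z w where "z = q * p + a0" and "w = (q - 1) * p + a0"
  have q1: "q / (q - 1) - 1 = 1 / (q - 1)" "1 / q - 1 = (1 - q) / q" "1 - q = - (q - 1)"
    using g by (simp_all add: field_simps)
  have q2: "q + a0 / p = z / p" "q + a0 / p - 1 = w / p" "1 - (q + a0 / p) = - (w / p)"
    using g by (simp_all add: z_def w_def field_simps)
  have nz: "z \<noteq> 0" "w \<noteq> 0"
    using g by (simp_all add: z_def w_def)
  have "1 / q + a0 / - (z * q) = p / z" "q / (q - 1) + a0 / - ((q - 1) * w) = z / w"
    using nz g by (simp_all add: divide_simps) (simp_all add: z_def w_def algebra_simps)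
  moreover have "(- (q * p) - a0) * q = - (z * q)" "(1 - q) * ((q - 1) * p + a0) = - ((q - 1) * w)"
    by (simp_all add: z_def w_def algebra_simps)
  ultimately have *: "1 / q + a0 / ((- (q * p) - a0) * q) = 1 / (q + a0 / p)"
      "(- (q * p) - a0) * q = (a0 - (q + a0 / p) * p) * (q + a0 / p)"
      "q / (q - 1) + a0 / ((1 - q) * ((q - 1) * p + a0)) = (q + a0 / p) / (q + a0 / p - 1)"
      "(1 - q) * ((q - 1) * p + a0) = (1 - (q + a0 / p)) * ((q + a0 / p - 1) * p - a0)"
    using g nz unfolding q2(2,3) unfolding q2(1) by (simp_all add: z_def w_def)
  have **: "a4 / (1 - q) = - (a4 / (q - 1))"
    by (simp only: q1(3) minus_divide_right)
  \<comment> \<open>The next two computations serve fixed nodes next to the centre: node 4 under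
    \<open>Pi2\<close> and node 2 under \<open>Pi3\<close>.\<close>
  have "q * (a4 / (q - 1)) - a4 = a4 / (q - 1)"
    using g by (simp add: divide_simps) (simp add: algebra_simps)
  then have ***: "(- (q * p) - a0) * q - a4 * q / (1 - q) = (- a0 - a4 - q * (p - a4 / (q - 1))) * q"
    unfolding times_divide_eq_left[symmetric] ** by (simp add: algebra_simps)
  have "(1 - q) * ((q - 1) * p + a0) - (q - 1) * e =
        (1 - q) * ((q - 1) * (p - e) + (a0 + q * e))" for e
    by (simp add: algebra_simps)
  from this[of "a2 / q"] have ****: "(1 - q) * ((q - 1) * p + a0) - a2 * (q - 1) / q =
        (1 - q) * ((q - 1) * (p - a2 / q) + (a0 + a2))"
    using g by (simp add: mult.commute)
  have e: "q * (p - a2 / q) = q * p - a2" "(q - 1) * (p - a4 / (q - 1)) = (q - 1) * p - a4"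
    using g by (simp_all add: right_diff_distrib)
  show ?thesis
    using less_7_cases[OF assms(2)] assms(3) unfolding C
    by (elim disjE insertE emptyE)
      (simp_all add: transpose_def q1(1,2) *(1,3) *(2,4)[symmetric] *** **** e del: right_minus_eq,
       simp_all add: ** algebra_simps)
qed

abbreviation word_aut :: "nat list \<Rightarrow> ratfun \<Rightarrow> ratfun" where
  "word_aut w \<equiv> aut (map nodegen w)"

lemma aut_square: "aut [g, g] = id"
  using aut_rev[of "[g]"] by (simp add: aut_Cons)

lemma word_aut_order:
  assumes "i < 7" "j < 7"
  shows "word_aut (concat (replicate (E6_order i j) [i, j])) = id"
proof -
  consider "i = j" | "i \<noteq> j" "{i, j} \<in> E6_edges" | "i \<noteq> j" "{i, j} \<notin> E6_edges" by blast
  then show ?thesis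
  proof cases
    case 1
    then show ?thesis by (simp add: E6_order_def aut_square)
  next
    case 2
    let ?u = "[nodegen i, nodegen j, nodegen i]" and ?v = "[nodegen j, nodegen i, nodegen j]"
    have "aut ?u = aut ?v"
      by (rule aut_eqI[OF braid_bt[OF good_generic 2(2)]])
    then have "aut (?u @ ?v) = id"
      using aut_rev[of ?v] unfolding aut_append[of ?u ?v] by simp
    then show ?thesis
      using 2 by (simp add: E6_order_def numeral_3_eq_3)
  next
    case 3
    let ?u = "[nodegen i, nodegen j]" and ?v = "[nodegen j, nodegen i]"
    have "aut ?u = aut ?v"
      by (rule aut_eqI[OF commute_bt[OF good_generic assms 3]])
    then have "aut (?u @ ?u) = id"
      using aut_rev[of ?u] unfolding aut_append[of ?u ?u] by simp
    then show ?thesis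
      using 3 by (simp add: E6_order_def numeral_2_eq_2)
  qed
qed

lemma word_aut_cong: "E6_word_eq u v \<Longrightarrow> word_aut u = word_aut v"
proof (induction rule: E6_word_eq.induct)
  case (rel i j u v)
  then have "word_aut (concat (replicate (E6_order i j) [i, j])) = id"
    by (simp add: word_aut_order E6_nodes_eq)
  then show ?case
    by (simp only: map_append aut_append id_comp)
qed auto

section \<open>Words in the diagram generators and their permutations\<close>

abbreviation pi_gens :: "gen set" where
  "pi_gens \<equiv> {Pi1, Pi2, Pi3}"

definition pi_perm :: "gen list \<Rightarrow> nat \<Rightarrow> nat" where
  "pi_perm \<rho> = foldr (\<lambda>g \<sigma>. snd (E6_gen g) \<circ> \<sigma>) \<rho> id"

lemma pi_perm_Nil [simp]: "pi_perm [] = id"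
  and pi_perm_Cons: "pi_perm (g # \<rho>) = snd (E6_gen g) \<circ> pi_perm \<rho>"
  by (simp_all add: pi_perm_def)

lemma pi_perm_append: "pi_perm (\<rho> @ \<rho>') = pi_perm \<rho> \<circ> pi_perm \<rho>'"
  by (induction \<rho>) (simp_all add: pi_perm_Cons o_assoc)

lemma pi_gen_nodes: "g \<in> pi_gens \<Longrightarrow> snd (E6_gen g) i < 7 \<longleftrightarrow> i < 7"
  by (elim insertE emptyE) (auto simp: Transposition.transpose_def)

lemma pi_perm_nodes: "\<rho> \<in> lists pi_gens \<Longrightarrow> pi_perm \<rho> i \<in> E6_nodes \<longleftrightarrow> i \<in> E6_nodes"
proof (induction \<rho>)
  case (Cons g \<rho>)
  then have "g \<in> pi_gens" "\<rho> \<in> lists pi_gens" by (simp_all only: Cons_in_lists_iff)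
  then show ?case
    using pi_gen_nodes[of g "pi_perm \<rho> i"] Cons.IH
    unfolding pi_perm_Cons o_apply E6_nodes_eq lessThan_iff by blast
qed simp

lemma bt_aut_word_aut:
  assumes "g \<in> pi_gens" "w \<in> lists E6_nodes"
  shows "bt_aut g \<circ> word_aut w = word_aut (map (snd (E6_gen g)) w) \<circ> bt_aut g"
  using assms(2)
proof (induction w rule: list.induct)
  case (Cons i w)
  have i: "i < 7" and w: "w \<in> lists E6_nodes" using Cons.prems by (simp_all add: E6_nodes_eq)
  have 1: "aut [g, nodegen i] = aut [nodegen (snd (E6_gen g) i), g]"
    by (rule aut_eqI[OF pi_bt[OF good_generic i assms(1)]])
  have "bt_aut g \<circ> word_aut (i # w) = aut [g, nodegen i] \<circ> word_aut w"
    by (simp add: aut_Cons o_assoc)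
  also have "\<dots> = bt_aut (nodegen (snd (E6_gen g) i)) \<circ> (bt_aut g \<circ> word_aut w)"
    unfolding 1 by (simp add: aut_Cons o_assoc)
  also have "\<dots> = word_aut (map (snd (E6_gen g)) (i # w)) \<circ> bt_aut g"
    unfolding Cons.IH[OF w] by (simp add: aut_Cons o_assoc)
  finally show ?case .
qed simp

lemma aut_word_aut:
  assumes "\<rho> \<in> lists pi_gens" "w \<in> lists E6_nodes"
  shows "aut \<rho> \<circ> word_aut w = word_aut (map (pi_perm \<rho>) w) \<circ> aut \<rho>"
  using assms(1)
proof (induction \<rho> rule: list.induct)
  case (Cons g \<rho>)
  have *: "map (pi_perm \<rho>) w \<in> lists E6_nodes"
    using assms(2) pi_perm_nodes[of \<rho>] Cons.prems by (simp add: in_lists_conv_set)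
  have "aut (g # \<rho>) \<circ> word_aut w = bt_aut g \<circ> word_aut (map (pi_perm \<rho>) w) \<circ> aut \<rho>"
    using Cons unfolding aut_Cons comp_assoc by (simp only: Cons_in_lists_iff)
  also have "\<dots> = word_aut (map (pi_perm (g # \<rho>)) w) \<circ> aut (g # \<rho>)"
    using bt_aut_word_aut[OF _ *, of g] Cons.prems by (simp add: aut_Cons pi_perm_Cons comp_assoc)
  finally show ?case .
qed simp

subsection \<open>Asymptotics at the point \<open>(q, p) = (0, \<infinity>)\<close>\<close>

fun pnth :: "'k params \<Rightarrow> nat \<Rightarrow> 'k" where
  "pnth (a0, a1, a2, a3, a4, a5, a6) j = [a0, a1, a2, a3, a4, a5, a6] ! j"

lemma params_eqI: "(\<And>j. j < 7 \<Longrightarrow> pnth a j = pnth b j) \<Longrightarrow> a = b"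
proof -
  assume *: "\<And>j. j < 7 \<Longrightarrow> pnth a j = pnth b j"
  obtain a0 a1 a2 a3 a4 a5 a6 where a: "a = (a0, a1, a2, a3, a4, a5, a6)" by (cases a) auto
  obtain b0 b1 b2 b3 b4 b5 b6 where b: "b = (b0, b1, b2, b3, b4, b5, b6)" by (cases b) auto
  show ?thesis
    using *[of 0] *[of 1] *[of 2] *[of 3] *[of 4] *[of 5] *[of 6] by (simp add: a b)
qed

fun config_q :: "'k config \<Rightarrow> 'k" where "config_q (Config q p t a) = q"
fun config_p :: "'k config \<Rightarrow> 'k" where "config_p (Config q p t a) = p"
fun config_t :: "'k config \<Rightarrow> 'k" where "config_t (Config q p t a) = t"
fun config_a :: "'k config \<Rightarrow> nat \<Rightarrow> 'k" where "config_a (Config q p t a) = pnth a"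

lemma config_coords_eqI:
  assumes "config_q C = config_q D" "config_p C = config_p D" "config_t C = config_t D"
    "\<And>j. j < 7 \<Longrightarrow> config_a C j = config_a D j"
  shows "C = D"
proof -
  obtain q p t a where C: "C = Config q p t a" by (cases C)
  obtain q' p' t' a' where D: "D = Config q' p' t' a'" by (cases D)
  have "a = a'" using assms(4) unfolding C D config_a.simps by (rule params_eqI)
  with assms show ?thesis by (simp add: C D)
qed

lemma config_a_map: "j < 7 \<Longrightarrow> config_a (map_config h C) j = h (config_a C j)"
proof -
  assume "j < 7"
  obtain q p t a0 a1 a2 a3 a4 a5 a6 where C: "C = Config q p t (a0, a1, a2, a3, a4, a5, a6)"
    by (metis config.exhaust prod.exhaust)
  show "config_a (map_config h C) j = h (config_a C j)"
    using less_7_cases[OF \<open>j < 7\<close>] unfolding C by (elim disjE) simp_all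
qed

lemma config_a_bt:
  assumes "i < 7" "j < 7"
  shows "config_a (bt (nodegen i) C) j = config_a C j - of_int (cartan i j) * config_a C i"
proof -
  obtain q p t a0 a1 a2 a3 a4 a5 a6 where C: "C = Config q p t (a0, a1, a2, a3, a4, a5, a6)"
    by (metis config.exhaust prod.exhaust)
  show ?thesis
    using less_7_cases[OF assms(1)] less_7_cases[OF assms(2)] unfolding C
    by (elim disjE) (simp_all add: cartan_def E6_edges_def doubleton_eq_iff)
qed

lemma config_q_bt:
  assumes "i < 7"
  shows "config_q (bt (nodegen i) C) = (if i = 0 then config_q C + config_a C 0 / config_p C else config_q C)"
    and "config_p (bt (nodegen i) C) =
      (if i = 2 then config_p C - config_a C 2 / config_q C
       else if i = 4 then config_p C - config_a C 4 / (config_q C - 1) else config_p C)"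
    and "config_t (bt (nodegen i) C) = config_t C"
proof -
  obtain q p t a0 a1 a2 a3 a4 a5 a6 where C: "C = Config q p t (a0, a1, a2, a3, a4, a5, a6)"
    by (metis config.exhaust prod.exhaust)
  show "config_q (bt (nodegen i) C) = (if i = 0 then config_q C + config_a C 0 / config_p C else config_q C)"
    "config_p (bt (nodegen i) C) =
      (if i = 2 then config_p C - config_a C 2 / config_q C
       else if i = 4 then config_p C - config_a C 4 / (config_q C - 1) else config_p C)"
    "config_t (bt (nodegen i) C) = config_t C"
    using less_7_cases[OF assms] unfolding C by (elim disjE; simp)+
qed

text \<open>Interprets a coefficient vector as a rational function, with \<open>qp\<close> in the
  role of \<open>x\<close>. The generic parameters satisfy the constraint, so the null root goes to
  0.\<close>

definition lin_form :: "(nat \<Rightarrow> int) \<Rightarrow> ratfun" where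
  "lin_form c = of_int (c 7) * (rf_var Var_q * rf_var Var_p) +
     (\<Sum>j<7. of_int (c j) * config_a generic_config j)"

lemma lin_form_lin: "lin_form (\<lambda>k. a * c k + b * d k) = of_int a * lin_form c + of_int b * lin_form d"
  by (simp add: lin_form_def sum.distrib sum_distrib_left algebra_simps)

text \<open>The kernel is spanned by the null root, because the six independent parameters and
  \<open>qp\<close> are linearly independent. The multiple is read off at node 1, whose mark is 1
  and whose parameter is the eliminated one.\<close>

lemma lin_form_eq_0:
  assumes "lin_form c = 0"
  shows "c 7 = 0" "j < 7 \<Longrightarrow> c j = c 1 * null_root j"
proof -
  have *: "of_int (c 7) * (z Var_q * z Var_p) + (of_int (c 0) * z Var_a0 +
      of_int (c 1) * - (3 * z Var_a0 + 2 * z Var_a2 + z Var_a3 + 2 * z Var_a4 + 2 * z Var_a5 + z Var_a6) +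
      of_int (c 2) * z Var_a2 + of_int (c 3) * z Var_a3 + of_int (c 4) * z Var_a4 +
      of_int (c 5) * z Var_a5 + of_int (c 6) * z Var_a6) = (0 :: complex)" for z
  proof -
    interpret substitution "\<lambda>x :: complex. x" z by (rule substitution_id)
    have eq: "lin_form c = of_int (c 7) * (rf_var Var_q * rf_var Var_p) + (of_int (c 0) * rf_var Var_a0 +
      of_int (c 1) * - (3 * rf_var Var_a0 + 2 * rf_var Var_a2 + rf_var Var_a3 + 2 * rf_var Var_a4 +
        2 * rf_var Var_a5 + rf_var Var_a6) +
      of_int (c 2) * rf_var Var_a2 + of_int (c 3) * rf_var Var_a3 + of_int (c 4) * rf_var Var_a4 +
      of_int (c 5) * rf_var Var_a5 + of_int (c 6) * rf_var Var_a6)" (is "_ = ?R")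
      by (simp add: lin_form_def lessThan_7 generic_config_def generic_params_def add.assoc)
    have "ev ?R (of_int (c 7) * (z Var_q * z Var_p) + (of_int (c 0) * z Var_a0 +
      of_int (c 1) * - (3 * z Var_a0 + 2 * z Var_a2 + z Var_a3 + 2 * z Var_a4 + 2 * z Var_a5 + z Var_a6) +
      of_int (c 2) * z Var_a2 + of_int (c 3) * z Var_a3 + of_int (c 4) * z Var_a4 +
      of_int (c 5) * z Var_a5 + of_int (c 6) * z Var_a6))" (is "ev _ ?y")
      by (intro ev_add ev_mult ev_minus ev_of_int ev_var ev_numeral)
    then have "ev 0 ?y"
      unfolding eq[symmetric] assms .
    then show ?thesis
      using ev_0 by (rule ev_unique)
  qed
  show "c 7 = 0"
    using *[of "\<lambda>x. if x = Var_q \<or> x = Var_p then 1 else 0"] by simp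
  have pt: "of_int x = (of_int y :: complex) \<Longrightarrow> x = y" for x y by simp
  have "c 0 = c 1 * 3" "c 2 = c 1 * 2" "c 3 = c 1" "c 4 = c 1 * 2" "c 5 = c 1 * 2" "c 6 = c 1"
    using *[of "\<lambda>x. if x = Var_a0 then 1 else 0"] *[of "\<lambda>x. if x = Var_a2 then 1 else 0"]
      *[of "\<lambda>x. if x = Var_a3 then 1 else 0"] *[of "\<lambda>x. if x = Var_a4 then 1 else 0"]
      *[of "\<lambda>x. if x = Var_a5 then 1 else 0"] *[of "\<lambda>x. if x = Var_a6 then 1 else 0"]
    by (intro pt; simp)+
  then show "c j = c 1 * null_root j" if "j < 7"
    using less_7_cases[OF that] by (auto simp: null_root_def)
qed

interpretation fls_const: field_morphism "fls_const :: 'k::field \<Rightarrow> 'k fls"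
  by standard (simp_all add: fls_plus_const)

text \<open>The substitution \<open>q \<mapsto> q \<epsilon>\<close>, \<open>p \<mapsto> p / \<epsilon>\<close>, whose order in \<open>\<epsilon>\<close> is the vanishing
  order along the curve with coordinate \<open>qp\<close> over the point \<open>(0, \<infinity>)\<close>.\<close>

definition asym_config :: "ratfun fls config" where
  "asym_config = (case map_config fls_const generic_config of Config q p t a \<Rightarrow>
     Config (q * fls_X) (p * fls_X_inv) t a)"

definition asym_const :: "complex \<Rightarrow> ratfun fls" where
  "asym_const = fls_const \<circ> rf_const"

interpretation asym: substitution asym_const "config_var asym_config"
  unfolding substitution_def asym_const_def
  by (rule field_morphism_comp fls_const.field_morphism_axioms rf_const.field_morphism_axioms)+

lemma asym_config_eq:
  "config_q asym_config = fls_const (rf_var Var_q) * fls_X"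
  "config_p asym_config = fls_const (rf_var Var_p) * fls_X_inv"
  "config_t asym_config = fls_const (rf_var Var_t)"
  "j < 7 \<Longrightarrow> config_a asym_config j = fls_const (config_a generic_config j)"
proof -
  show "config_q asym_config = fls_const (rf_var Var_q) * fls_X"
    "config_p asym_config = fls_const (rf_var Var_p) * fls_X_inv"
    "config_t asym_config = fls_const (rf_var Var_t)"
    by (simp_all add: asym_config_def generic_config_def)
  assume j: "j < 7"
  have "config_a asym_config j = config_a (map_config fls_const (generic_config :: ratfun config)) j"
    unfolding asym_config_def by (simp split: config.split)
  then show "config_a asym_config j = fls_const (config_a generic_config j)"
    using j by (simp add: config_a_map)
qed

lemma rel_asym: "rel_config asym.ev generic_config asym_config"
proof (rule asym.rel_generic)
  have "config_constraint (map_config fls_const (generic_config :: ratfun config))"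
    by (rule fls_const.config_constraint_map) simp
  then show "config_constraint asym_config"
    by (simp add: asym_config_def generic_config_def)
qed simp

text \<open>Expresses that the blown-up curve is preserved. Only the product \<open>qp\<close> is
  followed to leading order, since it changes by additive parameters while the leading coefficients
  of \<open>q\<close> and \<open>p\<close> separately change by rational factors.\<close>

definition asym_inv :: "nat list \<Rightarrow> ratfun fls config \<Rightarrow> bool" where
  "asym_inv w D \<longleftrightarrow> fls_subdegree (config_q D) = 1 \<and> fls_subdegree (config_p D) = - 1 \<and>
     fls_nth (config_q D * config_p D) 0 = lin_form (word_act w (unit_vec 7)) \<and>
     (\<forall>j<7. config_a D j = fls_const (lin_form (word_act w (unit_vec j))))"

lemma lin_form_unit:
  "lin_form (unit_vec 7) = rf_var Var_q * rf_var Var_p"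
  "j < 7 \<Longrightarrow> lin_form (unit_vec j) = config_a generic_config j"
proof -
  show "lin_form (unit_vec 7) = rf_var Var_q * rf_var Var_p"
    by (simp add: lin_form_def unit_vec_def)
  assume j: "j < 7"
  have "(\<Sum>i<7. of_int (unit_vec j i) * config_a generic_config i) =
    (\<Sum>i<7. if i = j then config_a generic_config j else (0::ratfun))"
    by (intro sum.cong) (auto simp: unit_vec_def)
  then show "lin_form (unit_vec j) = config_a generic_config j"
    using j by (simp add: lin_form_def) (simp add: unit_vec_def)
qed

lemma asym_inv_Nil: "asym_inv [] asym_config"
proof -
  have nz: "rf_var Var_q \<noteq> 0" "rf_var Var_p \<noteq> 0"
    using good_generic by (auto simp: good_config_def generic_config_def generic_params_def)
  have "fls_X * fls_X_inv = (1 :: ratfun fls)"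
    by (simp add: fls_X_times_conv_shift)
  moreover have "fls_const (rf_var Var_q) * fls_X * (fls_const (rf_var Var_p) * fls_X_inv) =
      fls_const (rf_var Var_q) * fls_const (rf_var Var_p) * (fls_X * fls_X_inv)"
    by (simp only: mult_ac)
  ultimately have "fls_const (rf_var Var_q) * fls_X * (fls_const (rf_var Var_p) * fls_X_inv) =
      fls_const (rf_var Var_q * rf_var Var_p)"
    by simp
  with nz show ?thesis
    by (simp add: asym_inv_def asym_config_eq lin_form_unit)
qed

lemma reflect_eq: "reflect i c = (\<lambda>k. 1 * c k + (- coroot i c) * unit_vec i k)"
  by (rule ext) (simp add: reflect_nth unit_vec_def)

text \<open>The letter appended last acts through the current parameters, which are the
  \<open>w\<close>-images of the original ones. That is why the correction is the
  \<open>w\<close>-image of the root of \<open>i\<close>, and why \<open>word_act\<close> matches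
  \<open>fold bt\<close>.\<close>

lemma lin_form_word_act_snoc:
  "lin_form (word_act (w @ [i]) c) =
     lin_form (word_act w c) - of_int (coroot i c) * lin_form (word_act w (unit_vec i))"
  using lin_form_lin[of 1 "word_act w c" "- coroot i c" "word_act w (unit_vec i)"]
    word_act_lin[of w 1 c "- coroot i c" "unit_vec i"] reflect_eq[of i c]
  by simp

text \<open>Reflections leave the coefficient of \<open>x\<close> untouched, so this function still
  contains \<open>qp\<close> with coefficient 1. Leading coefficients along the curve therefore
  never cancel.\<close>

lemma lin_form_word_act_nonzero:
  assumes "w \<in> lists E6_nodes" "i < 7"
  shows "lin_form (word_act w (unit_vec 7)) + of_int n * lin_form (word_act w (unit_vec i)) \<noteq> 0"
proof
  assume *: "lin_form (word_act w (unit_vec 7)) + of_int n * lin_form (word_act w (unit_vec i)) = 0"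
  have "7 \<notin> E6_nodes" by (simp add: E6_nodes_eq)
  then have "word_act w c 7 = c 7" for c
    by (rule word_act_outside[OF assms(1)])
  moreover have "1 * word_act w (unit_vec 7) 7 + n * word_act w (unit_vec i) 7 = 0"
    using lin_form_lin[of 1 "word_act w (unit_vec 7)" n "word_act w (unit_vec i)"] *
    by (intro lin_form_eq_0(1)[of "\<lambda>k. 1 * word_act w (unit_vec 7) k + n * word_act w (unit_vec i) k"]) simp
  ultimately show False
    using assms(2) by (simp add: unit_vec_def)
qed

lemma coroot_unit_7: "i < 7 \<Longrightarrow> coroot i (unit_vec 7) = (if i = 2 then 1 else if i = 0 then - 1 else 0)"
  by (simp add: coroot_def unit_vec_def)

lemma fls_subdegree_divide_field:
  fixes f g :: "'a::field fls"
  assumes "f \<noteq> 0" "g \<noteq> 0"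
  shows "fls_subdegree (f / g) = fls_subdegree f - fls_subdegree g"
  using assms by (simp add: divide_inverse)

lemma asym_step:
  assumes inv: "asym_inv w D" and w: "w \<in> lists E6_nodes" and i: "i < 7"
  shows "asym_inv (w @ [i]) (bt (nodegen i) D)" "bt_defined (nodegen i) (config_q D) (config_p D)"
proof -
  define Q P a X where "Q = config_q D" "P = config_p D" "a = config_a D" "X = lin_form (word_act w (unit_vec 7))"
  note defs = this
  have sQ: "fls_subdegree Q = 1" and sP: "fls_subdegree P = - 1" and QP: "fls_nth (Q * P) 0 = X"
    and a: "\<And>j. j < 7 \<Longrightarrow> a j = fls_const (lin_form (word_act w (unit_vec j)))"
    using inv by (simp_all add: asym_inv_def defs)
  have nz: "Q \<noteq> 0" "P \<noteq> 0" using sQ sP by auto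
  have sQP: "fls_subdegree (Q * P) = 0" using nz sQ sP by simp
  have Q1: "fls_nth (Q - 1) 0 = - 1" "fls_subdegree (Q - 1) = 0"
  proof -
    show 1: "fls_nth (Q - 1) 0 = - 1" using sQ by simp
    show "fls_subdegree (Q - 1) = 0" using sQ 1 by (intro fls_subdegree_eqI) auto
  qed
  then have nz1: "Q - 1 \<noteq> 0" by auto
  show "bt_defined (nodegen i) (config_q D) (config_p D)"
    using less_7_cases[OF i] nz nz1 by (elim disjE) (simp_all add: defs)
  \<comment> \<open>\<open>Z\<close> is the product of the new \<open>q\<close> and \<open>p\<close>
    for every node. The sign of \<open>coroot\<close> gives \<open>+ a0\<close> for
    \<open>S0\<close> and \<open>- a2\<close> for \<open>S2\<close>. For \<open>S4\<close> the extra
    term has order 1, because \<open>q\<close> tends to 0 and \<open>q - 1\<close> to -1, so it does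
    not reach the coefficient of order 0.\<close>
  define Z where "Z = Q * P - of_int (coroot i (unit_vec 7)) * a i
    - (if i = 4 then Q * (a 4 / (Q - 1)) else 0)"
  have Q4: "fls_nth (Q * (a 4 / (Q - 1))) n = 0" if "n \<le> 0" for n
  \<comment> \<open>The zero series is split off because \<open>fls_subdegree 0\<close> is 0 and
    orders add only for nonzero factors.\<close>
  proof (cases "a 4 = 0")
    case False
    then have "fls_subdegree (Q * (a 4 / (Q - 1))) = 1"
      using nz nz1 Q1 sQ a[of 4] by (simp add: fls_subdegree_divide_field)
    then show ?thesis using that by simp
  qed simp
  have ca: "of_int (coroot i (unit_vec 7)) * a i =
      fls_const (of_int (coroot i (unit_vec 7)) * lin_form (word_act w (unit_vec i)))"
    using a[OF i] by (simp only: fls_const.h_mult fls_const.h_of_int)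
  have Z0: "fls_nth Z 0 = lin_form (word_act (w @ [i]) (unit_vec 7))"
    unfolding lin_form_word_act_snoc Z_def ca using QP Q4[of 0] by (simp add: defs)
  also have "\<dots> \<noteq> 0"
    using lin_form_word_act_nonzero[OF w i, of "- coroot i (unit_vec 7)"]
    unfolding lin_form_word_act_snoc by simp
  finally have "fls_nth Z 0 \<noteq> 0" .
  moreover have "fls_nth Z n = 0" if "n < 0" for n
    unfolding Z_def ca using that sQP Q4[of n] by simp
  ultimately have sZ: "fls_subdegree Z = 0" "Z \<noteq> 0"
    by (auto intro: fls_subdegree_eqI)
  let ?D = "bt (nodegen i) D"
  have "config_q ?D = (if i = 0 then Z / P else Q)" "config_p ?D = (if i = 0 then P else Z / Q)"
    using nz coroot_unit_7[OF i] unfolding config_q_bt[OF i] defs[symmetric] Z_def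
    by (auto simp: diff_divide_distrib add_divide_distrib)
  then have "fls_subdegree (config_q ?D) = 1" "fls_subdegree (config_p ?D) = - 1"
    "config_q ?D * config_p ?D = Z"
    using sZ nz sQ sP by (auto simp: fls_subdegree_divide_field)
  moreover have "config_a ?D j = fls_const (lin_form (word_act (w @ [i]) (unit_vec j)))" if j: "j < 7" for j
  proof -
    have "config_a ?D j = a j - of_int (cartan i j) * a i"
      using config_a_bt[OF i j] by (simp add: defs)
    also have "\<dots> = fls_const (lin_form (word_act w (unit_vec j)) - of_int (cartan i j) * lin_form (word_act w (unit_vec i)))"
      using a[OF i] a[OF j] by (simp only: fls_const.h_mult fls_const.h_of_int fls_const.h_diff)
    finally show ?thesis
      unfolding lin_form_word_act_snoc coroot_unit[OF j] .
  qed
  ultimately show "asym_inv (w @ [i]) ?D"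
    using Z0 by (simp add: asym_inv_def)
qed

text \<open>The expansion of the transformed configuration is obtained by applying the generators to
  the expansion itself; \<open>asym_step\<close> guarantees at every letter that no denominator
  vanishes.\<close>

lemma asym_word:
  assumes "w \<in> lists E6_nodes"
  obtains D where "asym_inv w D" "rel_config asym.ev (fold bt (map nodegen w) generic_config) D"
proof -
  have "\<exists>D. asym_inv w D \<and> rel_config asym.ev (fold bt (map nodegen w) generic_config) D"
    using assms
  proof (induction w rule: rev_induct)
    case Nil
    then show ?case using asym_inv_Nil rel_asym by auto
  next
    case (snoc i w)
    then have w: "w \<in> lists E6_nodes" and i: "i < 7" by (simp_all add: E6_nodes_eq)
    obtain D where D: "asym_inv w D" "rel_config asym.ev (fold bt (map nodegen w) generic_config) D"
      using snoc.IH w by blast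
    obtain q p t a where C: "fold bt (map nodegen w) generic_config = Config q p t a"
      by (cases "fold bt (map nodegen w) (generic_config :: ratfun config)")
    obtain q' p' t' a' where D': "D = Config q' p' t' a'" by (cases D)
    have "rel_config asym.ev (bt (nodegen i) (Config q p t a)) (bt (nodegen i) (Config q' p' t' a'))"
      using D(2) asym_step(2)[OF D(1) w i] unfolding C D' by (intro asym.rel_bt) simp_all
    then show ?case
      using asym_step(1)[OF D(1) w i] unfolding D' by (auto simp: C)
  qed
  with that show ?thesis by blast
qed

subsection \<open>The diagram automorphisms\<close>

text \<open>The three functions below are permuted by the \<open>\<pi>\<^sub>j\<close> up to a common sign, exactly as the
  nodes 2, 4, 5 of the diagram.\<close>

definition pi_fn :: "'k::field config \<Rightarrow> nat \<Rightarrow> 'k" where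
  "pi_fn C i = (let q = config_q C; p = config_p C; a0 = config_a C 0 in
     if i = 2 then q * (q * p + a0) else if i = 4 then (q - 1) * ((q - 1) * p + a0) else p)"

lemma pi_step:
  assumes g: "g \<in> pi_gens" and nz: "config_q C \<noteq> 0" "config_q C - 1 \<noteq> 0"
  shows "config_q (bt g C) \<noteq> 0" "config_q (bt g C) - 1 \<noteq> 0"
    "i \<in> {2, 4, 5} \<Longrightarrow> pi_fn (bt g C) i = - pi_fn C (snd (E6_gen g) i)"
    "j < 7 \<Longrightarrow> config_a (bt g C) j = config_a C (snd (E6_gen g) j)"
    "\<exists>m. config_t (bt g C) = of_int m - config_t C"
proof -
  obtain q p t a0 a1 a2 a3 a4 a5 a6 where C: "C = Config q p t (a0, a1, a2, a3, a4, a5, a6)"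
    by (metis config.exhaust prod.exhaust)
  define r where "r = q - 1"
  have nz': "q \<noteq> 0" "r \<noteq> 0"
    using nz by (simp_all add: C r_def)
  have inv_q: "q / (q - 1) - 1 = 1 / (q - 1)" "1 / q - 1 = - (q - 1) / q"
    using nz' by (simp_all add: r_def field_simps)
  from nz' have 1: "1 - q \<noteq> 0" "1 - q - 1 \<noteq> 0" "1 / q \<noteq> 0" "1 / q - 1 \<noteq> 0"
    "q / (q - 1) \<noteq> 0" "q / (q - 1) - 1 \<noteq> 0"
    unfolding inv_q by (simp_all add: r_def)
  show "config_q (bt g C) \<noteq> 0" "config_q (bt g C) - 1 \<noteq> 0"
    using g 1 unfolding C by (elim insertE emptyE; simp only: bt.simps config_q.simps not_False_eq_True)+
  have eq1: "- (q * (r * p + a0)) + a0 = - (r * (q * p + a0))"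
    and eq2: "- (1 * (r * p + a0)) + a0 = - (r * p)"
    and eq3: "- (1 * (q * p + a0)) + a0 = - (q * p)"
    and eq4: "- (- r * (q * p + a0)) + a0 = q * (r * p + a0)"
    by (simp_all add: r_def algebra_simps)
  have cancel1: "x / y * (- y * z) = - (x * z)" and cancel2: "x / y * (- (y * z)) = - (x * z)"
    and cancel3: "x / y * (y * z) = x * z" and cancel4: "x / y * (- z * y) = - (x * z)"
    if "y \<noteq> 0" for x y z :: 'a
    using that by simp_all
  have "q / r * (q / r * (- r * (r * p + a0)) + a0) = - (q * (q * p + a0))"
    unfolding cancel1[OF nz'(2)] eq1 cancel2[OF nz'(2)] ..
  moreover have "1 / r * (1 / r * (- r * (r * p + a0)) + a0) = - p"
    unfolding cancel1[OF nz'(2)] eq2 cancel2[OF nz'(2)] by simp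
  moreover have "1 / q * (1 / q * (- (q * p + a0) * q) + a0) = - p"
    unfolding cancel4[OF nz'(1)] eq3 cancel2[OF nz'(1)] by simp
  moreover have "- r / q * (- r / q * (- (q * p + a0) * q) + a0) = - (r * (r * p + a0))"
    unfolding cancel4[OF nz'(1)] eq4 cancel3[OF nz'(1)] by simp
  moreover have "(1 - q) * ((1 - q) * - p + a0) = - (r * (r * p + a0))"
    "(1 - q - 1) * ((1 - q - 1) * - p + a0) = - (q * (q * p + a0))"
    "- (q * p + a0) * q = - (q * (q * p + a0))"
    "- r * (r * p + a0) = - (r * (r * p + a0))"
    by (simp_all add: r_def algebra_simps)
  moreover have "pi_fn (Config x y u (a0, b1, b2, b3, b4, b5, b6)) 2 = x * (x * y + a0)"
    "pi_fn (Config x y u (a0, b1, b2, b3, b4, b5, b6)) 4 = (x - 1) * ((x - 1) * y + a0)"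
    "pi_fn (Config x y u (a0, b1, b2, b3, b4, b5, b6)) 5 = y" for x y u b1 b2 b3 b4 b5 b6
    by (simp_all add: pi_fn_def Let_def)
  moreover have "snd (E6_gen Pi1) 2 = 4" "snd (E6_gen Pi1) 4 = 2" "snd (E6_gen Pi1) 5 = 5"
    "snd (E6_gen Pi2) 2 = 5" "snd (E6_gen Pi2) 4 = 4" "snd (E6_gen Pi2) 5 = 2"
    "snd (E6_gen Pi3) 2 = 2" "snd (E6_gen Pi3) 4 = 5" "snd (E6_gen Pi3) 5 = 4"
    by (simp_all add: Transposition.transpose_def)
  ultimately show "pi_fn (bt g C) i = - pi_fn C (snd (E6_gen g) i)" if "i \<in> {2, 4, 5}"
    using g that unfolding C r_def
    by (elim insertE emptyE) (simp_all only: bt.simps inv_q)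
  show "config_a (bt g C) j = config_a C (snd (E6_gen g) j)" if "j < 7"
    using less_7_cases[OF that] g unfolding C
    by (elim insertE emptyE disjE; simp add: Transposition.transpose_def)
  show "\<exists>m. config_t (bt g C) = of_int m - config_t C"
    using g unfolding C
    by (elim insertE emptyE) (auto intro: exI[of _ 0] exI[of _ 1] exI[of _ 2])
qed

lemma pi_gen_245: "g \<in> pi_gens \<Longrightarrow> i \<in> {2, 4, 5} \<Longrightarrow> snd (E6_gen g) i \<in> {2, 4, 5}"
  by (elim insertE emptyE) (simp_all add: Transposition.transpose_def)

lemma pi_perm_245: "\<rho> \<in> lists pi_gens \<Longrightarrow> i \<in> {2, 4, 5} \<Longrightarrow> pi_perm \<rho> i \<in> {2, 4, 5}"
proof (induction \<rho> rule: list.induct)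
  case (Cons g \<rho>)
  then show ?case
    unfolding pi_perm_Cons o_apply Cons_in_lists_iff using pi_gen_245 by blast
qed simp

lemma pi_fold:
  assumes "\<rho> \<in> lists pi_gens" "config_q C \<noteq> 0" "config_q C - 1 \<noteq> 0"
  shows "i \<in> {2, 4, 5} \<Longrightarrow> pi_fn (fold bt \<rho> C) i = (- 1) ^ length \<rho> * pi_fn C (pi_perm \<rho> i)"
    and "j < 7 \<Longrightarrow> config_a (fold bt \<rho> C) j = config_a C (pi_perm \<rho> j)"
    and "\<exists>m. config_t (fold bt \<rho> C) = of_int m + (- 1) ^ length \<rho> * config_t C"
proof -
  have "(\<forall>i\<in>{2, 4, 5}. pi_fn (fold bt \<rho> C) i = (- 1) ^ length \<rho> * pi_fn C (pi_perm \<rho> i)) \<and>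
    (\<forall>j<7. config_a (fold bt \<rho> C) j = config_a C (pi_perm \<rho> j)) \<and>
    (\<exists>m. config_t (fold bt \<rho> C) = of_int m + (- 1) ^ length \<rho> * config_t C)"
    using assms
  proof (induction \<rho> arbitrary: C rule: list.induct)
    case Nil
    show ?case by (auto intro: exI[of _ 0])
  next
    case (Cons g \<rho>)
    have g: "g \<in> pi_gens" and \<rho>: "\<rho> \<in> lists pi_gens"
      using Cons.prems(1) unfolding Cons_in_lists_iff by auto
    note step = pi_step[OF g Cons.prems(2,3)]
    note IH = Cons.IH[OF \<rho> step(1,2)]
    have "pi_fn (fold bt (g # \<rho>) C) i = (- 1) ^ length (g # \<rho>) * pi_fn C (pi_perm (g # \<rho>) i)"
      if i: "i \<in> {2, 4, 5}" for i
      using bspec[OF conjunct1[OF IH] i] step(3)[OF pi_perm_245[OF \<rho> i]] by (simp add: pi_perm_Cons)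
    moreover have "config_a (fold bt (g # \<rho>) C) j = config_a C (pi_perm (g # \<rho>) j)" if "j < 7" for j
      using IH that step(4)[of "pi_perm \<rho> j"] pi_perm_nodes[OF \<rho>, of j]
      by (simp add: pi_perm_Cons E6_nodes_eq)
    moreover have "\<exists>m. config_t (fold bt (g # \<rho>) C) = of_int m + (- 1) ^ length (g # \<rho>) * config_t C"
    proof -
      obtain m n where "config_t (fold bt \<rho> (bt g C)) = of_int m + (- 1) ^ length \<rho> * config_t (bt g C)"
        "config_t (bt g C) = of_int n - config_t C"
        using IH step(5) by blast
      then have "config_t (fold bt (g # \<rho>) C) = of_int (m + (- 1) ^ length \<rho> * n) + (- 1) ^ length (g # \<rho>) * config_t C"
        by (simp add: algebra_simps)
      then show ?thesis by blast
    qed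
    ultimately show ?case by blast
  qed
  note main = this
  show "i \<in> {2, 4, 5} \<Longrightarrow> pi_fn (fold bt \<rho> C) i = (- 1) ^ length \<rho> * pi_fn C (pi_perm \<rho> i)"
    by (rule bspec[OF conjunct1[OF main]])
  show "j < 7 \<Longrightarrow> config_a (fold bt \<rho> C) j = config_a C (pi_perm \<rho> j)"
    by (rule mp[OF spec[OF conjunct1[OF conjunct2[OF main]]]])
  show "\<exists>m. config_t (fold bt \<rho> C) = of_int m + (- 1) ^ length \<rho> * config_t C"
    by (rule conjunct2[OF conjunct2[OF main]])
qed

text \<open>The terms \<open>q^2 p\<close> cancel, which leaves an expression linear in
  \<open>q\<close>. Hence \<open>pi_fn\<close> and \<open>a0\<close> determine \<open>p\<close> and
  then \<open>q\<close>, provided \<open>p\<close> and 2 are nonzero.\<close>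

lemma pi_fn_diff: "pi_fn C 2 - pi_fn C 4 = 2 * (config_p C * config_q C) - config_p C + config_a C 0"
proof -
  have "x * (x * y + a) - (x - 1) * ((x - 1) * y + a) = 2 * (y * x) - y + a" for x y a :: 'a
    by (simp add: algebra_simps)
  then show ?thesis by (simp add: pi_fn_def Let_def)
qed

lemma pi_fn_inject:
  assumes "\<And>i. i \<in> {2, 4, 5} \<Longrightarrow> pi_fn C i = pi_fn D i" "config_a C 0 = config_a D 0" "config_p C \<noteq> 0"
    "(2::'k) \<noteq> 0"
  shows "config_p C = config_p D" "config_q C = (config_q D :: 'k::field)"
proof -
  show p: "config_p C = config_p D" using assms(1)[of 5] by (simp add: pi_fn_def)
  have "pi_fn C 2 - pi_fn C 4 = pi_fn D 2 - pi_fn D 4" using assms(1) by simp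
  then have "2 * (config_p C * config_q C) = 2 * (config_p C * config_q D)"
    unfolding pi_fn_diff p[symmetric] assms(2) by simp
  then show "config_q C = config_q D" using assms(3,4) by simp
qed

text \<open>Value tables on the nodes 0 to 6 of the permutations of the arms: the identity and the
  two rotations here, the three reflections in \<open>odd_pi_lists\<close>.\<close>

abbreviation even_pi_lists :: "nat list set" where
  "even_pi_lists \<equiv> {[0, 1, 2, 3, 4, 5, 6], [0, 6, 5, 1, 2, 4, 3], [0, 3, 4, 6, 5, 2, 1]}"

abbreviation odd_pi_lists :: "nat list set" where
  "odd_pi_lists \<equiv> {[0, 3, 4, 1, 2, 5, 6], [0, 6, 5, 3, 4, 2, 1], [0, 1, 2, 6, 5, 4, 3]}"

lemma upt_7: "[0..<7] = [0, 1, 2, 3, 4, 5, 6]"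
  by (simp add: upt_rec)

text \<open>Each generator exchanges two arms and is odd as a permutation of them, so the
  permutation determines the parity of the word. That parity is also the sign with which the word
  acts on time and on \<open>pi_fn\<close>.\<close>

lemma map_pi_perm:
  assumes "\<rho> \<in> lists pi_gens"
  shows "map (pi_perm \<rho>) [0..<7] \<in> (if even (length \<rho>) then even_pi_lists else odd_pi_lists)"
  using assms
proof (induction \<rho> rule: list.induct)
  case Nil
  then show ?case by (simp add: upt_7)
next
  case (Cons g \<rho>)
  have g: "g \<in> pi_gens" and \<rho>: "\<rho> \<in> lists pi_gens"
    using Cons.prems unfolding Cons_in_lists_iff by auto
  have eq: "map (pi_perm (g # \<rho>)) [0..<7] = map (snd (E6_gen g)) (map (pi_perm \<rho>) [0..<7])"
    by (simp add: pi_perm_Cons)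
  show ?case
  proof (cases "even (length \<rho>)")
    case True
    then have "map (pi_perm \<rho>) [0..<7] \<in> even_pi_lists" using Cons.IH[OF \<rho>] by simp
    then have "map (pi_perm (g # \<rho>)) [0..<7] \<in> odd_pi_lists"
      unfolding eq using g by (elim insertE emptyE) (simp_all add: Transposition.transpose_def del: upt.simps)
    then show ?thesis using True by simp
  next
    case False
    then have "map (pi_perm \<rho>) [0..<7] \<in> odd_pi_lists" using Cons.IH[OF \<rho>] by simp
    then have "map (pi_perm (g # \<rho>)) [0..<7] \<in> even_pi_lists"
      unfolding eq using g by (elim insertE emptyE) (simp_all add: Transposition.transpose_def del: upt.simps)
    then show ?thesis using False by simp
  qed
qed

lemma map_upt_7_eqD: "map f [0..<7] = map g [0..<7] \<Longrightarrow> j < 7 \<Longrightarrow> f j = g j"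
  by (simp add: map_eq_conv)

section \<open>Automorphisms of the Dynkin diagram\<close>

lemma E6_edge_cases:
  "{i, j} \<in> E6_edges \<longleftrightarrow> (i, j) \<in> {(0, 2), (2, 0), (2, 1), (1, 2), (0, 4), (4, 0), (4, 3), (3, 4),
     (0, 5), (5, 0), (5, 6), (6, 5)}"
  by (auto simp: E6_edges_def doubleton_eq_iff)

lemma pi_gen_diagram_aut:
  assumes "g \<in> pi_gens"
  shows "snd (E6_gen g) \<in> E6_diagram_auts"
proof -
  have "snd (E6_gen g) permutes E6_nodes"
    using assms by (elim insertE emptyE)
      (auto simp: E6_nodes_def intro!: permutes_compose permutes_swap_id)
  moreover have "{snd (E6_gen g) i, snd (E6_gen g) j} \<in> E6_edges \<longleftrightarrow> {i, j} \<in> E6_edges"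
    if "i < 7" "j < 7" for i j
    using assms less_7_cases[OF that(1)] less_7_cases[OF that(2)] unfolding E6_edge_cases
    by (elim insertE emptyE disjE; simp add: Transposition.transpose_def)
  ultimately show ?thesis
    by (simp add: E6_diagram_auts_def E6_nodes_eq)
qed

lemma diagram_aut_nodes: "\<pi> \<in> E6_diagram_auts \<Longrightarrow> \<pi> i \<in> E6_nodes \<longleftrightarrow> i \<in> E6_nodes"
  by (simp add: E6_diagram_auts_def permutes_in_image)

lemma pi_perm_diagram_aut:
  assumes "\<rho> \<in> lists pi_gens"
  shows "pi_perm \<rho> \<in> E6_diagram_auts"
  using assms
proof (induction \<rho> rule: list.induct)
  case Nil
  show ?case by (simp add: E6_diagram_auts_def permutes_id[unfolded id_def] id_def)
next
  case (Cons g \<rho>)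
  have g: "g \<in> pi_gens" and \<rho>: "\<rho> \<in> lists pi_gens"
    using Cons.prems unfolding Cons_in_lists_iff by auto
  have 1: "snd (E6_gen g) \<in> E6_diagram_auts" and 2: "pi_perm \<rho> \<in> E6_diagram_auts"
    using pi_gen_diagram_aut[OF g] Cons.IH[OF \<rho>] by auto
  have "pi_perm (g # \<rho>) permutes E6_nodes"
    unfolding pi_perm_Cons using 1 2 by (intro permutes_compose) (auto simp: E6_diagram_auts_def)
  moreover have "{pi_perm (g # \<rho>) i, pi_perm (g # \<rho>) j} \<in> E6_edges \<longleftrightarrow> {i, j} \<in> E6_edges"
    if "i \<in> E6_nodes" "j \<in> E6_nodes" for i j
    using 1 2 that diagram_aut_nodes[OF 2, of i] diagram_aut_nodes[OF 2, of j]
    unfolding pi_perm_Cons o_apply E6_diagram_auts_def by blast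
  ultimately show ?case unfolding E6_diagram_auts_def by blast
qed

lemma diagram_aut_eqI:
  assumes "\<pi> \<in> E6_diagram_auts" "\<rho> \<in> E6_diagram_auts" "map \<pi> [0..<7] = map \<rho> [0..<7]"
  shows "\<pi> = \<rho>"
proof
  fix i
  show "\<pi> i = \<rho> i"
  proof (cases "i < 7")
    case True
    then show ?thesis using map_upt_7_eqD[OF assms(3)] by blast
  next
    case False
    then have "i \<notin> E6_nodes" by (simp add: E6_nodes_eq)
    then show ?thesis
      using assms(1,2) permutes_not_in[of \<pi> E6_nodes i] permutes_not_in[of \<rho> E6_nodes i]
      unfolding E6_diagram_auts_def by simp
  qed
qed

text \<open>Node 0 is fixed as the only node with three neighbours, so an automorphism permutes 2,
  4, 5 and carries the outer nodes along. This leaves the six tables, each realised by one of six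
  explicit words of length at most two.\<close>

lemma diagram_aut_is_pi_perm:
  assumes "\<pi> \<in> E6_diagram_auts"
  obtains \<rho> where "\<rho> \<in> lists pi_gens" "pi_perm \<rho> = \<pi>"
proof -
  have inj: "\<pi> i = \<pi> j \<longleftrightarrow> i = j" for i j
    using assms permutes_inj[of \<pi>] by (auto simp: E6_diagram_auts_def inj_eq)
  have ed: "{\<pi> i, \<pi> j} \<in> E6_edges" if "{i, j} \<in> E6_edges" for i j
  proof -
    have "i \<in> E6_nodes" "j \<in> E6_nodes"
      using that unfolding E6_edge_cases by (auto simp: E6_nodes_eq)
    then show ?thesis using that assms unfolding E6_diagram_auts_def by blast
  qed
  have e: "{\<pi> 0, \<pi> 2} \<in> E6_edges" "{\<pi> 0, \<pi> 4} \<in> E6_edges" "{\<pi> 0, \<pi> 5} \<in> E6_edges"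
    "{\<pi> 2, \<pi> 1} \<in> E6_edges" "{\<pi> 4, \<pi> 3} \<in> E6_edges" "{\<pi> 5, \<pi> 6} \<in> E6_edges"
    by (rule ed, simp add: E6_edges_def)+
  note d = inj[of 2 4] inj[of 2 5] inj[of 4 5] inj[of 1 0] inj[of 3 0] inj[of 6 0]
  have "i = 0" if "{i, x} \<in> E6_edges" "{i, y} \<in> E6_edges" "{i, z} \<in> E6_edges" "x \<noteq> y" "x \<noteq> z" "y \<noteq> z"
    for i x y z :: nat
  proof -
    have "i < 7" using that(1) unfolding E6_edge_cases by auto
    from less_7_cases[OF this] show ?thesis
      using that by (elim disjE) (auto simp: E6_edge_cases)
  qed
  from this[OF e(1-3)] have 0: "\<pi> 0 = 0"
    using d(1-3) by simp
  then have 245: "\<pi> 2 \<in> {2, 4, 5}" "\<pi> 4 \<in> {2, 4, 5}" "\<pi> 5 \<in> {2, 4, 5}"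
    using e(1-3) unfolding E6_edge_cases by auto
  have neighbour: "j = (if i = 2 then 1 else if i = 4 then 3 else 6)"
    if "i \<in> {2, 4, 5}" "{i, j} \<in> E6_edges" "j \<noteq> 0" for i j :: nat
    using that unfolding E6_edge_cases by auto
  have 136: "\<pi> 1 = (if \<pi> 2 = 2 then 1 else if \<pi> 2 = 4 then 3 else 6)"
    "\<pi> 3 = (if \<pi> 4 = 2 then 1 else if \<pi> 4 = 4 then 3 else 6)"
    "\<pi> 6 = (if \<pi> 5 = 2 then 1 else if \<pi> 5 = 4 then 3 else 6)"
    using neighbour[OF 245(1) e(4)] neighbour[OF 245(2) e(5)] neighbour[OF 245(3) e(6)] d 0 by simp_all
  have "map \<pi> [0..<7] = [0, \<pi> 1, \<pi> 2, \<pi> 3, \<pi> 4, \<pi> 5, \<pi> 6]"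
    unfolding upt_7 by (simp add: 0)
  moreover have "[0, \<pi> 1, \<pi> 2, \<pi> 3, \<pi> 4, \<pi> 5, \<pi> 6] \<in> even_pi_lists \<union> odd_pi_lists"
    unfolding 136 using 245 d(1-3) by (elim insertE emptyE) simp_all
  ultimately have "map \<pi> [0..<7] \<in> even_pi_lists \<union> odd_pi_lists"
    by simp
  moreover
  have L: "map (pi_perm []) [0..<7] = [0, 1, 2, 3, 4, 5, 6]"
    "map (pi_perm [Pi1]) [0..<7] = [0, 3, 4, 1, 2, 5, 6]"
    "map (pi_perm [Pi2]) [0..<7] = [0, 6, 5, 3, 4, 2, 1]"
    "map (pi_perm [Pi3]) [0..<7] = [0, 1, 2, 6, 5, 4, 3]"
    "map (pi_perm [Pi1, Pi2]) [0..<7] = [0, 6, 5, 1, 2, 4, 3]"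
    "map (pi_perm [Pi2, Pi1]) [0..<7] = [0, 3, 4, 6, 5, 2, 1]"
    unfolding upt_7 by (simp_all add: pi_perm_Cons Transposition.transpose_def del: One_nat_def)
  have "even_pi_lists \<union> odd_pi_lists \<subseteq>
      (\<lambda>\<rho>. map (pi_perm \<rho>) [0..<7]) ` {[], [Pi1], [Pi2], [Pi3], [Pi1, Pi2], [Pi2, Pi1]}"
    by (simp only: image_insert image_empty L) simp
  ultimately have "map \<pi> [0..<7] \<in> (\<lambda>\<rho>. map (pi_perm \<rho>) [0..<7]) ` {[], [Pi1], [Pi2], [Pi3], [Pi1, Pi2], [Pi2, Pi1]}"
    by (rule subsetD[rotated])
  then obtain \<rho> where "map \<pi> [0..<7] = map (pi_perm \<rho>) [0..<7]"
    and "\<rho> \<in> {[], [Pi1], [Pi2], [Pi3], [Pi1, Pi2], [Pi2, Pi1]}"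
    by (rule imageE)
  moreover from this(2) have "\<rho> \<in> lists pi_gens"
    by (elim insertE emptyE) simp_all
  ultimately have "\<exists>\<rho>\<in>lists pi_gens. map (pi_perm \<rho>) [0..<7] = map \<pi> [0..<7]"
    by (intro bexI[of _ \<rho>]) simp_all
  then show ?thesis
    using diagram_aut_eqI[OF pi_perm_diagram_aut assms] that by blast
qed

subsection \<open>The kernel of the action\<close>

fun shift_t :: "'k::field \<Rightarrow> 'k config \<Rightarrow> 'k config" where
  "shift_t c (Config q p t a) = Config q p (t + c) a"

lemma config_shift_t [simp]:
  "config_q (shift_t c C) = config_q C" "config_p (shift_t c C) = config_p C"
  "config_t (shift_t c C) = config_t C + c" "config_a (shift_t c C) = config_a C"
  by (cases C; simp)+

lemma pi_fn_shift_t [simp]: "pi_fn (shift_t c C) = pi_fn C"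
  by (simp add: pi_fn_def fun_eq_iff)

lemma two_nonzero_ratfun: "(2 :: ratfun) \<noteq> 0"
proof -
  interpret substitution "\<lambda>x :: complex. x" "\<lambda>x. 0" by (rule substitution_id)
  show ?thesis using ev_nonzero[OF ev_numeral[of "num.Bit0 num.One"]] by simp
qed

lemma generic_coords:
  "config_q generic_config = rf_var Var_q" "config_p generic_config = rf_var Var_p"
  "config_t generic_config = rf_var Var_t"
  by (simp_all add: generic_config_def)

lemma generic_nonzero:
  "config_q generic_config \<noteq> (0::ratfun)" "config_q generic_config - 1 \<noteq> (0::ratfun)"
  "config_p generic_config \<noteq> (0::ratfun)"
  using good_generic by (auto simp: good_config_def generic_config_def generic_params_def)

text \<open>Excludes a time-reversing word in the kernel: \<open>t + c = m - t\<close> would make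
  \<open>2 t\<close> constant.\<close>

lemma rf_var_t_not_const: "2 * rf_var Var_t \<noteq> rf_const c"
proof
  assume *: "2 * rf_var Var_t = rf_const c"
  have "2 * z = c" for z
  proof -
    interpret substitution "\<lambda>x :: complex. x" "\<lambda>x. z" by (rule substitution_id)
    have "ev (2 * rf_var Var_t) (2 * z)" by (intro ev_mult ev_numeral ev_var)
    moreover have "ev (2 * rf_var Var_t) c" unfolding * by (rule ev_const)
    ultimately show ?thesis by (rule ev_unique)
  qed
  from this[of 0] this[of 1] show False by simp
qed

text \<open>A trivial permutation forces even length, so all signs cancel and \<open>pi_fn\<close>
  and the parameters are restored, hence \<open>q\<close> and \<open>p\<close> as well. Only time
  can still move. The configuration is general because \<open>kernel_trivial\<close> applies this
  after a Weyl word.\<close>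

lemma pi_perm_id_imp_shift:
  assumes \<rho>: "\<rho> \<in> lists pi_gens" and id: "pi_perm \<rho> = id"
    and C: "config_q C \<noteq> 0" "config_q C - 1 \<noteq> 0" "config_p C \<noteq> (0 :: ratfun)"
  shows "\<exists>m. fold bt \<rho> C = shift_t (of_int m) C"
proof -
  have "map (pi_perm \<rho>) [0..<7] \<notin> odd_pi_lists"
    by (simp add: id upt_7)
  then have even: "even (length \<rho>)"
    using map_pi_perm[OF \<rho>] by presburger
  note f = pi_fold[OF \<rho> C(1,2)]
  obtain m where m: "config_t (fold bt \<rho> C) = of_int m + config_t C"
    using f(3) even by auto
  have pf: "pi_fn C i = pi_fn (fold bt \<rho> C) i" if "i \<in> {2, 4, 5}" for i
    using f(1)[OF that] even id by simp
  have a: "config_a (fold bt \<rho> C) j = config_a C j" if "j < 7" for j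
    using f(2)[OF that] id by simp
  have "config_a C 0 = config_a (fold bt \<rho> C) 0" using a[of 0] by simp
  note pq = pi_fn_inject[OF pf this C(3) two_nonzero_ratfun]
  have "fold bt \<rho> C = shift_t (of_int m) C"
    using pq a m by (intro config_coords_eqI) (simp_all add: add.commute)
  then show ?thesis by blast
qed

lemma rel_coords:
  assumes "rel_config R C D"
  shows "R (config_q C) (config_q D)" "R (config_p C) (config_p D)" "R (config_t C) (config_t D)"
    "j < 7 \<Longrightarrow> R (config_a C j) (config_a D j)"
proof -
  obtain q p t a0 a1 a2 a3 a4 a5 a6 where C: "C = Config q p t (a0, a1, a2, a3, a4, a5, a6)"
    by (metis config.exhaust prod.exhaust)
  obtain q' p' t' b0 b1 b2 b3 b4 b5 b6 where D: "D = Config q' p' t' (b0, b1, b2, b3, b4, b5, b6)"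
    by (metis config.exhaust prod.exhaust)
  show "R (config_q C) (config_q D)" "R (config_p C) (config_p D)" "R (config_t C) (config_t D)"
    using assms unfolding C D by simp_all
  show "R (config_a C j) (config_a D j)" if "j < 7"
    using assms less_7_cases[OF that] unfolding C D by (elim disjE) simp_all
qed

lemma (in substitution) ev_pi_fn:
  assumes "rel_config ev C D"
  shows "ev (pi_fn C i) (pi_fn D i)"
  using rel_coords(1,2)[OF assms] rel_coords(4)[OF assms, of 0] unfolding pi_fn_def Let_def
  by (auto intro!: ev_mult ev_add ev_diff ev_1)

text \<open>The orders 1, -1, -1 single out node 2 among the neighbours of the centre, whatever the
  Weyl word. This is how a rotation is detected.\<close>

lemma asym_pi_fn:
  assumes inv: "asym_inv w D" and w: "w \<in> lists E6_nodes"
  shows "fls_subdegree (pi_fn D 2) = 1" "fls_subdegree (pi_fn D 4) = - 1" "fls_subdegree (pi_fn D 5) = - 1"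
proof -
  define Q P a where "Q = config_q D" "P = config_p D" "a = config_a D 0"
  note defs = this
  define l where "l = lin_form (word_act w (unit_vec 0))"
  have sQ: "fls_subdegree Q = 1" and sP: "fls_subdegree P = - 1"
    and QP: "fls_nth (Q * P) 0 = lin_form (word_act w (unit_vec 7))" and a: "a = fls_const l"
    using inv by (simp_all add: asym_inv_def defs l_def)
  have nz: "Q \<noteq> 0" "P \<noteq> 0" using sQ sP by auto
  have sQP: "fls_subdegree (Q * P) = 0" using nz sQ sP by simp
  have fn: "pi_fn D 2 = Q * (Q * P + a)" "pi_fn D 4 = (Q - 1) * ((Q - 1) * P + a)" "pi_fn D 5 = P"
    by (simp_all add: pi_fn_def Let_def defs)
  show "fls_subdegree (pi_fn D 5) = - 1" by (simp add: fn sP)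
  have "fls_nth (Q * P + a) 0 \<noteq> 0"
    using lin_form_word_act_nonzero[OF w, of 0 1] QP by (simp add: a l_def)
  moreover have "fls_nth (Q * P + a) n = 0" if "n < 0" for n
    using that sQP by (simp add: a)
  ultimately have "fls_subdegree (Q * P + a) = 0" "Q * P + a \<noteq> 0"
    using fls_subdegree_eqI[of "Q * P + a" 0] by (blast, metis fls_zero_nth)
  then show "fls_subdegree (pi_fn D 2) = 1"
    using nz sQ by (simp add: fn)
  have Q1: "fls_subdegree (Q - 1) = 0" "Q - 1 \<noteq> 0"
  proof -
    have 1: "fls_nth (Q - 1) 0 = - 1" using sQ by simp
    then show "fls_subdegree (Q - 1) = 0" using sQ by (intro fls_subdegree_eqI) auto
    show "Q - 1 \<noteq> 0" using 1 by auto
  qed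
  have "fls_subdegree ((Q - 1) * P) = - 1" "(Q - 1) * P \<noteq> 0"
    using Q1 nz sP by simp_all
  moreover from this have "fls_subdegree ((Q - 1) * P + a) = - 1"
    using fls_subdegree_add_eq1[of "(Q - 1) * P" a] by (simp add: a)
  moreover from this have "(Q - 1) * P + a \<noteq> 0" by auto
  ultimately show "fls_subdegree (pi_fn D 4) = - 1"
    using Q1 by (simp add: fn)
qed

lemma fold_word_t: "w \<in> lists E6_nodes \<Longrightarrow> config_t (fold bt (map nodegen w) C) = config_t C"
proof (induction w arbitrary: C rule: list.induct)
  case (Cons i w)
  then show ?case by (simp add: config_q_bt(3) E6_nodes_eq)
qed simp

text \<open>As \<open>ev\<close> is single valued, the expansion transported along \<open>w\<close>
  agrees with the initial one. Comparing their leading data shows that \<open>w\<close> fixes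
  \<open>x\<close> and the simple roots modulo the null root.\<close>

lemma word_trivial:
  assumes w: "w \<in> lists E6_nodes"
    and triv: "fold bt (map nodegen w) generic_config = generic_config"
  shows "E6_word_eq w []"
proof -
  obtain D where D: "asym_inv w D" "rel_config asym.ev (fold bt (map nodegen w) generic_config) D"
    using asym_word[OF w] .
  have "rel_config asym.ev generic_config D" using D(2) triv by simp
  note r = rel_coords[OF this] and s = rel_coords[OF rel_asym]
  have eq: "config_q D = config_q asym_config" "config_p D = config_p asym_config"
    "\<And>j. j < 7 \<Longrightarrow> config_a D j = config_a asym_config j"
    using r s asym.ev_unique by metis+
  have lin: "lin_form (word_act w (unit_vec j)) = lin_form (unit_vec j)" if "j < 8" for j
  proof (cases "j = 7")
    case True
    then show ?thesis
      using D(1) asym_inv_Nil eq(1,2) by (simp add: asym_inv_def)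
  next
    case False
    then have "j < 7" using that by simp
    then have "fls_const (lin_form (word_act w (unit_vec j))) = fls_const (lin_form (unit_vec j))"
      using D(1) asym_inv_Nil eq(3) by (simp add: asym_inv_def)
    then show ?thesis by (metis fls_const_nth)
  qed
  define m where "m j = word_act w (unit_vec j) 1 - unit_vec j 1" for j
  have "word_act w (unit_vec j) = (\<lambda>k. unit_vec j k + m j * null_root k)" if j: "j < 8" for j
  proof
    fix k :: nat
    let ?c = "\<lambda>k. 1 * word_act w (unit_vec j) k + (- 1) * unit_vec j k"
    have 0: "lin_form ?c = 0"
      unfolding lin_form_lin using lin[OF j] by simp
    consider "k < 7" | "k = 7" | "k > 7" by linarith
    then show "word_act w (unit_vec j) k = unit_vec j k + m j * null_root k"
    proof cases
      case 1
      then show ?thesis using lin_form_eq_0(2)[OF 0 1] by (simp add: m_def)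
    next
      case 2
      then show ?thesis using lin_form_eq_0(1)[OF 0] by (simp add: null_root_def)
    next
      case 3
      then show ?thesis
        using word_act_outside[OF w, of k "unit_vec j"] by (simp add: null_root_def E6_nodes_eq)
    qed
  qed
  then show ?thesis
    by (rule word_act_faithful_mod_null_root[OF w])
qed

theorem kernel_trivial:
  assumes w: "w \<in> lists E6_nodes" and \<rho>: "\<rho> \<in> lists pi_gens"
    and shift: "map_config (word_aut w \<circ> aut \<rho>) generic_config = shift_t (rf_const c) generic_config"
  shows "E6_word_eq w [] \<and> pi_perm \<rho> = id"
proof -
  define C where "C = fold bt (map nodegen w) (generic_config :: ratfun config)"
  have fold: "fold bt \<rho> C = shift_t (rf_const c) generic_config"
    using shift by (simp add: C_def map_aut flip: aut_append)
  obtain D where D: "asym_inv w D" "rel_config asym.ev C D"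
    using asym_word[OF w] unfolding C_def .
  note r = rel_coords[OF D(2)]
  have sub: "fls_subdegree (config_q D) = 1" "fls_subdegree (config_p D) = - 1"
    using D(1) by (simp_all add: asym_inv_def)
  have "config_q D \<noteq> 0" "config_p D \<noteq> 0" "config_q D - 1 \<noteq> 0"
    using sub by auto
  then have C: "config_q C \<noteq> 0" "config_q C - 1 \<noteq> 0" "config_p C \<noteq> 0"
    using asym.ev_nonzero r(1,2) asym.ev_diff[OF r(1) asym.ev_1] by blast+
  note f = pi_fold[OF \<rho> C(1,2)]
  have Ct: "config_t C = rf_var Var_t"
    unfolding C_def by (simp add: fold_word_t[OF w] generic_coords)
  obtain m where m: "rf_var Var_t + rf_const c = of_int m + (- 1) ^ length \<rho> * rf_var Var_t"
    using f(3) unfolding fold Ct by (auto simp: generic_coords)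
  have even: "even (length \<rho>)"
  proof (rule ccontr)
    assume "odd (length \<rho>)"
    then have "2 * rf_var Var_t = rf_const (of_int m - c)"
      using m by (simp add: rf_const.h_diff rf_const.h_of_int algebra_simps)
    then show False using rf_var_t_not_const by blast
  qed
  \<comment> \<open>If \<open>\<rho>\<close> moved node 2, a function of order 1 along the curve
    would coincide with one of order -1.\<close>
  have 2: "pi_perm \<rho> 2 = 2"
  proof -
    have "pi_fn generic_config 2 = pi_fn C (pi_perm \<rho> 2)"
      using f(1)[of 2] even unfolding fold by simp
    then have "asym.ev (pi_fn generic_config 2) (pi_fn D (pi_perm \<rho> 2))"
      using asym.ev_pi_fn[OF D(2)] by simp
    then have "pi_fn asym_config 2 = pi_fn D (pi_perm \<rho> 2)"
      using asym.ev_pi_fn[OF rel_asym] asym.ev_unique by blast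
    then have "fls_subdegree (pi_fn D (pi_perm \<rho> 2)) = 1"
      using asym_pi_fn(1)[OF asym_inv_Nil] by simp
    moreover have "pi_perm \<rho> 2 \<in> {2, 4, 5}" by (rule pi_perm_245[OF \<rho>]) simp
    ultimately show ?thesis using asym_pi_fn[OF D(1) w] by auto
  qed
  have "map (pi_perm \<rho>) [0..<7] \<in> even_pi_lists"
    using map_pi_perm[OF \<rho>] even by presburger
  then have "map (pi_perm \<rho>) [0..<7] = map (pi_perm []) [0..<7]"
    using 2 unfolding upt_7 by auto
  then have id: "pi_perm \<rho> = id"
    using diagram_aut_eqI[OF pi_perm_diagram_aut[OF \<rho>] pi_perm_diagram_aut[of "[]"]] by simp
  obtain n where n: "fold bt \<rho> C = shift_t (of_int n) C"
    using pi_perm_id_imp_shift[OF \<rho> id C] by blast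
  \<comment> \<open>A word with trivial permutation only shifts time, so the Weyl part alone already
    restores \<open>q\<close>, \<open>p\<close> and the parameters, and it never moves time.\<close>
  have "C = generic_config"
  proof (rule config_coords_eqI)
    have eq: "shift_t (of_int n) C = shift_t (rf_const c) generic_config" using n fold by simp
    show "config_q C = config_q generic_config" using arg_cong[OF eq, of config_q] by simp
    show "config_p C = config_p generic_config" using arg_cong[OF eq, of config_p] by simp
    show "config_t C = config_t generic_config" by (simp add: Ct generic_coords)
    show "config_a C j = config_a generic_config j" for j using arg_cong[OF eq, of config_a] by simp
  qed
  then have "E6_word_eq w []"
    using word_trivial[OF w] by (simp add: C_def)
  with id show ?thesis by blast
qed

subsection \<open>The group generated by the transformations\<close>

lemma bt_aut_in_generate: "aut us \<in> generate ratfun_Aut (range bt_aut)"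
proof (induction us)
  case Nil
  show ?case using generate.one[of ratfun_Aut "range bt_aut"] unfolding ratfun_Aut_simps aut_Nil .
next
  case (Cons g us)
  have "bt_aut g \<otimes>\<^bsub>ratfun_Aut\<^esub> aut us \<in> generate ratfun_Aut (range bt_aut)"
    by (intro generate.eng generate.incl Cons) simp
  then show ?case
    unfolding aut_Cons ratfun_Aut_simps .
qed

text \<open>The generators are involutions, so \<open>generate\<close> produces nothing beyond words
  without inverses.\<close>

lemma carrier_bt_group_range: "carrier bt_group = range aut"
proof -
  interpret group ratfun_Aut by (rule group_ratfun_Aut)
  have "\<sigma> \<in> range aut" if "\<sigma> \<in> generate ratfun_Aut (range bt_aut)" for \<sigma>
    using that
  proof induction
    case one
    show ?case by (rule range_eqI[of _ _ "[]"]) simp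
  next
    case (incl h)
    then obtain g where "h = bt_aut g" by blast
    then show ?case by (intro range_eqI[of _ _ "[g]"]) (simp add: aut_Cons)
  next
    case (inv h)
    then obtain g where h: "h = bt_aut g" by blast
    have "inv\<^bsub>ratfun_Aut\<^esub> h = h"
      unfolding h using bt_aut(1) bt_aut_involution by (intro inv_equality) simp_all
    then show ?case using h by (intro range_eqI[of _ _ "[g]"]) (simp add: aut_Cons)
  next
    case (eng h1 h2)
    then obtain us vs where "h1 = aut us" "h2 = aut vs" by blast
    then show ?case by (intro range_eqI[of _ _ "us @ vs"]) (simp add: aut_append)
  qed
  then show ?thesis
    using bt_aut_in_generate by (auto simp: bt_group_def)
qed

lemma group_bt_group: "group bt_group"
proof -
  interpret group ratfun_Aut by (rule group_ratfun_Aut)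
  have "subgroup (generate ratfun_Aut (range bt_aut)) ratfun_Aut"
    using bt_aut(1) by (intro generate_is_subgroup) auto
  then show ?thesis
    unfolding bt_group_def by (intro subgroup.subgroup_is_group group_axioms)
qed

lemma bt_group_simps [simp]: "\<one>\<^bsub>bt_group\<^esub> = id" "x \<otimes>\<^bsub>bt_group\<^esub> y = x \<circ> y"
  by (simp_all add: bt_group_def)

lemma inv_bt_group: "inv\<^bsub>bt_group\<^esub> (aut us) = aut (rev us)"
proof -
  interpret group bt_group by (rule group_bt_group)
  show ?thesis
    using aut_rev[of "rev us"] by (intro inv_equality) (simp_all add: carrier_bt_group_range)
qed

text \<open>Diagram generators are moved to the right past the Weyl letters, which they permute.
  This is the semidirect decomposition on the level of words.\<close>

lemma aut_normal_form:
  obtains w \<rho> where "w \<in> lists E6_nodes" "\<rho> \<in> lists pi_gens" "aut us = word_aut w \<circ> aut \<rho>"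
proof -
  have "\<exists>w \<rho>. w \<in> lists E6_nodes \<and> \<rho> \<in> lists pi_gens \<and> aut us = word_aut w \<circ> aut \<rho>"
  proof (induction us)
    case Nil
    show ?case by (intro exI[of _ "[]"]) simp
  next
    case (Cons g us)
    then obtain w \<rho> where *: "w \<in> lists E6_nodes" "\<rho> \<in> lists pi_gens" "aut us = word_aut w \<circ> aut \<rho>"
      by blast
    have "g \<in> pi_gens \<or> (\<exists>i\<in>E6_nodes. g = nodegen i)"
      by (cases g) (auto simp: E6_nodes_eq lessThan_7)
    then show ?case
    proof
      assume g: "g \<in> pi_gens"
      have "aut (g # us) = word_aut (map (snd (E6_gen g)) w) \<circ> aut (g # \<rho>)"
        unfolding aut_Cons *(3) using bt_aut_word_aut[OF g *(1)] by (metis comp_assoc)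
      moreover have "map (snd (E6_gen g)) w \<in> lists E6_nodes"
        using *(1) pi_gen_nodes[OF g] by (simp add: E6_nodes_eq in_lists_conv_set)
      moreover have "g # \<rho> \<in> lists pi_gens" using g *(2) unfolding Cons_in_lists_iff by blast
      ultimately show ?thesis by blast
    next
      assume "\<exists>i\<in>E6_nodes. g = nodegen i"
      then obtain i where i: "i \<in> E6_nodes" "g = nodegen i" by blast
      have "aut (g # us) = word_aut (i # w) \<circ> aut \<rho>"
        unfolding list.map aut_Cons *(3) i(2) by (simp only: comp_assoc)
      moreover have "i # w \<in> lists E6_nodes" using i *(1) by simp
      ultimately show ?thesis using *(2) by blast
    qed
  qed
  with that show ?thesis by blast
qed

lemma time_shifts_iff:
  "\<sigma> \<in> time_shifts \<longleftrightarrow> \<sigma> \<in> carrier bt_group \<and>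
     (\<exists>c. map_config \<sigma> generic_config = shift_t (rf_const c) generic_config)"
  by (simp add: time_shifts_def generic_config_def)

lemma map_shift_t:
  assumes "\<sigma> \<in> carrier ratfun_Aut"
  shows "map_config \<sigma> (shift_t (rf_const c) C) = shift_t (rf_const c) (map_config \<sigma> C)"
  using assms by (cases C) (auto simp: carrier_ratfun_Aut_iff field_morphism_def)

lemma bt_shift_t: "bt g (shift_t c C) = shift_t (if g \<in> pi_gens then - c else c) (bt g C)"
proof -
  obtain q p t a0 a1 a2 a3 a4 a5 a6 where C: "C = Config q p t (a0, a1, a2, a3, a4, a5, a6)"
    by (metis config.exhaust prod.exhaust)
  show ?thesis unfolding C by (cases g) simp_all
qed

lemma carrier_bt_group_Aut: "\<sigma> \<in> carrier bt_group \<Longrightarrow> \<sigma> \<in> carrier ratfun_Aut"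
  using aut_carrier by (auto simp: carrier_bt_group_range)

text \<open>The generator is its own inverse, so this is conjugation by it. A diagram generator
  reverses time and turns the shift by \<open>c\<close> into one by \<open>- c\<close>.\<close>

lemma time_shifts_conj:
  assumes "\<tau> \<in> time_shifts"
  shows "bt_aut g \<circ> \<tau> \<circ> bt_aut g \<in> time_shifts"
proof -
  obtain c where \<tau>: "\<tau> \<in> carrier bt_group" "map_config \<tau> generic_config = shift_t (rf_const c) generic_config"
    using assms time_shifts_iff by blast
  then obtain us where us: "\<tau> = aut us" by (auto simp: carrier_bt_group_range)
  have mem: "bt_aut g \<circ> \<tau> \<circ> bt_aut g \<in> carrier bt_group"
    unfolding carrier_bt_group_range us by (rule range_eqI[of _ _ "g # us @ [g]"]) (simp add: aut_Cons aut_append comp_assoc)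
  interpret s: field_morphism "bt_aut g" using bt_aut(1) by (simp add: carrier_ratfun_Aut_iff)
  interpret t: field_morphism \<tau> using carrier_bt_group_Aut[OF \<tau>(1)] by (simp add: carrier_ratfun_Aut_iff)
  have "map_config (bt_aut g \<circ> \<tau> \<circ> bt_aut g) generic_config =
      map_config (bt_aut g) (map_config \<tau> (map_config (bt_aut g) generic_config))"
    by (simp only: config.map_comp comp_assoc)
  also have "\<dots> = bt g (shift_t (rf_const c) (bt g generic_config))"
    unfolding bt_aut(2) t.map_bt \<tau>(2) s.map_bt map_shift_t[OF bt_aut(1)] ..
  also have "\<dots> = shift_t (rf_const (if g \<in> pi_gens then - c else c)) generic_config"
    unfolding bt_shift_t bt_bt_good[OF good_generic] by (simp add: rf_const.h_minus)
  finally show ?thesis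
    using mem time_shifts_iff by blast
qed

lemma time_shifts_conj_aut:
  "\<tau> \<in> time_shifts \<Longrightarrow> aut us \<circ> \<tau> \<circ> aut (rev us) \<in> time_shifts"
proof (induction us)
  case (Cons g us)
  have eq: "aut (g # us) \<circ> \<tau> \<circ> aut (rev (g # us)) = bt_aut g \<circ> (aut us \<circ> \<tau> \<circ> aut (rev us)) \<circ> bt_aut g"
    by (simp add: aut_Cons aut_append fun_eq_iff)
  show ?case
    unfolding eq by (rule time_shifts_conj[OF Cons.IH[OF Cons.prems]])
qed simp

theorem time_shifts_normal: "time_shifts \<lhd> bt_group"
proof -
  interpret group bt_group by (rule group_bt_group)
  have "subgroup time_shifts bt_group"
  proof (rule subgroupI)
    show "time_shifts \<subseteq> carrier bt_group" by (auto simp: time_shifts_def)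
    have "shift_t (rf_const 0) generic_config = generic_config"
      by (simp add: generic_config_def)
    then have "\<one>\<^bsub>bt_group\<^esub> \<in> time_shifts"
      using one_closed unfolding time_shifts_iff by (auto simp: config.map_id intro!: exI[of _ 0])
    then show "time_shifts \<noteq> {}" by blast
  next
    fix \<sigma> assume "\<sigma> \<in> time_shifts"
    then obtain c where \<sigma>: "\<sigma> \<in> carrier bt_group" "map_config \<sigma> generic_config = shift_t (rf_const c) generic_config"
      using time_shifts_iff by blast
    let ?\<tau> = "inv\<^bsub>bt_group\<^esub> \<sigma>"
    have \<tau>: "?\<tau> \<in> carrier bt_group" using \<sigma>(1) by simp
    have "generic_config = map_config (?\<tau> \<circ> \<sigma>) generic_config"
      using l_inv[OF \<sigma>(1)] by (simp add: config.map_id)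
    also have "\<dots> = map_config ?\<tau> (map_config \<sigma> generic_config)"
      by (simp only: config.map_comp)
    also have "\<dots> = shift_t (rf_const c) (map_config ?\<tau> generic_config)"
      unfolding \<sigma>(2) by (rule map_shift_t[OF carrier_bt_group_Aut[OF \<tau>]])
    finally have "shift_t (rf_const (- c)) generic_config =
        shift_t (rf_const (- c)) (shift_t (rf_const c) (map_config ?\<tau> generic_config))"
      by simp
    also have "\<dots> = map_config ?\<tau> generic_config"
      by (cases "map_config ?\<tau> generic_config") (simp add: rf_const.h_minus)
    finally show "?\<tau> \<in> time_shifts"
      using \<tau> time_shifts_iff by metis
  next
    fix \<sigma> \<tau> assume "\<sigma> \<in> time_shifts" "\<tau> \<in> time_shifts"
    then obtain c d where \<sigma>: "\<sigma> \<in> carrier bt_group" "map_config \<sigma> generic_config = shift_t (rf_const c) generic_config"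
      and \<tau>: "\<tau> \<in> carrier bt_group" "map_config \<tau> generic_config = shift_t (rf_const d) generic_config"
      using time_shifts_iff by blast
    have "map_config (\<sigma> \<circ> \<tau>) generic_config = map_config \<sigma> (map_config \<tau> generic_config)"
      by (simp only: config.map_comp)
    also have "\<dots> = shift_t (rf_const d) (shift_t (rf_const c) generic_config)"
      unfolding \<tau>(2) map_shift_t[OF carrier_bt_group_Aut[OF \<sigma>(1)]] \<sigma>(2) ..
    also have "\<dots> = shift_t (rf_const (c + d)) generic_config"
      by (simp add: generic_config_def rf_const.h_add)
    finally show "\<sigma> \<otimes>\<^bsub>bt_group\<^esub> \<tau> \<in> time_shifts"
      using m_closed[OF \<sigma>(1) \<tau>(1)] time_shifts_iff by auto
  qed
  moreover have "x \<otimes>\<^bsub>bt_group\<^esub> h \<otimes>\<^bsub>bt_group\<^esub> inv\<^bsub>bt_group\<^esub> x \<in> time_shifts"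
    if x: "x \<in> carrier bt_group" and h: "h \<in> time_shifts" for x h
  proof -
    obtain us where us: "x = aut us" using x by (auto simp: carrier_bt_group_range)
    show ?thesis
      unfolding us inv_bt_group bt_group_simps by (rule time_shifts_conj_aut[OF h])
  qed
  ultimately show ?thesis
    unfolding normal_inv_iff by blast
qed

subsection \<open>The isomorphism\<close>

lemma E6_class_eq_iff:
  assumes "w \<in> lists E6_nodes"
  shows "E6_class w = E6_class v \<longleftrightarrow> E6_word_eq w v"
proof
  assume "E6_class w = E6_class v"
  moreover have "w \<in> E6_class w" using assms by (simp add: E6_class_def E6_word_eq.refl)
  ultimately have "E6_word_eq v w" by (simp add: E6_class_def)
  then show "E6_word_eq w v" by (rule E6_word_eq.sym)
next
  assume "E6_word_eq w v"
  then show "E6_class w = E6_class v"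
    unfolding E6_class_def using E6_word_eq.trans E6_word_eq.sym by blast
qed

lemma E6_word_eq_map:
  assumes \<pi>: "\<pi> \<in> E6_diagram_auts" and "E6_word_eq u v"
  shows "E6_word_eq (map \<pi> u) (map \<pi> v)"
  using assms(2)
proof (induction rule: E6_word_eq.induct)
  have l: "map \<pi> w \<in> lists E6_nodes" if "w \<in> lists E6_nodes" for w
    using that diagram_aut_nodes[OF \<pi>] by (simp add: in_lists_conv_set)
  case (refl w)
  show ?case by (rule E6_word_eq.refl[OF l[OF refl]])
next
  case (sym u v)
  show ?case by (rule E6_word_eq.sym[OF sym.IH])
next
  case (trans u v w)
  show ?case by (rule E6_word_eq.trans[OF trans.IH])
next
  have l: "map \<pi> w \<in> lists E6_nodes" if "w \<in> lists E6_nodes" for w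
    using that diagram_aut_nodes[OF \<pi>] by (simp add: in_lists_conv_set)
  case (rel i j u v)
  have "\<pi> i = \<pi> j \<longleftrightarrow> i = j"
    using \<pi> permutes_inj[of \<pi>] by (auto simp: E6_diagram_auts_def inj_eq)
  moreover have "{\<pi> i, \<pi> j} \<in> E6_edges \<longleftrightarrow> {i, j} \<in> E6_edges"
    using \<pi> rel(1,2) by (simp add: E6_diagram_auts_def)
  ultimately have "E6_order i j = E6_order (\<pi> i) (\<pi> j)"
    by (simp add: E6_order_def)
  moreover have "E6_word_eq (map \<pi> u @ concat (replicate (E6_order (\<pi> i) (\<pi> j)) [\<pi> i, \<pi> j]) @ map \<pi> v)
      (map \<pi> u @ map \<pi> v)"
    using rel diagram_aut_nodes[OF \<pi>] by (intro E6_word_eq.rel l) simp_all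
  ultimately show ?case
    by (simp add: map_concat)
qed

lemma ext_mult:
  assumes "w \<in> lists E6_nodes" "v \<in> lists E6_nodes" "\<pi> \<in> E6_diagram_auts"
  shows "(E6_class w, \<pi>) \<otimes>\<^bsub>ext_affine_weyl_E6\<^esub> (E6_class v, \<rho>) = (E6_class (w @ map \<pi> v), \<pi> \<circ> \<rho>)"
proof -
  have "E6_class (x @ map \<pi> y) = E6_class (w @ map \<pi> v)" if "x \<in> E6_class w" "y \<in> E6_class v" for x y
  proof -
    have "E6_word_eq (w @ map \<pi> v) (x @ map \<pi> y)"
      using that E6_word_eq_map[OF assms(3)] by (intro E6_word_eq_append) (simp_all add: E6_class_def)
    then show ?thesis
      using E6_class_eq_iff E6_word_eq_lists by metis
  qed
  moreover have "w \<in> E6_class w" "v \<in> E6_class v"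
    using assms by (simp_all add: E6_class_def E6_word_eq.refl)
  ultimately have "(\<Union>x\<in>E6_class w. \<Union>y\<in>map \<pi> ` E6_class v. E6_class (x @ y)) = E6_class (w @ map \<pi> v)"
    by blast
  then show ?thesis
    by (simp add: ext_affine_weyl_E6_def affine_weyl_E6_def)
qed

text \<open>A relation rather than a function, because a diagram automorphism has many words in the
  \<open>Pi\<close> generators and these agree only up to a time shift.\<close>

inductive realises :: "nat list set \<times> (nat \<Rightarrow> nat) \<Rightarrow> (ratfun \<Rightarrow> ratfun) \<Rightarrow> bool" where
  "w \<in> lists E6_nodes \<Longrightarrow> \<rho> \<in> lists pi_gens \<Longrightarrow>
     realises (E6_class w, pi_perm \<rho>) (word_aut w \<circ> aut \<rho>)"

lemma realises_carrier:
  assumes "realises x \<sigma>"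
  shows "x \<in> carrier ext_affine_weyl_E6" "\<sigma> \<in> carrier bt_group"
proof -
  obtain w \<rho> where x: "x = (E6_class w, pi_perm \<rho>)" "\<sigma> = word_aut w \<circ> aut \<rho>"
    "w \<in> lists E6_nodes" "\<rho> \<in> lists pi_gens"
    using assms by (cases rule: realises.cases)
  then show "x \<in> carrier ext_affine_weyl_E6"
    by (simp add: ext_affine_weyl_E6_def affine_weyl_E6_def pi_perm_diagram_aut del: in_lists_conv_set)
  show "\<sigma> \<in> carrier bt_group"
    unfolding x(2) carrier_bt_group_range aut_append[symmetric] by (rule rangeI)
qed

lemma realises_total:
  assumes "x \<in> carrier ext_affine_weyl_E6"
  shows "\<exists>\<sigma>. realises x \<sigma>"
proof -
  obtain w \<pi> where x: "x = (E6_class w, \<pi>)" "w \<in> lists E6_nodes" "\<pi> \<in> E6_diagram_auts"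
    using assms by (auto simp: ext_affine_weyl_E6_def affine_weyl_E6_def)
  obtain \<rho> where "\<rho> \<in> lists pi_gens" "pi_perm \<rho> = \<pi>"
    using diagram_aut_is_pi_perm[OF x(3)] .
  with x realises.intros[OF x(2)] show ?thesis by blast
qed

lemma realises_onto:
  assumes "\<sigma> \<in> carrier bt_group"
  shows "\<exists>x. realises x \<sigma>"
proof -
  obtain us where "\<sigma> = aut us" using assms by (auto simp: carrier_bt_group_range)
  then show ?thesis
    using aut_normal_form[of us] realises.intros by metis
qed

lemma realises_mult:
  assumes "realises x \<sigma>" "realises y \<tau>"
  shows "realises (x \<otimes>\<^bsub>ext_affine_weyl_E6\<^esub> y) (\<sigma> \<circ> \<tau>)"
  using assms(1)
proof (cases rule: realises.cases)
  case (1 w \<rho>)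
  note x = this
  show ?thesis
    using assms(2)
  proof (cases rule: realises.cases)
    case (1 v \<rho>')
    note y = this
    have l: "map (pi_perm \<rho>) v \<in> lists E6_nodes"
      using y(3) pi_perm_nodes[OF x(4)] by (simp add: in_lists_conv_set)
    have "\<sigma> \<circ> \<tau> = word_aut w \<circ> (aut \<rho> \<circ> word_aut v) \<circ> aut \<rho>'"
      unfolding x(2) y(2) by (simp only: comp_assoc)
    also have "\<dots> = word_aut (w @ map (pi_perm \<rho>) v) \<circ> aut (\<rho> @ \<rho>')"
      unfolding aut_word_aut[OF x(4) y(3)] map_append aut_append by (simp only: comp_assoc)
    finally have "\<sigma> \<circ> \<tau> = word_aut (w @ map (pi_perm \<rho>) v) \<circ> aut (\<rho> @ \<rho>')" .
    moreover have "x \<otimes>\<^bsub>ext_affine_weyl_E6\<^esub> y = (E6_class (w @ map (pi_perm \<rho>) v), pi_perm (\<rho> @ \<rho>'))"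
      unfolding x(1) y(1) ext_mult[OF x(3) y(3) pi_perm_diagram_aut[OF x(4)]] pi_perm_append ..
    moreover have "w @ map (pi_perm \<rho>) v \<in> lists E6_nodes" "\<rho> @ \<rho>' \<in> lists pi_gens"
      using x(3,4) y(4) l by (simp_all only: append_in_lists_conv)
    ultimately show ?thesis
      using realises.intros by metis
  qed
qed

lemma pi_perm_rev: "pi_perm \<rho> \<circ> pi_perm (rev \<rho>) = id"
proof (induction \<rho>)
  case (Cons g \<rho>)
  have g: "snd (E6_gen g) \<circ> snd (E6_gen g) = id"
    by (cases g) (auto simp: fun_eq_iff Transposition.transpose_def)
  have "pi_perm (g # \<rho>) \<circ> pi_perm (rev (g # \<rho>)) =
      snd (E6_gen g) \<circ> (pi_perm \<rho> \<circ> pi_perm (rev \<rho>)) \<circ> snd (E6_gen g)"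
    by (simp add: pi_perm_Cons pi_perm_append comp_assoc)
  then show ?case unfolding Cons comp_id g .
qed simp

text \<open>Gives at once that the map to cosets is well defined and that it is injective. Both
  directions study the quotient of \<open>\<tau>\<close> by \<open>\<sigma>\<close>, which is
  \<open>v\<close> times \<open>\<kappa>\<close> times \<open>rev w\<close>. If
  \<open>x = y\<close>, it is a conjugate of the time shift \<open>aut \<kappa>\<close>; conversely,
  \<open>kernel_trivial\<close> applies once \<open>\<kappa>\<close> has been moved to the
  right.\<close>

lemma realises_unique:
  assumes "realises x \<sigma>" "realises y \<tau>"
  shows "x = y \<longleftrightarrow> time_shifts #>\<^bsub>bt_group\<^esub> \<sigma> = time_shifts #>\<^bsub>bt_group\<^esub> \<tau>"
proof -
  interpret normal time_shifts bt_group by (rule time_shifts_normal)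
  obtain w \<rho> where x: "x = (E6_class w, pi_perm \<rho>)" "\<sigma> = word_aut w \<circ> aut \<rho>"
    "w \<in> lists E6_nodes" "\<rho> \<in> lists pi_gens"
    using assms(1) by (cases rule: realises.cases)
  obtain v \<rho>' where y: "y = (E6_class v, pi_perm \<rho>')" "\<tau> = word_aut v \<circ> aut \<rho>'"
    "v \<in> lists E6_nodes" "\<rho>' \<in> lists pi_gens"
    using assms(2) by (cases rule: realises.cases)
  note \<sigma> = realises_carrier(2)[OF assms(1)] and \<tau> = realises_carrier(2)[OF assms(2)]
  define \<kappa> where "\<kappa> = \<rho>' @ rev \<rho>"
  have \<kappa>: "\<kappa> \<in> lists pi_gens"
    using x(4) y(4) by (auto simp: \<kappa>_def in_lists_conv_set)
  have inv: "inv\<^bsub>bt_group\<^esub> \<sigma> = aut (rev \<rho>) \<circ> word_aut (rev w)"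
    unfolding x(2) aut_append[symmetric] inv_bt_group by (simp add: rev_map)
  have quot: "\<tau> \<circ> inv\<^bsub>bt_group\<^esub> \<sigma> = word_aut v \<circ> aut \<kappa> \<circ> word_aut (rev w)"
    unfolding inv y(2) \<kappa>_def aut_append by (simp only: comp_assoc)
  have coset: "time_shifts #>\<^bsub>bt_group\<^esub> \<sigma> = time_shifts #>\<^bsub>bt_group\<^esub> \<tau> \<longleftrightarrow> \<tau> \<circ> inv\<^bsub>bt_group\<^esub> \<sigma> \<in> time_shifts"
  proof -
    have "\<tau> \<in> time_shifts #>\<^bsub>bt_group\<^esub> \<sigma> \<longleftrightarrow> \<tau> \<otimes>\<^bsub>bt_group\<^esub> inv\<^bsub>bt_group\<^esub> \<sigma> \<in> time_shifts"
      using \<sigma> \<tau> rcos_module by simp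
    moreover have "\<tau> \<in> time_shifts #>\<^bsub>bt_group\<^esub> \<sigma> \<longleftrightarrow>
        time_shifts #>\<^bsub>bt_group\<^esub> \<sigma> = time_shifts #>\<^bsub>bt_group\<^esub> \<tau>"
      using repr_independence[OF _ \<sigma> subgroup_axioms] rcos_self[OF \<tau> subgroup_axioms] by metis
    ultimately show ?thesis by simp
  qed
  have perm: "pi_perm \<kappa> = id \<longleftrightarrow> pi_perm \<rho> = pi_perm \<rho>'"
  proof
    assume "pi_perm \<kappa> = id"
    then have "pi_perm \<rho>' \<circ> (pi_perm (rev \<rho>) \<circ> pi_perm \<rho>) = pi_perm \<rho>"
      by (simp add: \<kappa>_def pi_perm_append o_assoc)
    then show "pi_perm \<rho> = pi_perm \<rho>'" using pi_perm_rev[of "rev \<rho>"] by simp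
  next
    assume "pi_perm \<rho> = pi_perm \<rho>'"
    then show "pi_perm \<kappa> = id" using pi_perm_rev[of \<rho>] by (simp add: \<kappa>_def pi_perm_append)
  qed
  show ?thesis
  proof
    assume "x = y"
    then have "E6_word_eq w v" "pi_perm \<rho> = pi_perm \<rho>'"
      using x(1) y(1) E6_class_eq_iff[OF x(3)] by auto
    then have w: "word_aut v = word_aut w" and id: "pi_perm \<kappa> = id"
      using word_aut_cong perm by auto
    obtain m where "fold bt \<kappa> generic_config = shift_t (of_int m) (generic_config :: ratfun config)"
      using pi_perm_id_imp_shift[OF \<kappa> id generic_nonzero] by blast
    then have "map_config (aut \<kappa>) generic_config = shift_t (rf_const (of_int m)) generic_config"
      by (simp add: map_aut rf_const.h_of_int)
    then have "aut \<kappa> \<in> time_shifts"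
      unfolding time_shifts_iff carrier_bt_group_range by blast
    then have "\<tau> \<circ> inv\<^bsub>bt_group\<^esub> \<sigma> \<in> time_shifts"
      unfolding quot w using time_shifts_conj_aut[of "aut \<kappa>" "map nodegen w"] by (simp add: rev_map)
    then show "time_shifts #>\<^bsub>bt_group\<^esub> \<sigma> = time_shifts #>\<^bsub>bt_group\<^esub> \<tau>"
      using coset by blast
  next
    assume "time_shifts #>\<^bsub>bt_group\<^esub> \<sigma> = time_shifts #>\<^bsub>bt_group\<^esub> \<tau>"
    then have "\<tau> \<circ> inv\<^bsub>bt_group\<^esub> \<sigma> \<in> time_shifts"
      using coset by blast
    then obtain c where c: "map_config (word_aut v \<circ> aut \<kappa> \<circ> word_aut (rev w)) generic_config = shift_t (rf_const c) generic_config"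
      unfolding quot time_shifts_iff by blast
    have rw: "rev w \<in> lists E6_nodes" using x(3) by (simp add: in_lists_conv_set)
    have "word_aut v \<circ> aut \<kappa> \<circ> word_aut (rev w) = word_aut v \<circ> (aut \<kappa> \<circ> word_aut (rev w))"
      by (simp only: comp_assoc)
    also have "\<dots> = word_aut (v @ map (pi_perm \<kappa>) (rev w)) \<circ> aut \<kappa>"
      unfolding aut_word_aut[OF \<kappa> rw] map_append aut_append by (simp only: comp_assoc)
    finally have "map_config (word_aut (v @ map (pi_perm \<kappa>) (rev w)) \<circ> aut \<kappa>) generic_config = shift_t (rf_const c) generic_config"
      using c by (simp only:)
    moreover have "v @ map (pi_perm \<kappa>) (rev w) \<in> lists E6_nodes"
      using x(3) y(3) pi_perm_nodes[OF \<kappa>] by (auto simp: in_lists_conv_set)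
    ultimately have *: "E6_word_eq (v @ map (pi_perm \<kappa>) (rev w)) []" and id: "pi_perm \<kappa> = id"
      using kernel_trivial[OF _ \<kappa>] by blast+
    from * id have "E6_word_eq (v @ rev w) []" by simp
    then have "E6_word_eq ((v @ rev w) @ w) ([] @ w)"
      by (rule E6_word_eq_append_right[OF _ x(3)])
    then have "E6_word_eq v w"
      using E6_word_eq_cancel[OF rw, of v w] by simp
    then have "E6_class w = E6_class v"
      using E6_class_eq_iff[OF y(3), of w] by simp
    then show "x = y" using id perm x(1) y(1) by simp
  qed
qed

lemma realises_gen: "realises (E6_gen g) (bt_aut g)"
proof -
  have node: "realises (E6_class [i], id) (bt_aut (nodegen i))" if "i < 7" for i
    using realises.intros[of "[i]" "[]"] that by (simp add: aut_Cons E6_nodes_eq)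
  have "realises (E6_class [], snd (E6_gen g)) (bt_aut g)" if "g \<in> pi_gens" for g
    using realises.intros[of "[]" "[g]"] that by (simp add: aut_Cons pi_perm_Cons)
  from this[of Pi1] this[of Pi2] this[of Pi3] node[of 0] node[of 1] node[of 2] node[of 3] node[of 4]
    node[of 5] node[of 6]
  show ?thesis by (cases g) simp_all
qed

theorem ext_affine_weyl_iso:
  "\<exists>\<phi> \<in> iso ext_affine_weyl_E6 (bt_group Mod time_shifts).
     \<forall>g. \<phi> (E6_gen g) = time_shifts #>\<^bsub>bt_group\<^esub> bt_aut g"
proof -
  interpret normal time_shifts bt_group by (rule time_shifts_normal)
  \<comment> \<open>The choice of a realising automorphism is immaterial: by
    \<open>realises_unique\<close> all of them lie in one coset.\<close>
  define \<phi> where "\<phi> x = time_shifts #>\<^bsub>bt_group\<^esub> (SOME \<sigma>. realises x \<sigma>)" for x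
  have \<phi>: "\<phi> x = time_shifts #>\<^bsub>bt_group\<^esub> \<sigma>" if "realises x \<sigma>" for x \<sigma>
    unfolding \<phi>_def using realises_unique[OF someI[of "realises x", OF that] that] by blast
  have "\<phi> \<in> hom ext_affine_weyl_E6 (bt_group Mod time_shifts)"
  proof (rule homI)
    fix x assume "x \<in> carrier ext_affine_weyl_E6"
    then obtain \<sigma> where \<sigma>: "realises x \<sigma>" using realises_total by blast
    then show "\<phi> x \<in> carrier (bt_group Mod time_shifts)"
      using realises_carrier(2)[OF \<sigma>] \<phi>[OF \<sigma>] by (auto simp: FactGroup_def RCOSETS_def)
  next
    fix x y assume "x \<in> carrier ext_affine_weyl_E6" "y \<in> carrier ext_affine_weyl_E6"
    then obtain \<sigma> \<tau> where \<sigma>: "realises x \<sigma>" and \<tau>: "realises y \<tau>" using realises_total by blast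
    show "\<phi> (x \<otimes>\<^bsub>ext_affine_weyl_E6\<^esub> y) = \<phi> x \<otimes>\<^bsub>bt_group Mod time_shifts\<^esub> \<phi> y"
      using rcos_sum[OF realises_carrier(2)[OF \<sigma>] realises_carrier(2)[OF \<tau>]]
      unfolding \<phi>[OF \<sigma>] \<phi>[OF \<tau>] \<phi>[OF realises_mult[OF \<sigma> \<tau>]] by (simp add: FactGroup_def)
  qed
  moreover have "inj_on \<phi> (carrier ext_affine_weyl_E6)"
  proof (rule inj_onI)
    fix x y assume "x \<in> carrier ext_affine_weyl_E6" "y \<in> carrier ext_affine_weyl_E6" and eq: "\<phi> x = \<phi> y"
    then obtain \<sigma> \<tau> where "realises x \<sigma>" "realises y \<tau>" using realises_total by blast
    with eq \<phi> realises_unique show "x = y" by metis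
  qed
  moreover have "\<phi> ` carrier ext_affine_weyl_E6 = carrier (bt_group Mod time_shifts)"
  proof
    show "\<phi> ` carrier ext_affine_weyl_E6 \<subseteq> carrier (bt_group Mod time_shifts)"
      using calculation(1) by (auto simp: hom_def)
    show "carrier (bt_group Mod time_shifts) \<subseteq> \<phi> ` carrier ext_affine_weyl_E6"
    proof
      fix X assume "X \<in> carrier (bt_group Mod time_shifts)"
      then obtain \<sigma> where \<sigma>: "\<sigma> \<in> carrier bt_group" "X = time_shifts #>\<^bsub>bt_group\<^esub> \<sigma>"
        by (auto simp: FactGroup_def RCOSETS_def)
      then obtain x where "realises x \<sigma>" using realises_onto by blast
      then show "X \<in> \<phi> ` carrier ext_affine_weyl_E6"
        using \<phi> \<sigma>(2) realises_carrier(1) by blast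
    qed
  qed
  ultimately have "\<phi> \<in> iso ext_affine_weyl_E6 (bt_group Mod time_shifts)"
    by (simp add: iso_def bij_betw_def)
  then show ?thesis
    using \<phi>[OF realises_gen] by blast
qed

theorem theorem3p1:
  shows "(\<forall>g. backlund_transformation g) \<and>
    (\<forall>g. \<exists>!\<sigma>. induces g \<sigma>) \<and>
    time_shifts \<lhd> bt_group \<and>
    (\<forall>g\<in>{Pi1, Pi2, Pi3}. snd (E6_gen g) \<in> E6_diagram_auts) \<and>
    (\<exists>\<phi> \<in> iso ext_affine_weyl_E6 (bt_group Mod time_shifts).
       \<forall>g. \<phi> (E6_gen g) = time_shifts #>\<^bsub>bt_group\<^esub> bt_aut g)"
  using backlund induces_unique time_shifts_normal pi_gen_diagram_aut ext_affine_weyl_iso by blast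

end
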